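(* Let $G$ be a locally compact group such that $L^{1}(G)$ is separable (e.g. $G$ second countable). Then a functional $\varphi\in L^{\infty}(G)=L^{1}(G)^{*}$ is right Asplund if and only if $\mathfrak{G}\circledast\varphi=\{\omega\circledast\varphi:\omega\in\mathfrak{G}\}$ is (norm) separable.
   Context: All vector spaces are over $\mathbb{R}$; $B_{V}$ is the closed unit ball of a Banach space $V$. $G$ is a locally compact group with left Haar measure $\lambda$, assumed $\sigma$-finite and complete, on the $\sigma$-algebra $\Sigma$. $\mathcal{A}:=L^{1}(G)$ is the Banach algebra with convolution $(a\star b)(g)=\int_{G}a(h)b(h^{-1}g)\,d\lambda(h)$, and $\mathcal{A}^{*}$ is identified with $L^{\infty}(G)$ via $\langle\varphi,a\rangle=\int_{G}a\varphi\,d\lambda$. By the Yosida–Hewitt theorem, $\mathcal{A}^{**}=L^{\infty}(G)^{*}$ is isometrically identified with the space $\mathrm{ba}_{\lambda}(G)$ of (bounded, real-valued) finitely additive measures on $\Sigma$ whose null sets include all $\lambda$-null sets, acting by integration. Put $\mathfrak{G}:=\{\omega\in\mathrm{ba}_{\lambda}(G): \omega(G)=1\text{ and }\omega(A)\in\{0,1\}\text{ for all }A\in\Sigma\}\subseteq\mathcal{A}^{**}$. Actions: for $a,b\in\mathcal{A}$, $\varphi\in\mathcal{A}^{*}$, $\mu\in\mathcal{A}^{**}$: $\langle\varphi\circledast a,b\rangle:=\langle\varphi,a\star b\rangle$ and $\langle\mu\circledast\varphi,b\rangle:=\langle\mu,\varphi\circledast b\rangle$, so $\varphi\circledast a,\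 \mu\circledast\varphi\in\mathcal{A}^{*}$. $\varphi\in\mathcal{A}^{*}$ is right Asplund if $\varphi\circledast B_{\mathcal{A}}=\{\varphi\circledast a:a\in B_{\mathcal{A}}\}$ is an Asplund subset of $\mathcal{A}^{*}$. A bounded subset $C$ of a Banach space $V$ is Asplund if it is a fragmented family of functions on $(B_{V^{*}},w^{*})$, meaning: for every nonempty $A\subseteq B_{V^{*}}$ and $\varepsilon>0$ there is a weak-star open $O$ with $O\cap A\ne\emptyset$ and $\mathrm{diam}\,\{\langle \psi,x\rangle:\psi\in O\cap A\}<\varepsilon$ for every $x\in C$. Equivalently, for every countable $D\subseteq C$ the pseudometric space $(B_{V^{*}},\rho_{D})$ is separable, where $\rho_{D}(\varphi,\psi)=\sup_{x\in D}|\langle\varphi-\psi,x\rangle|$. *)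

theory Defs
  imports "HOL-Analysis.Analysis" "HOL-Probability.Essential_Supremum"
begin

text \<open>
  Groups are written additively, following the (not necessarily commutative) library class
  \<^class>\<open>topological_group_add\<close>: the product \<open>g h\<close> is \<open>g + h\<close> and the inverse of \<open>h\<close> is \<open>- h\<close>.

  The spaces of integrable and of essentially bounded functions consist of representatives; functions
  are not identified when they agree almost everywhere.  All notions below depend only on the
  corresponding seminorms.
\<close>

section \<open>Haar measure\<close>

definition left_haar_measure :: "'g::{topological_group_add, t2_space} measure \<Rightarrow> bool" where
  "left_haar_measure H \<longleftrightarrow>
     sets H = sets borel \<and>
     emeasure H UNIV \<noteq> 0 \<and>
     (\<forall>K. compact K \<longrightarrow> emeasure H K < \<infinity>) \<and>
     (\<forall>A\<in>sets borel. emeasure H A = (INF U\<in>{U. open U \<and> A \<subseteq> U}. emeasure H U)) \<and>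
     (\<forall>U. open U \<longrightarrow> emeasure H U = (SUP K\<in>{K. compact K \<and> K \<subseteq> U}. emeasure H K)) \<and>
     (\<forall>g. \<forall>A\<in>sets borel. emeasure H ((\<lambda>x. g + x) ` A) = emeasure H A)"

definition complete_left_haar_measure :: "'g::{topological_group_add, t2_space} measure \<Rightarrow> bool" where
  "complete_left_haar_measure M \<longleftrightarrow> (\<exists>H. left_haar_measure H \<and> M = completion H)"

section \<open>Function spaces\<close>

definition L1 :: "'a measure \<Rightarrow> ('a \<Rightarrow> real) set" where
  "L1 M = {f. integrable M f}"

definition L1_norm :: "'a measure \<Rightarrow> ('a \<Rightarrow> real) \<Rightarrow> real" where
  "L1_norm M f = (\<integral>x. \<bar>f x\<bar> \<partial>M)"

definition L1_unit_ball :: "'a measure \<Rightarrow> ('a \<Rightarrow> real) set" where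
  "L1_unit_ball M = {f \<in> L1 M. L1_norm M f \<le> 1}"

definition Linf :: "'a measure \<Rightarrow> ('a \<Rightarrow> real) set" where
  "Linf M = {f \<in> borel_measurable M. \<exists>C. AE x in M. \<bar>f x\<bar> \<le> C}"

text \<open>\<^const>\<open>real_of_ereal\<close> sends \<open>\<infinity>\<close> to \<open>0\<close>, so this is only meaningful on \<open>Linf M\<close>.\<close>

definition Linf_norm :: "'a measure \<Rightarrow> ('a \<Rightarrow> real) \<Rightarrow> real" where
  "Linf_norm M f = real_of_ereal (esssup M (\<lambda>x. ereal \<bar>f x\<bar>))"

definition norm_separable :: "(('a \<Rightarrow> real) \<Rightarrow> real) \<Rightarrow> ('a \<Rightarrow> real) set \<Rightarrow> bool" where
  "norm_separable N S \<longleftrightarrow>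
     (\<exists>D. countable D \<and> D \<subseteq> S \<and> (\<forall>f\<in>S. \<forall>\<epsilon>>0. \<exists>d\<in>D. N (\<lambda>x. f x - d x) < \<epsilon>))"

section \<open>Asplund sets\<close>

text \<open>
  The dual unit ball of a space \<open>V\<close> of functions with seminorm \<open>N\<close>.  Functionals are normalised
  to be \<^const>\<open>undefined\<close> off \<open>V\<close>; being bounded by \<open>N\<close>, they factor through the quotient of \<open>V\<close> by the
  kernel of \<open>N\<close>.
\<close>

definition dual_unit_ball ::
    "('a \<Rightarrow> real) set \<Rightarrow> (('a \<Rightarrow> real) \<Rightarrow> real) \<Rightarrow> (('a \<Rightarrow> real) \<Rightarrow> real) set" where
  "dual_unit_ball V N =
     {\<psi> \<in> extensional V.
        (\<forall>f\<in>V. \<forall>g\<in>V. \<psi> (\<lambda>x. f x + g x) = \<psi> f + \<psi> g) \<and>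
        (\<forall>c. \<forall>f\<in>V. \<psi> (\<lambda>x. c * f x) = c * \<psi> f) \<and>
        (\<forall>f\<in>V. \<bar>\<psi> f\<bar> \<le> N f)}"

definition weak_star_ball ::
    "('a \<Rightarrow> real) set \<Rightarrow> (('a \<Rightarrow> real) \<Rightarrow> real) \<Rightarrow> (('a \<Rightarrow> real) \<Rightarrow> real) topology" where
  "weak_star_ball V N =
     subtopology (product_topology (\<lambda>_. euclideanreal) V) (dual_unit_ball V N)"

definition asplund_set ::
    "('a \<Rightarrow> real) set \<Rightarrow> (('a \<Rightarrow> real) \<Rightarrow> real) \<Rightarrow> ('a \<Rightarrow> real) set \<Rightarrow> bool" where
  "asplund_set V N C \<longleftrightarrow>
     C \<subseteq> V \<and> (\<exists>K. \<forall>f\<in>C. N f \<le> K) \<and>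
     (\<forall>A \<epsilon>. A \<subseteq> dual_unit_ball V N \<longrightarrow> A \<noteq> {} \<longrightarrow> 0 < \<epsilon> \<longrightarrow>
        (\<exists>W. openin (weak_star_ball V N) W \<and> W \<inter> A \<noteq> {} \<and>
             (\<forall>f\<in>C. diameter ((\<lambda>\<psi>. \<psi> f) ` (W \<inter> A)) < \<epsilon>)))"

section \<open>Finitely additive measures\<close>

definition ba :: "'a measure \<Rightarrow> ('a set \<Rightarrow> real) set" where
  "ba M = {\<mu> \<in> extensional (sets M).
     additive (sets M) \<mu> \<and>
     (\<exists>K. \<forall>A\<in>sets M. \<bar>\<mu> A\<bar> \<le> K) \<and>
     (\<forall>A\<in>null_sets M. \<mu> A = 0)}"

definition zero_one_ba :: "'a measure \<Rightarrow> ('a set \<Rightarrow> real) set" where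
  "zero_one_ba M = {\<omega> \<in> ba M. \<omega> (space M) = 1 \<and> (\<forall>A\<in>sets M. \<omega> A \<in> {0, 1})}"

definition ba_simple_integral :: "'a measure \<Rightarrow> ('a set \<Rightarrow> real) \<Rightarrow> ('a \<Rightarrow> real) \<Rightarrow> real" where
  "ba_simple_integral M \<mu> s = (\<Sum>y\<in>s ` space M. y * \<mu> (s -` {y} \<inter> space M))"

text \<open>
  The integral is continuous in the essential supremum seminorm and simple functions are dense, so for
  \<open>\<mu> \<in> ba M\<close> and \<open>f \<in> Linf M\<close> the limit exists and does not depend on the approximating sequence.
\<close>

definition ba_integral :: "'a measure \<Rightarrow> ('a set \<Rightarrow> real) \<Rightarrow> ('a \<Rightarrow> real) \<Rightarrow> real" where
  "ba_integral M \<mu> f =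
     (THE I. \<exists>s. (\<forall>n. simple_function M (s n)) \<and>
                 (\<lambda>n. Linf_norm M (\<lambda>x. f x - s n x)) \<longlonglongrightarrow> 0 \<and>
                 (\<lambda>n. ba_simple_integral M \<mu> (s n)) \<longlonglongrightarrow> I)"

section \<open>Convolution and the module actions\<close>

definition convolution ::
    "'g::group_add measure \<Rightarrow> ('g \<Rightarrow> real) \<Rightarrow> ('g \<Rightarrow> real) \<Rightarrow> 'g \<Rightarrow> real" where
  "convolution M a b = (\<lambda>g. \<integral>h. a h * b (- h + g) \<partial>M)"

definition pairing :: "'a measure \<Rightarrow> ('a \<Rightarrow> real) \<Rightarrow> ('a \<Rightarrow> real) \<Rightarrow> real" where
  "pairing M \<phi> a = (\<integral>x. a x * \<phi> x \<partial>M)"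

text \<open>
  The essentially bounded function representing a bounded linear functional on the space of integrable
  functions.  It is determined up to null sets, so the choice made by \<open>SOME\<close> is immaterial.
\<close>

definition Linf_rep :: "'a measure \<Rightarrow> (('a \<Rightarrow> real) \<Rightarrow> real) \<Rightarrow> 'a \<Rightarrow> real" where
  "Linf_rep M F = (SOME \<psi>. \<psi> \<in> Linf M \<and> (\<forall>b\<in>L1 M. pairing M \<psi> b = F b))"

definition right_action ::
    "'g::group_add measure \<Rightarrow> ('g \<Rightarrow> real) \<Rightarrow> ('g \<Rightarrow> real) \<Rightarrow> 'g \<Rightarrow> real" where
  "right_action M \<phi> a = Linf_rep M (\<lambda>b. pairing M \<phi> (convolution M a b))"

definition bidual_action ::
    "'g::group_add measure \<Rightarrow> ('g set \<Rightarrow> real) \<Rightarrow> ('g \<Rightarrow> real) \<Rightarrow> 'g \<Rightarrow> real" where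
  "bidual_action M \<mu> \<phi> = Linf_rep M (\<lambda>b. ba_integral M \<mu> (right_action M \<phi> b))"

definition right_asplund :: "'g::group_add measure \<Rightarrow> ('g \<Rightarrow> real) \<Rightarrow> bool" where
  "right_asplund M \<phi> \<longleftrightarrow>
     asplund_set (Linf M) (Linf_norm M) (right_action M \<phi> ` L1_unit_ball M)"

end

theory Submission
  imports Defs
begin

text \<open>
  Write \<open>T a = \<phi> \<circledast> a\<close>, a bounded operator from \<open>L\<^sup>1\<close> to \<open>L\<^sup>\<infinity>\<close>; then \<open>\<omega> \<circledast> \<phi> = T* \<omega>\<close>.  Since \<open>L\<^sup>1\<close> is
  separable, \<open>T\<close> of its unit ball is Asplund if and only if the image under \<open>T*\<close> of the whole bidual unit
  ball is norm separable: one direction is Baire's theorem, the other follows by passing to a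
  compact metrizable quotient of the ball.  It remains to see that separability on the zero-one measures
  gives separability on the ball.  The zero-one measures are the points of the Stone space of the
  measure algebra, on which every charge induces a countably additive measure, and a functional on
  \<open>L\<^sup>\<infinity>\<close> is integration of point evaluations against a difference of two such measures.  If the point
  evaluations are separable, then countably many small measurable pieces cover the Stone space, so the
  integral is a norm limit of finite combinations of point evaluations.

  The group enters only through the boundedness of the bilinear form
  \<open>(a, b) \<mapsto> \<langle>\<phi>, a \<star> b\<rangle>\<close>.  It rests on Fubini's theorem, and the integrand is jointly measurable because
  separability of \<open>L\<^sup>1\<close> makes the group second countable.
\<close>

section \<open>The essential supremum seminorm\<close>

text \<open>The zero-one measures are the delicate point: by Krein-Milman they recover the bidual
  ball only in the weak-star topology, and weak-star density says nothing about norm separability.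
  Integrating over Stone measures is what produces approximation in norm. The norm distance of two
  adjoint images is the uniform distance of the functionals on the image of the unit ball of L1;
  \<open>sup_separable\<close> expresses separability for that distance without forming adjoints on
  the whole bidual. Two features of the setting shape the details. Functions are representatives and
  \<open>Linf_rep\<close> chooses one by \<open>SOME\<close>, so \<open>T\<close> is linear only up
  to functions of seminorm zero; the functionals applied to it ignore such functions. And
  \<open>M\<close> is a completion: composing an \<open>M\<close>-measurable function with the group
  operation can destroy joint measurability, so integrable functions are traded for Borel
  representatives with respect to \<open>H\<close> before Fubini's theorem is applied.\<close>

lemma LinfD:
  assumes "f \<in> Linf M"
  shows "f \<in> borel_measurable M" "AE x in M. \<bar>f x\<bar> \<le> Linf_norm M f" "0 \<le> Linf_norm M f"
proof -
  show m[measurable]: "f \<in> borel_measurable M"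
    using assms by (simp add: Linf_def)
  obtain C where C: "AE x in M. \<bar>f x\<bar> \<le> C"
    using assms by (auto simp: Linf_def)
  let ?e = "esssup M (\<lambda>x. ereal \<bar>f x\<bar>)"
  have "(AE x in M. \<bar>f x\<bar> \<le> Linf_norm M f) \<and> 0 \<le> Linf_norm M f"
  \<comment> \<open>On a null space the essential supremum is minus infinity, which
    \<open>real_of_ereal\<close> sends to 0; the seminorm stays nonnegative and the bound holds
    vacuously.\<close>
  proof (cases "emeasure M (space M) = 0")
    case True
    then have "?e = -\<infinity>"
      by (intro esssup_zero_space) auto
    moreover have "AE x in M. P x" for P
      using True by (intro AE_I[of _ _ "space M"]) auto
    ultimately show ?thesis
      by (simp add: Linf_norm_def)
  next
    case False
    have "?e \<le> ereal C"
      using C by (intro esssup_I) auto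
    moreover have "0 \<le> ?e"
    proof -
      have "esssup M (\<lambda>x. 0 :: ereal) \<le> ?e"
        by (intro esssup_mono) auto
      then show ?thesis
        using False by (simp add: esssup_const)
    qed
    ultimately obtain r where r: "?e = ereal r" "0 \<le> r"
      by (cases ?e) auto
    then show ?thesis
      using esssup_AE[of "\<lambda>x. ereal \<bar>f x\<bar>" M] by (simp add: Linf_norm_def)
  qed
  then show "AE x in M. \<bar>f x\<bar> \<le> Linf_norm M f" "0 \<le> Linf_norm M f"
    by auto
qed

lemma LinfI:
  assumes "f \<in> borel_measurable M" "AE x in M. \<bar>f x\<bar> \<le> C"
  shows "f \<in> Linf M"
  using assms by (auto simp: Linf_def)

lemma Linf_norm_le:
  assumes [measurable]: "f \<in> borel_measurable M" and C: "AE x in M. \<bar>f x\<bar> \<le> C" "0 \<le> C"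
  shows "Linf_norm M f \<le> C"
proof -
  have "esssup M (\<lambda>x. ereal \<bar>f x\<bar>) \<le> ereal C"
    using C by (intro esssup_I) auto
  then show ?thesis
    using \<open>0 \<le> C\<close> unfolding Linf_norm_def
    by (cases "esssup M (\<lambda>x. ereal \<bar>f x\<bar>)") auto
qed

lemma Linf_add: "f \<in> Linf M \<Longrightarrow> g \<in> Linf M \<Longrightarrow> (\<lambda>x. f x + g x) \<in> Linf M"
proof -
  assume fg: "f \<in> Linf M" "g \<in> Linf M"
  note [measurable] = LinfD(1)[OF fg(1)] LinfD(1)[OF fg(2)]
  show ?thesis
  proof (rule LinfI)
    show "AE x in M. \<bar>f x + g x\<bar> \<le> Linf_norm M f + Linf_norm M g"
      using LinfD(2)[OF fg(1)] LinfD(2)[OF fg(2)] by eventually_elim linarith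
  qed measurable
qed

lemma Linf_cmult: "f \<in> Linf M \<Longrightarrow> (\<lambda>x. c * f x) \<in> Linf M"
proof -
  assume f: "f \<in> Linf M"
  note [measurable] = LinfD(1)[OF f]
  show ?thesis
  proof (rule LinfI)
    show "AE x in M. \<bar>c * f x\<bar> \<le> \<bar>c\<bar> * Linf_norm M f"
      using LinfD(2)[OF f] by eventually_elim (simp add: abs_mult mult_left_mono)
  qed measurable
qed

lemma Linf_diff: "f \<in> Linf M \<Longrightarrow> g \<in> Linf M \<Longrightarrow> (\<lambda>x. f x - g x) \<in> Linf M"
  using Linf_add[OF _ Linf_cmult[of g M "-1"], of f] by simp

lemma Linf_indicator: "A \<in> sets M \<Longrightarrow> indicat_real A \<in> Linf M"
  by (intro LinfI[of _ _ 1]) auto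

lemma Linf_sum: "(\<And>i. i \<in> I \<Longrightarrow> f i \<in> Linf M) \<Longrightarrow> (\<lambda>x. \<Sum>i\<in>I. f i x) \<in> Linf M"
proof (induction I rule: infinite_finite_induct)
  case (insert i I)
  then show ?case
    by (simp add: Linf_add)
qed (auto simp: Linf_def)

lemma Linf_simple_function: "simple_function M s \<Longrightarrow> s \<in> Linf M" for s :: "'a \<Rightarrow> real"
proof (rule LinfI[of _ _ "Max ((\<lambda>x. \<bar>s x\<bar>) ` space M)"])
  assume s: "simple_function M s"
  show "s \<in> borel_measurable M"
    using s by (rule borel_measurable_simple_function)
  have "finite ((\<lambda>x. \<bar>s x\<bar>) ` space M)"
    using simple_functionD(1)[OF s] by (metis (no_types) finite_imageI image_image)
  then show "AE x in M. \<bar>s x\<bar> \<le> Max ((\<lambda>x. \<bar>s x\<bar>) ` space M)"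
    by (intro AE_I2 Max_ge) auto
qed

lemma Linf_simple_approx:
  assumes f: "f \<in> Linf M" and e: "e > 0"
  obtains s where "simple_function M s" "Linf_norm M (\<lambda>x. f x - s x) \<le> e"
proof
  define C where "C = Linf_norm M f"
  \<comment> \<open>Truncation changes \<open>f\<close> on a null set only, and it makes the
    rounding \<open>s\<close> take finitely many values everywhere, as
    \<open>simple_function\<close> demands.\<close>
  define g where "g = (\<lambda>x. max (-C) (min C (f x)))"
  define s where "s = (\<lambda>x. e * of_int \<lfloor>g x / e\<rfloor>)"
  note [measurable] = LinfD(1)[OF f]
  have g[measurable]: "g \<in> borel_measurable M"
    unfolding g_def by measurable
  have sm[measurable]: "s \<in> borel_measurable M"
    unfolding s_def by measurable
  have C: "0 \<le> C"
    using LinfD(3)[OF f] by (simp add: C_def)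
  have "s ` space M \<subseteq> (\<lambda>k. e * of_int k) ` {\<lfloor>-C / e\<rfloor>..\<lfloor>C / e\<rfloor>}"
  proof
    fix y assume "y \<in> s ` space M"
    then obtain x where y: "y = s x"
      by auto
    have "- C \<le> g x" "g x \<le> C"
      using C by (auto simp: g_def)
    then have "\<lfloor>-C / e\<rfloor> \<le> \<lfloor>g x / e\<rfloor>" "\<lfloor>g x / e\<rfloor> \<le> \<lfloor>C / e\<rfloor>"
      using e by (intro floor_mono divide_right_mono; simp)+
    then show "y \<in> (\<lambda>k. e * of_int k) ` {\<lfloor>-C / e\<rfloor>..\<lfloor>C / e\<rfloor>}"
      unfolding y s_def by (intro imageI) simp
  qed
  then have "finite (s ` space M)"
    by (rule finite_subset) simp
  then show "simple_function M s"
    using sm by (simp add: simple_function_borel_measurable)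
  have gs: "\<bar>g x - s x\<bar> \<le> e" for x
  proof -
    have "g x / e - 1 \<le> of_int \<lfloor>g x / e\<rfloor>" "of_int \<lfloor>g x / e\<rfloor> \<le> g x / e"
      by linarith+
    then have "e * (g x / e - 1) \<le> s x" "s x \<le> e * (g x / e)"
      unfolding s_def using e by (simp_all only: mult_le_cancel_left_pos)
    then show ?thesis
      using e by (simp add: right_diff_distrib abs_le_iff)
  qed
  show "Linf_norm M (\<lambda>x. f x - s x) \<le> e"
  proof (rule Linf_norm_le)
    show "AE x in M. \<bar>f x - s x\<bar> \<le> e"
      using LinfD(2)[OF f]
    proof eventually_elim
      case (elim x)
      then have "g x = f x"
        by (auto simp: g_def C_def)
      then show ?case
        using gs[of x] by simp
    qed
  qed (use e in auto)
qed

section \<open>Duality between integrable and essentially bounded functions\<close>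

lemma L1_norm_nonneg: "0 \<le> L1_norm M f"
  by (simp add: L1_norm_def)

lemma L1_D: "f \<in> L1 M \<Longrightarrow> f \<in> borel_measurable M"
  by (simp add: L1_def)

lemma pairing_integrable:
  assumes f: "f \<in> Linf M" and a: "a \<in> L1 M"
  shows "integrable M (\<lambda>x. a x * f x)"
proof (rule Bochner_Integration.integrable_bound[of _ "\<lambda>x. Linf_norm M f * a x"])
  show "integrable M (\<lambda>x. Linf_norm M f * a x)"
    using a by (simp add: L1_def)
  show "(\<lambda>x. a x * f x) \<in> borel_measurable M"
    using a LinfD(1)[OF f] by (auto simp: L1_def)
  show "AE x in M. norm (a x * f x) \<le> norm (Linf_norm M f * a x)"
    using LinfD(2)[OF f]
    by eventually_elim (use LinfD(3)[OF f] in \<open>simp add: abs_mult mult.commute[of "\<bar>a _\<bar>"] mult_right_mono\<close>)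
qed

lemma pairing_bound:
  assumes f: "f \<in> Linf M" and a: "a \<in> L1 M"
  shows "\<bar>pairing M f a\<bar> \<le> Linf_norm M f * L1_norm M a"
proof -
  have "\<bar>pairing M f a\<bar> \<le> (\<integral>x. \<bar>a x * f x\<bar> \<partial>M)"
    unfolding pairing_def by (rule integral_abs_bound)
  also have "\<dots> \<le> (\<integral>x. Linf_norm M f * \<bar>a x\<bar> \<partial>M)"
  proof (rule integral_mono_AE)
    show "integrable M (\<lambda>x. \<bar>a x * f x\<bar>)"
      using pairing_integrable[OF f a] by simp
    show "integrable M (\<lambda>x. Linf_norm M f * \<bar>a x\<bar>)"
      using a by (simp add: L1_def)
    show "AE x in M. \<bar>a x * f x\<bar> \<le> Linf_norm M f * \<bar>a x\<bar>"
      using LinfD(2)[OF f]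
      by eventually_elim (use LinfD(3)[OF f] in \<open>simp add: abs_mult mult.commute[of "\<bar>a _\<bar>"] mult_right_mono\<close>)
  qed
  finally show ?thesis
    by (simp add: L1_norm_def)
qed

lemma pairing_diff:
  assumes "f \<in> Linf M" "g \<in> Linf M" "a \<in> L1 M"
  shows "pairing M (\<lambda>x. f x - g x) a = pairing M f a - pairing M g a"
  using pairing_integrable[OF assms(1,3)] pairing_integrable[OF assms(2,3)]
  by (simp add: pairing_def right_diff_distrib)

section \<open>Norming by the unit ball of L1, and representation of its functionals\<close>

text \<open>If \<open>g\<close> exceeded \<open>r\<close> on a set of positive measure,
  sigma-finiteness would give a subset \<open>B\<close> of finite positive measure, and the
  normalised indicator of \<open>B\<close> would pair with \<open>g\<close> to more than
  \<open>r\<close>.\<close>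

lemma (in sigma_finite_measure) AE_le_of_pairing_le:
  assumes g: "g \<in> Linf M" and r: "\<And>b. b \<in> L1_unit_ball M \<Longrightarrow> pairing M g b \<le> r"
  shows "AE x in M. g x \<le> r"
proof (rule ccontr)
  assume neg: "\<not> (AE x in M. g x \<le> r)"
  note [measurable] = LinfD(1)[OF g]
  define A where "A = {x\<in>space M. r < g x}"
  have A[measurable]: "A \<in> sets M"
    unfolding A_def by measurable
  have pos: "emeasure M A \<noteq> 0"
    using neg unfolding A_def by (auto simp: AE_iff_measurable[OF _ refl] not_le)
  obtain B where B: "B \<in> sets M" "B \<subseteq> A" "emeasure M B < \<infinity>" "0 < emeasure M B"
  proof -
    have "A \<subseteq> space M"
      by (simp add: A_def)
    obtain F :: "nat \<Rightarrow> 'a set" where F: "range F \<subseteq> sets M" "(\<Union>i. F i) = space M" "\<And>i. emeasure M (F i) \<noteq> \<infinity>"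
      using sigma_finite by blast
    have "\<exists>i. emeasure M (A \<inter> F i) \<noteq> 0"
    proof (rule ccontr)
      assume "\<nexists>i. emeasure M (A \<inter> F i) \<noteq> 0"
      then have "A \<inter> F i \<in> null_sets M" for i
        using F(1) by auto
      then have "(\<Union>i. A \<inter> F i) \<in> null_sets M"
        by (rule null_sets_UN)
      moreover have "(\<Union>i. A \<inter> F i) = A"
        using F(2) \<open>A \<subseteq> space M\<close> by auto
      ultimately show False
        using pos by auto
    qed
    then obtain i where i: "emeasure M (A \<inter> F i) \<noteq> 0" ..
    have "emeasure M (A \<inter> F i) \<le> emeasure M (F i)"
      using F(1) by (intro emeasure_mono) auto
    then show ?thesis
      using F(1) F(3)[of i] i by (intro that[of "A \<inter> F i"]) (auto simp: less_top[symmetric] top_unique zero_less_iff_neq_zero)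
  qed
  then have mB: "0 < measure M B"
    by (simp add: measure_def enn2real_positive_iff)
  define b where "b = (\<lambda>x. indicat_real B x / measure M B)"
  have b: "b \<in> L1 M"
    using B by (auto simp: b_def L1_def)
  have nb: "L1_norm M b = 1"
    using B mB by (simp add: b_def L1_norm_def abs_mult)
  have "(\<integral>x. b x * r \<partial>M) = r"
    using B mB by (simp add: b_def)
  have "pairing M g b \<le> r"
    using r[of b] b nb by (simp add: L1_unit_ball_def)
  then have "(\<integral>x. b x * (g x - r) \<partial>M) \<le> 0"
    using Bochner_Integration.integral_diff[OF pairing_integrable[OF g b], of "\<lambda>x. b x * r"] b
      \<open>(\<integral>x. b x * r \<partial>M) = r\<close>
    by (auto simp: pairing_def L1_def right_diff_distrib)
  moreover have nn: "0 \<le> b x * (g x - r)" for x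
    using B(2) mB by (cases "x \<in> B") (auto simp: b_def A_def)
  have int: "integrable M (\<lambda>x. b x * (g x - r))"
    using pairing_integrable[OF g b] b by (simp add: L1_def right_diff_distrib)
  moreover have "0 \<le> (\<integral>x. b x * (g x - r) \<partial>M)"
    using nn by (simp add: integral_nonneg_AE)
  ultimately have "(\<integral>x. b x * (g x - r) \<partial>M) = 0"
    by simp
  then have "AE x in M. b x * (g x - r) = 0"
    using integral_nonneg_eq_0_iff_AE[OF int] nn by simp
  then have "AE x in M. x \<notin> B"
    by eventually_elim (use B(2) mB in \<open>auto simp: b_def A_def indicator_def split: if_splits\<close>)
  then have "emeasure M B = 0"
    using B(1) by (simp add: AE_iff_null_sets null_setsD1)
  then show False
    using B(4) by simp
qed

lemma (in sigma_finite_measure) Linf_norm_le_of_pairing_le: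
  assumes g: "g \<in> Linf M" and r: "\<And>b. b \<in> L1_unit_ball M \<Longrightarrow> \<bar>pairing M g b\<bar> \<le> r"
  shows "Linf_norm M g \<le> r"
proof -
  have "AE x in M. g x \<le> r"
    by (rule AE_le_of_pairing_le[OF g]) (use r in \<open>fastforce simp: abs_le_iff\<close>)
  moreover have "AE x in M. - g x \<le> r"
  proof (rule AE_le_of_pairing_le)
    show "(\<lambda>x. - g x) \<in> Linf M"
      using Linf_cmult[OF g, of "-1"] by simp
    show "pairing M (\<lambda>x. - g x) b \<le> r" if "b \<in> L1_unit_ball M" for b
      using r[OF that] by (simp add: pairing_def abs_le_iff)
  qed
  ultimately have "AE x in M. \<bar>g x\<bar> \<le> r"
    by eventually_elim simp
  moreover have "0 \<le> r"
    using r[of "\<lambda>x. 0"] by (auto simp: L1_unit_ball_def L1_def L1_norm_def pairing_def)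
  ultimately show ?thesis
    using LinfD(1)[OF g] by (intro Linf_norm_le)
qed

text \<open>Adding a multiple of the integral to a bounded functional makes it positive, so that no
  decomposition of signed measures is needed.\<close>

lemma (in finite_measure) positive_L1_functional_rep:
  fixes G :: "('a \<Rightarrow> real) \<Rightarrow> real"
  assumes add: "\<And>f g. integrable M f \<Longrightarrow> integrable M g \<Longrightarrow> G (\<lambda>x. f x + g x) = G f + G g"
    and cmult: "\<And>c f. integrable M f \<Longrightarrow> G (\<lambda>x. c * f x) = c * G f"
    and bound: "\<And>f. integrable M f \<Longrightarrow> \<bar>G f\<bar> \<le> K * (\<integral>x. \<bar>f x\<bar> \<partial>M)"
    and nonneg: "\<And>f. integrable M f \<Longrightarrow> (\<And>x. 0 \<le> f x) \<Longrightarrow> 0 \<le> G f"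
    and K: "0 \<le> K"
  obtains \<psi> where "\<psi> \<in> Linf M" "\<And>f. integrable M f \<Longrightarrow> G f = (\<integral>x. f x * \<psi> x \<partial>M)"
proof -
  have int_ind[simp]: "integrable M (indicat_real A)" if "A \<in> sets M" for A
    using that by (simp add: integrable_indicator_iff emeasure_finite less_top[symmetric])
  have diff: "G (\<lambda>x. f x - g x) = G f - G g" if "integrable M f" "integrable M g" for f g
    using add[OF that(1), of "\<lambda>x. -1 * g x"] cmult[OF that(2), of "-1"] that(2) by simp
  have G0: "G (\<lambda>x. 0) = 0"
    using cmult[of "\<lambda>x. 0" 0] by simp
  have Gsum: "G (\<lambda>x. \<Sum>i<n. f i x) = (\<Sum>i<n. G (f i))"
    if "\<And>i. integrable M (f i)" for f and n :: nat
    by (induction n) (use that in \<open>auto simp: G0 add\<close>)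
  define \<nu> where "\<nu> = measure_of (space M) (sets M) (\<lambda>A. ennreal (G (indicat_real A)))"
  have ca: "countably_additive (sets M) (\<lambda>A. ennreal (G (indicat_real A)))"
  proof (rule countably_additiveI)
    fix A :: "nat \<Rightarrow> 'a set"
    assume A: "range A \<subseteq> sets M" "disjoint_family A" "(\<Union>i. A i) \<in> sets M"
    let ?U = "\<Union>i. A i"
    have Ai[simp]: "A i \<in> sets M" for i
      using A by auto
    have le: "(\<Sum>i<n. indicat_real (A i) x) \<le> indicat_real ?U x" for n x
    proof (cases "x \<in> ?U")
      case True
      then obtain j where "x \<in> A j"
        by auto
      then have "indicat_real (A i) x = (if i = j then 1 else 0)" for i
        using A(2) by (auto simp: disjoint_family_on_def indicator_def)
      then show ?thesis
        using True by simp
    qed (auto simp: indicator_def)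
    \<comment> \<open>The error is \<open>G\<close> at the indicator of the uncovered tail, whose L1
      norm is the measure of that tail; countable additivity of \<open>M\<close> sends it to
      0.\<close>
    have "\<bar>G (indicator ?U) - (\<Sum>i<n. G (indicator (A i)))\<bar>
        \<le> K * (measure M ?U - (\<Sum>i<n. measure M (A i)))" for n
    proof -
      have "G (indicator ?U) - (\<Sum>i<n. G (indicator (A i)))
          = G (\<lambda>x. indicator ?U x - (\<Sum>i<n. indicator (A i) x))"
        using A(3) by (subst diff) (auto simp: Gsum)
      also have "\<bar>\<dots>\<bar> \<le> K * (\<integral>x. \<bar>indicator ?U x - (\<Sum>i<n. indicator (A i) x)\<bar> \<partial>M)"
        using A(3) by (intro bound) auto
      also have "(\<integral>x. \<bar>indicator ?U x - (\<Sum>i<n. indicat_real (A i) x)\<bar> \<partial>M)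
          = (\<integral>x. indicator ?U x - (\<Sum>i<n. indicator (A i) x) \<partial>M)"
        using le by (intro Bochner_Integration.integral_cong) auto
      also have "\<dots> = measure M ?U - (\<Sum>i<n. measure M (A i))"
        using A(3) by (subst Bochner_Integration.integral_diff) auto
      finally show ?thesis .
    qed
    moreover
    have "(\<lambda>n. K * (measure M ?U - (\<Sum>i<n. measure M (A i)))) \<longlonglongrightarrow> K * (measure M ?U - measure M ?U)"
      using finite_measure_UNION[OF A(1,2)] unfolding sums_def by (intro tendsto_intros)
    then have "(\<lambda>n. K * (measure M ?U - (\<Sum>i<n. measure M (A i)))) \<longlonglongrightarrow> 0"
      by (simp only: diff_self mult_zero_right)
    ultimately have "(\<lambda>n. G (indicator ?U) - (\<Sum>i<n. G (indicator (A i)))) \<longlonglongrightarrow> 0"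
      by (metis (no_types, lifting) Lim_null_comparison always_eventually real_norm_def)
    then have "(\<lambda>n. G (indicator ?U) - (G (indicator ?U) - (\<Sum>i<n. G (indicator (A i))))) \<longlonglongrightarrow> G (indicator ?U) - 0"
      by (intro tendsto_intros)
    then have "(\<lambda>i. G (indicator (A i))) sums G (indicator ?U)"
      by (simp add: sums_def)
    then show "(\<Sum>i. ennreal (G (indicator (A i)))) = ennreal (G (indicator ?U))"
      by (intro suminf_ennreal_eq) (auto intro!: nonneg)
  qed
  have em: "emeasure \<nu> A = ennreal (G (indicator A))" if "A \<in> sets M" for A
    unfolding \<nu>_def
    by (rule emeasure_measure_of_sigma[OF sets.sigma_algebra_axioms _ ca that])
      (simp add: positive_def G0 indicator_def[abs_def])
  have sets_nu[simp]: "sets \<nu> = sets M"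
    by (simp add: \<nu>_def)
  have "absolutely_continuous M \<nu>"
    unfolding absolutely_continuous_def
  proof
    fix A assume A: "A \<in> null_sets M"
    then have "\<bar>G (indicator A)\<bar> \<le> K * (\<integral>x. \<bar>indicator A x\<bar> \<partial>M)"
      by (intro bound) auto
    also have "\<dots> = 0"
      using A by (auto simp: measure_def null_sets_def)
    finally show "A \<in> null_sets \<nu>"
      using A by (auto simp: null_sets_def em)
  qed
  then obtain f where f[measurable]: "f \<in> borel_measurable M" and dens: "density M f = \<nu>"
    using Radon_Nikodym[OF _ sets_nu] by auto
  have nf: "(\<integral>\<^sup>+x. f x * indicator A x \<partial>M) = ennreal (G (indicator A))" if "A \<in> sets M" for A
    using em[OF that] that by (simp add: dens[symmetric] emeasure_density)
  define \<psi> where "\<psi> = (\<lambda>x. enn2real (f x))"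
  have [measurable]: "\<psi> \<in> borel_measurable M"
    unfolding \<psi>_def by measurable
  have "(\<integral>\<^sup>+x. f x \<partial>M) = (\<integral>\<^sup>+x. f x * indicator (space M) x \<partial>M)"
    by (intro nn_integral_cong) auto
  also have "\<dots> < \<infinity>"
    by (subst nf) auto
  finally have "AE x in M. f x \<noteq> \<infinity>"
    using nn_integral_noteq_infinite[OF f] by auto
  then have f\<psi>: "AE x in M. f x = ennreal (\<psi> x)"
    by eventually_elim (simp add: \<psi>_def less_top)
  have n\<psi>: "(\<integral>\<^sup>+x. ennreal (\<psi> x * indicator A x) \<partial>M) = ennreal (G (indicator A))" if "A \<in> sets M" for A
    unfolding nf[OF that, symmetric] using f\<psi>
    by (intro nn_integral_cong_AE) (auto simp: indicator_def elim: eventually_mono)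
  have i\<psi>: "(\<integral>x. \<psi> x * indicator A x \<partial>M) = G (indicator A)" if "A \<in> sets M" for A
    using n\<psi>[OF that] that nonneg[of "indicator A"] by (intro integral_eq_nn_integral[THEN trans])
      (auto simp: \<psi>_def)
  have int\<psi>: "integrable M \<psi>"
  proof (rule integrableI_nonneg)
    have "(\<integral>\<^sup>+x. ennreal (\<psi> x) \<partial>M) = (\<integral>\<^sup>+x. ennreal (\<psi> x * indicator (space M) x) \<partial>M)"
      by (intro nn_integral_cong) auto
    then show "(\<integral>\<^sup>+x. ennreal (\<psi> x) \<partial>M) < \<infinity>"
      by (simp add: n\<psi>)
  qed (auto simp: \<psi>_def)
  \<comment> \<open>The means of \<open>\<psi>\<close> over sets of positive measure are
    \<open>G (indicator A) / measure M A\<close>, hence at most \<open>K\<close>; the averaging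
    theorem turns this into an almost everywhere bound.\<close>
  have "AE x in M. \<psi> x \<in> {..K}"
  proof (rule averaging_theorem[OF int\<psi>])
    fix A assume A: "A \<in> sets M" "0 < measure M A"
    have "G (indicator A) \<le> K * (\<integral>x. \<bar>indicator A x\<bar> \<partial>M)"
      using bound[of "indicator A"] A(1) by auto
    then show "(1 / measure M A) *\<^sub>R set_lebesgue_integral M A \<psi> \<in> {..K}"
      using A i\<psi>[OF A(1)] by (simp add: set_lebesgue_integral_def divide_simps mult.commute)
  qed auto
  then have L: "\<psi> \<in> Linf M"
    by (intro LinfI[of _ _ K]) (auto simp: \<psi>_def)
  have "G f = (\<integral>x. f x * \<psi> x \<partial>M)" if "integrable M f" for f
    using that
  proof (induction rule: integrable_induct)
    case (base A c)
    then show ?case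
      using cmult[of "indicator A" c] i\<psi>[of A] by (simp add: mult_ac)
  next
    case (add f g)
    then show ?case
      using assms(1)[OF add(1,2)] pairing_integrable[OF L, of f] pairing_integrable[OF L, of g]
      by (simp add: L1_def distrib_right)
  next
    case (lim f s)
    have "(\<lambda>i. \<integral>x. \<bar>s i x - f x\<bar> \<partial>M) \<longlonglongrightarrow> (\<integral>x. 0 \<partial>M)"
    proof (rule integral_dominated_convergence[where w = "\<lambda>x. 3 * \<bar>f x\<bar>"])
      show "AE x in M. (\<lambda>i. \<bar>s i x - f x\<bar>) \<longlonglongrightarrow> 0"
      proof (rule AE_I2)
        fix x assume "x \<in> space M"
        then have "(\<lambda>i. s i x) \<longlonglongrightarrow> f x"
          using lim by simp
        then show "(\<lambda>i. \<bar>s i x - f x\<bar>) \<longlonglongrightarrow> 0"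
          by (intro tendsto_rabs_zero) (simp add: LIM_zero)
      qed
      \<comment> \<open>The approximants of \<open>integrable_induct\<close> are bounded by twice
        \<open>f\<close>; one more \<open>f\<close> comes from the difference.\<close>
      show "AE x in M. norm \<bar>s i x - f x\<bar> \<le> 3 * \<bar>f x\<bar>" for i
      proof (rule AE_I2)
        fix x assume "x \<in> space M"
        then have "norm (s i x) \<le> 2 * norm (f x)"
          using lim by blast
        then show "norm \<bar>s i x - f x\<bar> \<le> 3 * \<bar>f x\<bar>"
          by (auto simp: abs_real_def split: if_splits)
      qed
    qed (use lim in auto)
    then have "(\<lambda>i. (K + Linf_norm M \<psi>) * (\<integral>x. \<bar>s i x - f x\<bar> \<partial>M)) \<longlonglongrightarrow> (K + Linf_norm M \<psi>) * 0"
      by (intro tendsto_intros) simp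
    moreover have "\<bar>G f - (\<integral>x. f x * \<psi> x \<partial>M)\<bar> \<le> (K + Linf_norm M \<psi>) * (\<integral>x. \<bar>s i x - f x\<bar> \<partial>M)" for i
    proof -
      have d: "integrable M (\<lambda>x. s i x - f x)"
        using lim by auto
      have "\<bar>G (\<lambda>x. s i x - f x)\<bar> \<le> K * (\<integral>x. \<bar>s i x - f x\<bar> \<partial>M)"
        using bound[OF d] .
      moreover have "\<bar>pairing M \<psi> (\<lambda>x. s i x - f x)\<bar> \<le> Linf_norm M \<psi> * (\<integral>x. \<bar>s i x - f x\<bar> \<partial>M)"
        using pairing_bound[OF L, of "\<lambda>x. s i x - f x"] d by (simp add: L1_def L1_norm_def)
      moreover have "pairing M \<psi> (\<lambda>x. s i x - f x) = G (s i) - (\<integral>x. f x * \<psi> x \<partial>M)"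
        using pairing_integrable[OF L, of "s i"] pairing_integrable[OF L, of f] lim(1,4,5)
        by (simp add: pairing_def L1_def left_diff_distrib)
      ultimately show ?thesis
        using diff[OF lim(1)[of i] lim(4)] by (simp add: distrib_right)
    qed
    ultimately have "\<bar>G f - (\<integral>x. f x * \<psi> x \<partial>M)\<bar> \<le> 0"
      by (intro LIMSEQ_le_const) auto
    then show ?case
      by simp
  qed
  with L show ?thesis
    by (rule that)
qed

lemma (in sigma_finite_measure) L1_functional_rep:
  fixes F :: "('a \<Rightarrow> real) \<Rightarrow> real"
  assumes add: "\<And>f g :: 'a \<Rightarrow> real. f \<in> L1 M \<Longrightarrow> g \<in> L1 M \<Longrightarrow> F (\<lambda>x. f x + g x) = F f + F g"
    and cmult: "\<And>c f. f \<in> L1 M \<Longrightarrow> F (\<lambda>x. c * f x) = c * F f"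
    and bound: "\<And>f. f \<in> L1 M \<Longrightarrow> \<bar>F f\<bar> \<le> K * L1_norm M f"
  shows "\<exists>\<psi>\<in>Linf M. \<forall>b\<in>L1 M. pairing M \<psi> b = F b"
proof -
  have K: "\<bar>F f\<bar> \<le> \<bar>K\<bar> * L1_norm M f" if "f \<in> L1 M" for f
    using bound[OF that] mult_right_mono[OF abs_ge_self[of K] L1_norm_nonneg[of M f]] by linarith
  \<comment> \<open>A strictly positive integrable weight gives a finite measure \<open>N\<close>
    with the same null sets, and division by \<open>w\<close> maps L1 of \<open>M\<close>
    isometrically onto L1 of \<open>N\<close>.\<close>
  obtain w :: "'a \<Rightarrow> real" where w[measurable]: "w \<in> borel_measurable M"
    and w0: "\<And>x. 0 < w x" and wint: "integrable M w"
    using obtain_positive_integrable_function by metis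
  define N where "N = density M (\<lambda>x. ennreal (w x))"
  have w0': "0 \<le> w x" for x
    using w0[of x] by simp
  have [simp]: "space N = space M" "sets N = sets M"
    by (simp_all add: N_def)
  have intN: "integrable N f \<longleftrightarrow> f \<in> borel_measurable M \<and> integrable M (\<lambda>x. w x * f x)" for f :: "'a \<Rightarrow> real"
  proof
    assume f: "integrable N f"
    then have [measurable]: "f \<in> borel_measurable M"
      using borel_measurable_integrable[OF f] by (simp add: N_def)
    show "f \<in> borel_measurable M \<and> integrable M (\<lambda>x. w x * f x)"
      using f integrable_real_density[of w M f] w0' by (simp add: N_def)
  next
    assume "f \<in> borel_measurable M \<and> integrable M (\<lambda>x. w x * f x)"
    then show "integrable N f"
      using integrable_real_density[of w M f] w0' by (simp add: N_def)
  qed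
  have IN: "(\<integral>x. f x \<partial>N) = (\<integral>x. w x * f x \<partial>M)" if "f \<in> borel_measurable M" for f :: "'a \<Rightarrow> real"
    using integral_real_density[of w M f] that w0' by (simp add: N_def)
  interpret N: finite_measure N
  proof
    have "emeasure N (space N) = (\<integral>\<^sup>+x. ennreal (w x) \<partial>M)"
      by (simp add: N_def emeasure_density cong: nn_integral_cong_simp)
    also have "\<dots> < \<infinity>"
      using wint w0' by (simp add: integrable_iff_bounded)
    finally show "emeasure N (space N) \<noteq> \<infinity>"
      by simp
  qed
  \<comment> \<open>The added integral doubles the constant to \<open>2 * \<bar>K\<bar>\<close>; it
    is removed at the end by subtracting \<open>\<bar>K\<bar>\<close> from the density.\<close>
  define G where "G = (\<lambda>f. F (\<lambda>x. w x * f x) + \<bar>K\<bar> * (\<integral>x. f x \<partial>N))"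
  obtain \<psi> where \<psi>: "\<psi> \<in> Linf N" "\<And>f. integrable N f \<Longrightarrow> G f = (\<integral>x. f x * \<psi> x \<partial>N)"
  proof (rule N.positive_L1_functional_rep[of G "2 * \<bar>K\<bar>"])
    fix f g :: "'a \<Rightarrow> real" assume "integrable N f" "integrable N g"
    then show "G (\<lambda>x. f x + g x) = G f + G g"
      using add[of "\<lambda>x. w x * f x" "\<lambda>x. w x * g x"] by (simp add: G_def intN L1_def distrib_left)
  next
    fix c and f :: "'a \<Rightarrow> real" assume "integrable N f"
    then show "G (\<lambda>x. c * f x) = c * G f"
      using cmult[of "\<lambda>x. w x * f x" c]
      by (simp add: G_def intN L1_def distrib_left mult.left_commute)
  next
    fix f :: "'a \<Rightarrow> real" assume f: "integrable N f"
    then have F: "\<bar>F (\<lambda>x. w x * f x)\<bar> \<le> \<bar>K\<bar> * (\<integral>x. \<bar>f x\<bar> \<partial>N)"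
      using K[of "\<lambda>x. w x * f x"] w0' IN[of "\<lambda>x. \<bar>f x\<bar>"] f
      by (auto simp: intN L1_def L1_norm_def abs_mult)
    moreover have "\<bar>K\<bar> * \<bar>\<integral>x. f x \<partial>N\<bar> \<le> \<bar>K\<bar> * (\<integral>x. \<bar>f x\<bar> \<partial>N)"
      by (intro mult_left_mono integral_abs_bound) simp
    ultimately show "\<bar>G f\<bar> \<le> 2 * \<bar>K\<bar> * (\<integral>x. \<bar>f x\<bar> \<partial>N)"
      unfolding G_def
      by (intro order_trans[OF abs_triangle_ineq]) (simp add: abs_mult)
    show "0 \<le> G f" if "\<And>x. 0 \<le> f x"
      using F that by (simp add: G_def)
  qed (auto intro: that)
  have AEN: "(AE x in N. P x) \<longleftrightarrow> (AE x in M. P x)" for P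
    unfolding N_def by (subst AE_density) (auto simp: w0)
  have \<psi>M: "\<psi> \<in> borel_measurable M"
    using LinfD(1)[OF \<psi>(1)] by (simp add: N_def)
  have L: "\<psi> \<in> Linf M"
    using LinfD(2)[OF \<psi>(1)] \<psi>M by (intro LinfI) (auto simp: AEN)
  have "pairing M (\<lambda>x. \<psi> x - \<bar>K\<bar>) b = F b" if b: "b \<in> L1 M" for b
  proof -
    have [measurable]: "b \<in> borel_measurable M"
      using b by (rule L1_D)
    have w_neq[simp]: "w x \<noteq> 0" for x
      using w0[of x] by simp
    have wb: "w x * (b x / w x) = b x" for x
      by simp
    have bw: "integrable N (\<lambda>x. b x / w x)"
      using b by (simp add: intN L1_def wb)
    have "G (\<lambda>x. b x / w x) = (\<integral>x. b x / w x * \<psi> x \<partial>N)"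
      by (rule \<psi>(2)[OF bw])
    also have "\<dots> = (\<integral>x. b x * \<psi> x \<partial>M)"
      using \<psi>M w0 by (subst IN) (auto simp: wb mult.assoc[symmetric] less_imp_neq[symmetric])
    finally have "F b + \<bar>K\<bar> * (\<integral>x. b x \<partial>M) = (\<integral>x. b x * \<psi> x \<partial>M)"
      by (simp add: G_def wb IN)
    then show ?thesis
      using pairing_integrable[OF L b] b
      by (simp add: pairing_def right_diff_distrib L1_def mult.commute[of _ "\<bar>K\<bar>"])
  qed
  moreover have "(\<lambda>x. \<psi> x - \<bar>K\<bar>) \<in> Linf M"
    by (intro Linf_diff L LinfI[of _ _ "\<bar>K\<bar>"]) auto
  ultimately show ?thesis
    by blast
qed

lemma Linf_repD:
  assumes "\<exists>\<psi>\<in>Linf M. \<forall>b\<in>L1 M. pairing M \<psi> b = F b"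
  shows "Linf_rep M F \<in> Linf M" "b \<in> L1 M \<Longrightarrow> pairing M (Linf_rep M F) b = F b"
  using someI_ex[of "\<lambda>\<psi>. \<psi> \<in> Linf M \<and> (\<forall>b\<in>L1 M. pairing M \<psi> b = F b)"] assms
  by (auto simp: Linf_rep_def)

section \<open>Zero-one measures as ultrafilters\<close>

text \<open>The ultrafilter is encoded as a filter so that integration against
  \<open>\<omega>\<close> becomes a limit, whose linearity and bounds then come from the general
  rules for limits.\<close>

definition zero_one_filter :: "'a measure \<Rightarrow> ('a set \<Rightarrow> real) \<Rightarrow> 'a filter" where
  "zero_one_filter M \<omega> = (INF A\<in>{A\<in>sets M. \<omega> A = 1}. principal A)"

lemma
  assumes w: "\<omega> \<in> zero_one_ba M"
  shows zero_one_values: "A \<in> sets M \<Longrightarrow> \<omega> A = 0 \<or> \<omega> A = 1"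
    and zero_one_space: "\<omega> (space M) = 1"
    and zero_one_Un: "A \<in> sets M \<Longrightarrow> B \<in> sets M \<Longrightarrow> A \<inter> B = {} \<Longrightarrow> \<omega> (A \<union> B) = \<omega> A + \<omega> B"
    and zero_one_null: "A \<in> null_sets M \<Longrightarrow> \<omega> A = 0"
  using w by (auto simp: zero_one_ba_def ba_def additive_def)

lemma zero_one_mono:
  assumes w: "\<omega> \<in> zero_one_ba M" and A: "A \<in> sets M" "\<omega> A = 1" "A \<subseteq> B" and B: "B \<in> sets M"
  shows "\<omega> B = 1"
  using zero_one_Un[OF w, of A "B - A"] zero_one_values[OF w, of "B - A"] zero_one_values[OF w B] A B
  by (auto simp: Un_absorb1)

lemma zero_one_compl:
  assumes w: "\<omega> \<in> zero_one_ba M" and A: "A \<in> sets M"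
  shows "\<omega> (space M - A) = 1 - \<omega> A"
  using zero_one_Un[OF w, of A "space M - A"] A zero_one_space[OF w] sets.sets_into_space[OF A]
  by (auto simp: Un_absorb1)

lemma zero_one_Int:
  assumes w: "\<omega> \<in> zero_one_ba M" and A: "A \<in> sets M" "\<omega> A = 1" and B: "B \<in> sets M" "\<omega> B = 1"
  shows "\<omega> (A \<inter> B) = 1"
proof -
  have "\<omega> (space M - B) = 0"
    using zero_one_compl[OF w B(1)] B by simp
  then have "\<omega> (A - B) \<noteq> 1"
    using zero_one_mono[OF w, of "A - B" "space M - B"] A B sets.sets_into_space[OF A(1)] by auto
  then have "\<omega> (A - B) = 0"
    using zero_one_values[OF w, of "A - B"] A B by auto
  then show ?thesis
    using zero_one_Un[OF w, of "A \<inter> B" "A - B"] A B by (auto simp: Int_Diff_Un)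
qed

lemma eventually_zero_one_filter:
  assumes w: "\<omega> \<in> zero_one_ba M"
  shows "eventually P (zero_one_filter M \<omega>) \<longleftrightarrow> (\<exists>A\<in>sets M. \<omega> A = 1 \<and> (\<forall>x\<in>A. P x))"
  unfolding zero_one_filter_def
proof (subst eventually_INF_base)
  show "{A \<in> sets M. \<omega> A = 1} \<noteq> {}"
    using zero_one_space[OF w] by auto
  show "\<exists>x\<in>{A \<in> sets M. \<omega> A = 1}. principal x \<le> inf (principal a) (principal b)"
    if "a \<in> {A \<in> sets M. \<omega> A = 1}" "b \<in> {A \<in> sets M. \<omega> A = 1}" for a b
    using that zero_one_Int[OF w, of a b] by (intro bexI[of _ "a \<inter> b"]) auto
qed (auto simp: eventually_principal)

lemma zero_one_filter_nontrivial:
  assumes w: "\<omega> \<in> zero_one_ba M"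
  shows "zero_one_filter M \<omega> \<noteq> bot"
proof
  assume "zero_one_filter M \<omega> = bot"
  then have "eventually (\<lambda>x. False) (zero_one_filter M \<omega>)"
    by simp
  then have "\<omega> {} = 1"
    by (auto simp: eventually_zero_one_filter[OF w])
  then show False
    using zero_one_null[OF w, of "{}"] by simp
qed

lemma eventually_zero_one_filter_sets:
  assumes w: "\<omega> \<in> zero_one_ba M" and P: "{x\<in>space M. P x} \<in> sets M"
  shows "eventually P (zero_one_filter M \<omega>) \<longleftrightarrow> \<omega> {x\<in>space M. P x} = 1"
proof
  assume "eventually P (zero_one_filter M \<omega>)"
  then obtain A where A: "A \<in> sets M" "\<omega> A = 1" "\<forall>x\<in>A. P x"
    by (auto simp: eventually_zero_one_filter[OF w])
  then have "A \<subseteq> {x\<in>space M. P x}"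
    using sets.sets_into_space by blast
  then show "\<omega> {x\<in>space M. P x} = 1"
    using zero_one_mono[OF w A(1,2)] P by blast
next
  assume "\<omega> {x\<in>space M. P x} = 1"
  then show "eventually P (zero_one_filter M \<omega>)"
    unfolding eventually_zero_one_filter[OF w] using P by blast
qed

lemma zero_one_filter_dichotomy:
  assumes w: "\<omega> \<in> zero_one_ba M" and P: "{x\<in>space M. P x} \<in> sets M"
  shows "eventually P (zero_one_filter M \<omega>) \<or> eventually (\<lambda>x. \<not> P x) (zero_one_filter M \<omega>)"
proof -
  have eq: "space M - {x\<in>space M. P x} = {x\<in>space M. \<not> P x}"
    by auto
  have nP: "{x\<in>space M. \<not> P x} \<in> sets M"
    using P unfolding eq[symmetric] by (rule sets.compl_sets)
  show ?thesis
    using zero_one_values[OF w P] zero_one_compl[OF w P] unfolding eq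
    by (auto simp: eventually_zero_one_filter_sets[OF w P] eventually_zero_one_filter_sets[OF w nP])
qed

lemma AE_imp_eventually_zero_one_filter:
  assumes w: "\<omega> \<in> zero_one_ba M" and P: "AE x in M. P x"
  shows "eventually P (zero_one_filter M \<omega>)"
proof -
  obtain N where N: "{x\<in>space M. \<not> P x} \<subseteq> N" "N \<in> null_sets M"
    using P by (auto elim!: AE_E simp: null_sets_def)
  then have "\<omega> (space M - N) = 1"
    using zero_one_compl[OF w, of N] zero_one_null[OF w, of N] by auto
  then show ?thesis
    unfolding eventually_zero_one_filter[OF w] using N
    by (intro bexI[of _ "space M - N"]) auto
qed

section \<open>Integration against a zero-one measure as a limit along an ultrafilter\<close>

text \<open>The limit is the supremum of the numbers that are eventually below \<open>f\<close>:
  anything larger is not eventually below \<open>f\<close>, and by the dichotomy it is then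
  eventually above.\<close>

lemma zero_one_limit_exists:
  assumes w: "\<omega> \<in> zero_one_ba M" and f: "f \<in> Linf M"
  shows "\<exists>I. (f \<longlongrightarrow> I) (zero_one_filter M \<omega>)"
proof -
  let ?F = "zero_one_filter M \<omega>" and ?C = "Linf_norm M f"
  note [measurable] = LinfD(1)[OF f]
  have C: "eventually (\<lambda>x. \<bar>f x\<bar> \<le> ?C) ?F"
    by (rule AE_imp_eventually_zero_one_filter[OF w LinfD(2)[OF f]])
  define T where "T = {t. eventually (\<lambda>x. t \<le> f x) ?F}"
  have "-?C \<in> T"
    using C unfolding T_def by (auto elim!: eventually_mono)
  have upper: "t \<le> ?C" if "t \<in> T" for t
  proof -
    have "eventually (\<lambda>x. t \<le> ?C) ?F"
      using C that unfolding T_def mem_Collect_eq by eventually_elim linarith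
    then show ?thesis
      using zero_one_filter_nontrivial[OF w] by simp
  qed
  then have bdd: "bdd_above T"
    by (auto simp: bdd_above_def)
  have "(f \<longlongrightarrow> Sup T) ?F"
  proof (rule tendstoI)
    fix e :: real assume e: "e > 0"
    obtain t where t: "t \<in> T" "Sup T - e < t"
      using less_cSup_iff[OF _ bdd, of "Sup T - e"] \<open>-?C \<in> T\<close> e by auto
    have "Sup T + e \<notin> T"
      using cSup_upper[OF _ bdd, of "Sup T + e"] e by auto
    then have "eventually (\<lambda>x. \<not> Sup T + e \<le> f x) ?F"
      using zero_one_filter_dichotomy[OF w, of "\<lambda>x. Sup T + e \<le> f x"] by (auto simp: T_def)
    moreover have "eventually (\<lambda>x. t \<le> f x) ?F"
      using t by (simp add: T_def)
    ultimately show "eventually (\<lambda>x. dist (f x) (Sup T) < e) ?F"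
      by eventually_elim (use t(2) in \<open>auto simp: dist_real_def abs_less_iff\<close>)
  qed
  then show ?thesis ..
qed

text \<open>Among the finitely many level sets of \<open>s\<close> an ultrafilter selects exactly
  one, and the defining sum collapses to its value.\<close>

lemma ba_simple_integral_zero_one:
  assumes w: "\<omega> \<in> zero_one_ba M" and s: "simple_function M s"
  shows "eventually (\<lambda>x. s x = ba_simple_integral M \<omega> s) (zero_one_filter M \<omega>)"
proof -
  let ?F = "zero_one_filter M \<omega>"
  have fin: "finite (s ` space M)"
    using s by (rule simple_functionD)
  have m: "s -` {y} \<inter> space M \<in> sets M" for y
    using s by (rule simple_functionD)
  have "\<exists>y\<in>s ` space M. eventually (\<lambda>x. s x = y) ?F"
  proof (rule ccontr)
    assume "\<not> ?thesis"
    moreover have "{x\<in>space M. s x = y} \<in> sets M" for y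
      using m[of y] by (simp add: vimage_def Int_def conj_commute)
    ultimately have "\<forall>y\<in>s ` space M. eventually (\<lambda>x. s x \<noteq> y) ?F"
      using zero_one_filter_dichotomy[OF w, of "\<lambda>x. s x = _"] by blast
    then have "eventually (\<lambda>x. \<forall>y\<in>s ` space M. s x \<noteq> y) ?F"
      by (intro eventually_ball_finite fin)
    moreover have "eventually (\<lambda>x. x \<in> space M) ?F"
      by (rule AE_imp_eventually_zero_one_filter[OF w]) simp
    ultimately have "eventually (\<lambda>x. False) ?F"
      by eventually_elim auto
    then show False
      using zero_one_filter_nontrivial[OF w] by simp
  qed
  then obtain y where y: "y \<in> s ` space M" "eventually (\<lambda>x. s x = y) ?F"
    by auto
  have eq: "s -` {z} \<inter> space M = {x\<in>space M. s x = z}" for z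
    by auto
  have val: "\<omega> (s -` {z} \<inter> space M) = (if z = y then 1 else 0)" for z
  proof (cases "z = y")
    case True
    then show ?thesis
      using y(2) m[of z] unfolding eq by (simp add: eventually_zero_one_filter_sets[OF w])
  next
    case False
    have "\<not> eventually (\<lambda>x. s x = z) ?F"
    proof
      assume "eventually (\<lambda>x. s x = z) ?F"
      with y(2) have "eventually (\<lambda>x. False) ?F"
        by eventually_elim (use False in auto)
      then show False
        using zero_one_filter_nontrivial[OF w] by simp
    qed
    then show ?thesis
      using False zero_one_values[OF w m[of z]] m[of z] unfolding eq
      by (auto simp: eventually_zero_one_filter_sets[OF w])
  qed
  have "ba_simple_integral M \<omega> s = y"
    using fin y(1) unfolding ba_simple_integral_def val by (simp add: if_distrib[of "\<lambda>t. _ * t"] cong: if_cong)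
  then show ?thesis
    using y(2) by simp
qed

text \<open>The limit \<open>I\<close> differs from the integral of a simple \<open>s\<close> by at
  most the seminorm of \<open>f - s\<close>. This single estimate gives existence and uniqueness for
  the \<open>THE\<close> in \<open>ba_integral\<close>, which need not be unfolded again.\<close>

lemma tendsto_ba_integral:
  assumes w: "\<omega> \<in> zero_one_ba M" and f: "f \<in> Linf M"
  shows "(f \<longlongrightarrow> ba_integral M \<omega> f) (zero_one_filter M \<omega>)"
proof -
  let ?F = "zero_one_filter M \<omega>"
  obtain I where I: "(f \<longlongrightarrow> I) ?F"
    using zero_one_limit_exists[OF w f] ..
  have close: "\<bar>I - ba_simple_integral M \<omega> s\<bar> \<le> Linf_norm M (\<lambda>x. f x - s x)"
    if s: "simple_function M s" for s
  proof -
    have "((\<lambda>x. \<bar>f x - ba_simple_integral M \<omega> s\<bar>) \<longlongrightarrow> \<bar>I - ba_simple_integral M \<omega> s\<bar>) ?F"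
      by (intro tendsto_intros I)
    moreover have "eventually (\<lambda>x. \<bar>f x - ba_simple_integral M \<omega> s\<bar> \<le> Linf_norm M (\<lambda>x. f x - s x)) ?F"
      using ba_simple_integral_zero_one[OF w s]
        AE_imp_eventually_zero_one_filter[OF w LinfD(2)[OF Linf_diff[OF f Linf_simple_function[OF s]]]]
      by eventually_elim simp
    ultimately show ?thesis
      using zero_one_filter_nontrivial[OF w] by (rule tendsto_upperbound)
  qed
  have "ba_integral M \<omega> f = I"
    unfolding ba_integral_def
  proof (rule the_equality)
    have "\<exists>s. simple_function M s \<and> Linf_norm M (\<lambda>x. f x - s x) \<le> inverse (real (Suc n))" for n
      by (rule Linf_simple_approx[OF f, of "inverse (real (Suc n))"]) auto
    then obtain s where s: "\<And>n. simple_function M (s n)"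
        "\<And>n. Linf_norm M (\<lambda>x. f x - s n x) \<le> inverse (real (Suc n))"
      by metis
    have lim: "(\<lambda>n. Linf_norm M (\<lambda>x. f x - s n x)) \<longlonglongrightarrow> 0"
    proof (rule tendsto_sandwich[OF _ _ tendsto_const LIMSEQ_inverse_real_of_nat])
      show "\<forall>\<^sub>F n in sequentially. 0 \<le> Linf_norm M (\<lambda>x. f x - s n x)"
        by (intro always_eventually allI LinfD(3) Linf_diff f Linf_simple_function s)
      show "\<forall>\<^sub>F n in sequentially. Linf_norm M (\<lambda>x. f x - s n x) \<le> inverse (real (Suc n))"
        by (intro always_eventually allI s)
    qed
    moreover have "(\<lambda>n. I - ba_simple_integral M \<omega> (s n)) \<longlonglongrightarrow> 0"
      by (rule Lim_null_comparison[OF _ lim]) (auto intro!: always_eventually close s)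
    then have "(\<lambda>n. I - (I - ba_simple_integral M \<omega> (s n))) \<longlonglongrightarrow> I - 0"
      by (intro tendsto_intros)
    ultimately show "\<exists>s. (\<forall>n. simple_function M (s n)) \<and>
        (\<lambda>n. Linf_norm M (\<lambda>x. f x - s n x)) \<longlonglongrightarrow> 0 \<and> (\<lambda>n. ba_simple_integral M \<omega> (s n)) \<longlonglongrightarrow> I"
      using s(1) by (intro exI[of _ s]) auto
  next
    fix J assume "\<exists>s. (\<forall>n. simple_function M (s n)) \<and>
        (\<lambda>n. Linf_norm M (\<lambda>x. f x - s n x)) \<longlonglongrightarrow> 0 \<and> (\<lambda>n. ba_simple_integral M \<omega> (s n)) \<longlonglongrightarrow> J"
    then obtain s where s: "\<And>n. simple_function M (s n)" "(\<lambda>n. Linf_norm M (\<lambda>x. f x - s n x)) \<longlonglongrightarrow> 0"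
        and J: "(\<lambda>n. ba_simple_integral M \<omega> (s n)) \<longlonglongrightarrow> J"
      by auto
    have "(\<lambda>n. I - ba_simple_integral M \<omega> (s n)) \<longlonglongrightarrow> 0"
      by (rule Lim_null_comparison[OF _ s(2)]) (auto intro!: always_eventually close s)
    then have "(\<lambda>n. I - (I - ba_simple_integral M \<omega> (s n))) \<longlonglongrightarrow> I - 0"
      by (intro tendsto_intros)
    then have "(\<lambda>n. ba_simple_integral M \<omega> (s n)) \<longlonglongrightarrow> I"
      by simp
    with J show "J = I"
      by (rule LIMSEQ_unique)
  qed
  then show ?thesis
    using I by simp
qed

lemma ba_integral_eqI:
  assumes w: "\<omega> \<in> zero_one_ba M" and "f \<in> Linf M" "(f \<longlongrightarrow> I) (zero_one_filter M \<omega>)"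
  shows "ba_integral M \<omega> f = I"
  using tendsto_unique[OF zero_one_filter_nontrivial[OF w] tendsto_ba_integral[OF w]] assms by blast

lemma ba_integral_add:
  assumes w: "\<omega> \<in> zero_one_ba M" and "f \<in> Linf M" "g \<in> Linf M"
  shows "ba_integral M \<omega> (\<lambda>x. f x + g x) = ba_integral M \<omega> f + ba_integral M \<omega> g"
  using assms by (intro ba_integral_eqI tendsto_add tendsto_ba_integral Linf_add)

lemma ba_integral_cmult:
  assumes w: "\<omega> \<in> zero_one_ba M" and "f \<in> Linf M"
  shows "ba_integral M \<omega> (\<lambda>x. c * f x) = c * ba_integral M \<omega> f"
  using assms by (intro ba_integral_eqI tendsto_mult tendsto_const tendsto_ba_integral Linf_cmult)

lemma ba_integral_bound:
  assumes w: "\<omega> \<in> zero_one_ba M" and f: "f \<in> Linf M"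
  shows "\<bar>ba_integral M \<omega> f\<bar> \<le> Linf_norm M f"
proof (rule tendsto_upperbound)
  show "((\<lambda>x. \<bar>f x\<bar>) \<longlongrightarrow> \<bar>ba_integral M \<omega> f\<bar>) (zero_one_filter M \<omega>)"
    by (intro tendsto_rabs tendsto_ba_integral w f)
  show "eventually (\<lambda>x. \<bar>f x\<bar> \<le> Linf_norm M f) (zero_one_filter M \<omega>)"
    by (rule AE_imp_eventually_zero_one_filter[OF w LinfD(2)[OF f]])
qed (rule zero_one_filter_nontrivial[OF w])

lemma ba_integral_diff:
  assumes w: "\<omega> \<in> zero_one_ba M" and "f \<in> Linf M" "g \<in> Linf M"
  shows "ba_integral M \<omega> (\<lambda>x. f x - g x) = ba_integral M \<omega> f - ba_integral M \<omega> g"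
  using assms by (intro ba_integral_eqI tendsto_diff tendsto_ba_integral Linf_diff)

lemma ba_integral_in_dual_unit_ball:
  assumes "\<omega> \<in> zero_one_ba M"
  shows "restrict (ba_integral M \<omega>) (Linf M) \<in> dual_unit_ball (Linf M) (Linf_norm M)"
  using assms
  by (auto simp: dual_unit_ball_def Linf_add Linf_cmult ba_integral_add ba_integral_cmult ba_integral_bound)

section \<open>The ultrafilter lemma modulo null sets\<close>

lemma zero_one_ba_exists:
  assumes F: "\<F> \<subseteq> sets M" "\<F> \<inter> null_sets M = {}"
    and F_Int: "\<And>A B. A \<in> \<F> \<Longrightarrow> B \<in> \<F> \<Longrightarrow> A \<inter> B \<in> \<F>"
    and "\<F> \<noteq> {}"
  shows "\<exists>\<omega>\<in>zero_one_ba M. \<forall>A\<in>\<F>. \<omega> A = 1"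
proof -
  \<comment> \<open>Ordered by inclusion, these are filter bases avoiding null sets. Upward closure
    of a maximal one is recovered later, in \<open>up\<close>, from the dichotomy.\<close>
  define \<U> where "\<U> = {U. \<F> \<subseteq> U \<and> U \<subseteq> sets M \<and> U \<inter> null_sets M = {} \<and> (\<forall>A\<in>U. \<forall>B\<in>U. A \<inter> B \<in> U)}"
  have "\<exists>U\<in>\<U>. \<forall>X\<in>\<U>. U \<subseteq> X \<longrightarrow> X = U"
  proof (rule subset_Zorn_nonempty)
    have "\<F> \<in> \<U>"
      unfolding \<U>_def using F F_Int by blast
    then show "\<U> \<noteq> {}"
      by blast
    fix C assume C: "C \<noteq> {}" "subset.chain \<U> C"
    then have sub: "C \<subseteq> \<U>" and lin: "\<And>X Y. X \<in> C \<Longrightarrow> Y \<in> C \<Longrightarrow> X \<subseteq> Y \<or> Y \<subseteq> X"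
      by (auto simp: subset_chain_def)
    have "A \<inter> B \<in> \<Union>C" if A: "A \<in> \<Union>C" and B: "B \<in> \<Union>C" for A B
    proof -
      obtain X Y where XY: "A \<in> X" "X \<in> C" "B \<in> Y" "Y \<in> C"
        using A B by auto
      then obtain Z where "Z \<in> C" "A \<in> Z" "B \<in> Z"
        using lin[of X Y] by blast
      then have "A \<inter> B \<in> Z"
        using sub by (auto simp: \<U>_def)
      with \<open>Z \<in> C\<close> show ?thesis
        by blast
    qed
    moreover have "\<F> \<subseteq> \<Union>C" "\<Union>C \<subseteq> sets M" "\<Union>C \<inter> null_sets M = {}"
      using C(1) sub unfolding \<U>_def by blast+
    ultimately show "\<Union>C \<in> \<U>"
      unfolding \<U>_def by blast
  qed
  then obtain U where U: "U \<in> \<U>" and max: "\<And>X. X \<in> \<U> \<Longrightarrow> U \<subseteq> X \<Longrightarrow> X = U"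
    by blast
  have FU: "\<F> \<subseteq> U" and US: "U \<subseteq> sets M" and UN: "U \<inter> null_sets M = {}"
    and UI: "\<And>A B. A \<in> U \<Longrightarrow> B \<in> U \<Longrightarrow> A \<inter> B \<in> U"
    using U by (auto simp: \<U>_def)
  \<comment> \<open>A set that meets every member of \<open>U\<close> in a non-null set can be
    adjoined: \<open>X\<close> is the filter generated by \<open>U\<close> and \<open>A\<close>, and
    maximality forces \<open>X = U\<close>.\<close>
  have in_U: "A \<in> U" if A: "A \<in> sets M" and AB: "\<And>B. B \<in> U \<Longrightarrow> A \<inter> B \<notin> null_sets M" for A
  proof -
    define X where "X = {C\<in>sets M. \<exists>B\<in>U. A \<inter> B \<subseteq> C}"
    have UX: "U \<subseteq> X"
      using US by (auto simp: X_def)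
    moreover have "X \<in> \<U>"
    proof -
      have "C \<notin> null_sets M" if "C \<in> X" for C
      proof
        assume C: "C \<in> null_sets M"
        obtain B where B: "B \<in> U" "A \<inter> B \<subseteq> C"
          using \<open>C \<in> X\<close> by (auto simp: X_def)
        then have "A \<inter> B \<in> null_sets M"
          using A US by (intro null_sets_subset[OF C]) auto
        then show False
          using AB[OF B(1)] by simp
      qed
      moreover have "C1 \<inter> C2 \<in> X" if C12: "C1 \<in> X" "C2 \<in> X" for C1 C2
      proof -
        obtain B1 B2 where "B1 \<in> U" "A \<inter> B1 \<subseteq> C1" "B2 \<in> U" "A \<inter> B2 \<subseteq> C2"
          using C12 unfolding X_def by blast
        then have "B1 \<inter> B2 \<in> U" "A \<inter> (B1 \<inter> B2) \<subseteq> C1 \<inter> C2"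
          using UI by auto
        then show ?thesis
          using C12 unfolding X_def by blast
      qed
      ultimately show ?thesis
        using UX FU by (auto simp: \<U>_def X_def)
    qed
    ultimately have "X = U"
      using max by blast
    moreover have "A \<in> X"
      using A FU \<open>\<F> \<noteq> {}\<close> by (auto simp: X_def)
    ultimately show ?thesis
      by simp
  qed
  have em: "{} \<notin> U"
    using UN by auto
  have dich: "A \<in> U \<or> space M - A \<in> U" if A: "A \<in> sets M" for A
  proof (rule ccontr)
    assume "\<not> ?thesis"
    then obtain B1 B2 where B: "B1 \<in> U" "A \<inter> B1 \<in> null_sets M" "B2 \<in> U" "(space M - A) \<inter> B2 \<in> null_sets M"
      using in_U[OF A] in_U[of "space M - A"] A by blast
    have "(A \<inter> B1) \<union> ((space M - A) \<inter> B2) \<in> null_sets M"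
      using B by blast
    moreover have "B1 \<inter> B2 \<subseteq> (A \<inter> B1) \<union> ((space M - A) \<inter> B2)"
      using US B sets.sets_into_space by blast
    moreover have "B1 \<inter> B2 \<in> U"
      using UI B by blast
    ultimately have "B1 \<inter> B2 \<in> null_sets M"
      using US null_sets_subset by blast
    then show False
      using UN \<open>B1 \<inter> B2 \<in> U\<close> by blast
  qed
  have up: "B \<in> U" if "A \<in> U" "A \<subseteq> B" "B \<in> sets M" for A B
  proof (rule ccontr)
    assume "B \<notin> U"
    then have "A \<inter> (space M - B) \<in> U"
      using dich that UI by blast
    moreover have "A \<inter> (space M - B) = {}"
      using that by auto
    ultimately show False
      using em by simp
  qed
  define \<omega> where "\<omega> = restrict (\<lambda>A. if A \<in> U then 1 else 0 :: real) (sets M)"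
  have sp: "space M \<in> U"
    using dich[of "space M"] em by auto
  have UN': "A \<in> U \<or> B \<in> U" if "A \<in> sets M" "B \<in> sets M" "A \<union> B \<in> U" for A B
  proof (rule ccontr)
    assume "\<not> ?thesis"
    then have "(A \<union> B) \<inter> ((space M - A) \<inter> (space M - B)) \<in> U"
      using dich[OF that(1)] dich[OF that(2)] that(3) UI by blast
    moreover have "(A \<union> B) \<inter> ((space M - A) \<inter> (space M - B)) = {}"
      by auto
    ultimately show False
      using em by simp
  qed
  have "\<omega> (A \<union> B) = \<omega> A + \<omega> B" if AB: "A \<in> sets M" "B \<in> sets M" "A \<inter> B = {}" for A B
  proof -
    have "\<not> (A \<in> U \<and> B \<in> U)"
      using UI[of A B] AB em by auto
    moreover have "A \<union> B \<in> U \<longleftrightarrow> A \<in> U \<or> B \<in> U"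
      using UN'[OF AB(1,2)] up[of A "A \<union> B"] up[of B "A \<union> B"] AB by auto
    ultimately show ?thesis
      using AB by (auto simp: \<omega>_def)
  qed
  moreover have "\<bar>\<omega> A\<bar> \<le> 1" if "A \<in> sets M" for A
    using that by (simp add: \<omega>_def)
  moreover have "\<omega> A = 0" if "A \<in> null_sets M" for A
    using that UN by (auto simp: \<omega>_def)
  ultimately have "\<omega> \<in> zero_one_ba M"
    using sp by (auto simp: zero_one_ba_def ba_def additive_def \<omega>_def)
  moreover have "\<forall>A\<in>\<F>. \<omega> A = 1"
    using FU F by (auto simp: \<omega>_def)
  ultimately show ?thesis
    by blast
qed

section \<open>Asplund sets and uniform separability\<close>

text \<open>The approximating functionals are not required to lie in \<open>X\<close>; by the triangle inequality this
  makes no difference.\<close>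

definition sup_separable :: "'a set \<Rightarrow> ('a \<Rightarrow> real) set \<Rightarrow> bool" where
  "sup_separable C X \<longleftrightarrow>
     (\<exists>D. countable D \<and> (\<forall>f\<in>X. \<forall>\<epsilon>>0. \<exists>d\<in>D. \<forall>u\<in>C. \<bar>f u - d u\<bar> \<le> \<epsilon>))"

lemma sup_separable_mono: "sup_separable C X \<Longrightarrow> Y \<subseteq> X \<Longrightarrow> sup_separable C Y"
  unfolding sup_separable_def by blast

lemma sup_separableI:
  assumes "\<And>\<epsilon>. \<epsilon> > 0 \<Longrightarrow> \<exists>D. countable D \<and> (\<forall>f\<in>X. \<exists>d\<in>D. \<forall>u\<in>C. \<bar>f u - d u\<bar> \<le> \<epsilon>)"
  shows "sup_separable C X"
proof -
  have "\<exists>D. countable D \<and> (\<forall>f\<in>X. \<exists>d\<in>D. \<forall>u\<in>C. \<bar>f u - d u\<bar> \<le> inverse (real (Suc n)))" for n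
    by (rule assms) simp
  then obtain D where D: "\<And>n. countable (D n)"
      "\<And>n f. f \<in> X \<Longrightarrow> \<exists>d\<in>D n. \<forall>u\<in>C. \<bar>f u - d u\<bar> \<le> inverse (real (Suc n))"
    by metis
  have "\<exists>d\<in>(\<Union>n. D n). \<forall>u\<in>C. \<bar>f u - d u\<bar> \<le> \<epsilon>" if f: "f \<in> X" and e: "\<epsilon> > 0" for f \<epsilon>
  proof -
    obtain n where n: "inverse (real (Suc n)) < \<epsilon>"
      using reals_Archimedean[OF e] by auto
    obtain d where "d \<in> D n" "\<forall>u\<in>C. \<bar>f u - d u\<bar> \<le> inverse (real (Suc n))"
      using D(2)[OF f] by blast
    then show ?thesis
      using n by (intro bexI[of _ d]) (auto intro: order_trans less_imp_le)
  qed
  then show ?thesis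
    unfolding sup_separable_def using D(1) by (intro exI[of _ "\<Union>n. D n"]) auto
qed

text \<open>For every centre and tolerance realised by some member of \<open>X\<close>, one such
  member is selected. Passing through the old centre costs two errors, hence the
  \<open>\<epsilon> / 2\<close>.\<close>

lemma sup_separable_obtain_subset:
  assumes "sup_separable C X"
  obtains D where "countable D" "D \<subseteq> X" "\<And>f \<epsilon>. f \<in> X \<Longrightarrow> \<epsilon> > 0 \<Longrightarrow> \<exists>d\<in>D. \<forall>u\<in>C. \<bar>f u - d u\<bar> \<le> \<epsilon>"
proof -
  obtain D where D: "countable D" "\<And>f \<epsilon>. f \<in> X \<Longrightarrow> \<epsilon> > 0 \<Longrightarrow> \<exists>d\<in>D. \<forall>u\<in>C. \<bar>f u - d u\<bar> \<le> \<epsilon>"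
    using assms unfolding sup_separable_def by blast
  define good where "good = (\<lambda>d n f. f \<in> X \<and> (\<forall>u\<in>C. \<bar>f u - d u\<bar> \<le> inverse (real (Suc n))))"
  define pick where "pick = (\<lambda>(d, n). SOME f. good d n f)"
  define P where "P = {(d, n). d \<in> D \<and> (\<exists>f. good d n f)}"
  have pick: "good d n (pick (d, n))" if "(d, n) \<in> P" for d n
    using that someI_ex[of "good d n"] by (auto simp: P_def pick_def)
  show thesis
  proof
    have "countable (D \<times> (UNIV :: nat set))"
      using D(1) by simp
    then have "countable P"
      by (rule countable_subset[rotated]) (auto simp: P_def)
    then show "countable (pick ` P)"
      by simp
    show "pick ` P \<subseteq> X"
      using pick by (auto simp: good_def)
    fix f \<epsilon> assume f: "f \<in> X" and e: "(0::real) < \<epsilon>"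
    obtain n where n: "inverse (real (Suc n)) < \<epsilon> / 2"
      using reals_Archimedean[of "\<epsilon> / 2"] e by auto
    obtain d where d: "d \<in> D" "\<forall>u\<in>C. \<bar>f u - d u\<bar> \<le> inverse (real (Suc n))"
      using D(2)[OF f, of "inverse (real (Suc n))"] by auto
    then have dn: "(d, n) \<in> P"
      using f by (auto simp: P_def good_def)
    have "\<bar>f u - pick (d, n) u\<bar> \<le> \<epsilon>" if "u \<in> C" for u
    proof -
      have "\<bar>f u - d u\<bar> \<le> inverse (real (Suc n))" "\<bar>pick (d, n) u - d u\<bar> \<le> inverse (real (Suc n))"
        using d(2) pick[OF dn] that by (auto simp: good_def)
      with n show ?thesis
        by linarith
    qed
    with dn show "\<exists>d\<in>pick ` P. \<forall>u\<in>C. \<bar>f u - d u\<bar> \<le> \<epsilon>"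
      by blast
  qed
qed

section \<open>The dual unit ball in its weak-star topology\<close>

lemma dual_unit_ballD:
  assumes "\<psi> \<in> dual_unit_ball V N"
  shows "f \<in> V \<Longrightarrow> g \<in> V \<Longrightarrow> \<psi> (\<lambda>x. f x + g x) = \<psi> f + \<psi> g"
    and "f \<in> V \<Longrightarrow> \<psi> (\<lambda>x. c * f x) = c * \<psi> f"
    and "f \<in> V \<Longrightarrow> \<bar>\<psi> f\<bar> \<le> N f"
  using assms by (auto simp: dual_unit_ball_def)

lemma topspace_weak_star_ball: "topspace (weak_star_ball V N) = dual_unit_ball V N"
  by (auto simp: weak_star_ball_def dual_unit_ball_def PiE_def)

lemma continuous_map_weak_star_eval:
  "f \<in> V \<Longrightarrow> continuous_map (weak_star_ball V N) euclideanreal (\<lambda>\<psi>. \<psi> f)"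
  unfolding weak_star_ball_def
  by (intro continuous_map_from_subtopology continuous_map_product_projection)

lemma Hausdorff_weak_star_ball: "Hausdorff_space (weak_star_ball V N)"
  unfolding weak_star_ball_def
  by (intro Hausdorff_space_subtopology) (simp add: Hausdorff_space_product_topology)

text \<open>Banach-Alaoglu: the product of the intervals \<open>{- N f..N f}\<close> is compact by
  Tychonoff's theorem, and each linearity identity involves finitely many coordinates, so it cuts
  out a closed set.\<close>

lemma compact_weak_star_ball:
  assumes add: "\<And>f g. f \<in> V \<Longrightarrow> g \<in> V \<Longrightarrow> (\<lambda>x. f x + g x) \<in> V"
    and cmult: "\<And>c f. f \<in> V \<Longrightarrow> (\<lambda>x. c * f x) \<in> V"
  shows "compact_space (weak_star_ball V N)"
proof -
  let ?P = "product_topology (\<lambda>_. euclideanreal) V"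
  let ?A = "\<lambda>f g. {\<psi> \<in> topspace ?P. \<psi> (\<lambda>x. f x + g x) - \<psi> f - \<psi> g \<in> {0}}"
  let ?M = "\<lambda>c f. {\<psi> \<in> topspace ?P. \<psi> (\<lambda>x. c * f x) - c * \<psi> f \<in> {0}}"
  \<comment> \<open>Inserting the whole space keeps the family nonempty, as
    \<open>closedin_Inter\<close> requires, even if \<open>V\<close> is empty.\<close>
  let ?K = "insert (topspace ?P) ({?A f g |f g. f \<in> V \<and> g \<in> V} \<union> {?M c f |c f. f \<in> V})"
  have ev: "continuous_map ?P euclideanreal (\<lambda>\<psi>. \<psi> f)" if "f \<in> V" for f
    using that by (rule continuous_map_product_projection)
  have "closedin ?P (?A f g)" if "f \<in> V" "g \<in> V" for f g
    by (rule closedin_continuous_map_preimage[where Y = euclideanreal])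
      (auto intro!: continuous_map_diff ev that add)
  moreover have "closedin ?P (?M c f)" if "f \<in> V" for c f
    by (rule closedin_continuous_map_preimage[where Y = euclideanreal])
      (auto intro!: continuous_map_diff continuous_map_real_mult ev that cmult)
  ultimately have "closedin ?P (\<Inter>?K)"
    using closedin_topspace[of ?P] by (intro closedin_Inter) (blast, elim insertE UnE CollectE exE conjE, simp_all only:)
  moreover have "compactin ?P (PiE V (\<lambda>f. {- N f..N f}))"
    by (simp add: compactin_PiE)
  ultimately have "compactin ?P (PiE V (\<lambda>f. {- N f..N f}) \<inter> \<Inter>?K)"
    by (rule compact_Int_closedin[rotated])
  moreover have "PiE V (\<lambda>f. {- N f..N f}) \<inter> \<Inter>?K = dual_unit_ball V N"
  proof (intro equalityI subsetI)
    fix \<psi> assume "\<psi> \<in> PiE V (\<lambda>f. {- N f..N f}) \<inter> \<Inter>?K"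
    then have 1: "\<psi> \<in> PiE V (\<lambda>f. {- N f..N f})" and all: "\<And>S. S \<in> ?K \<Longrightarrow> \<psi> \<in> S"
      by (simp_all only: Int_iff Inter_iff)
    have 2: "\<psi> \<in> ?A f g" if "f \<in> V" "g \<in> V" for f g
      by (rule all) (use that in blast)
    have 3: "\<psi> \<in> ?M c f" if "f \<in> V" for c f
      by (rule all) (use that in blast)
    have "\<bar>\<psi> f\<bar> \<le> N f" if "f \<in> V" for f
      using PiE_mem[OF 1 that] by (auto simp: abs_le_iff)
    moreover have "\<psi> (\<lambda>x. f x + g x) = \<psi> f + \<psi> g" if "f \<in> V" "g \<in> V" for f g
      using 2[OF that] by simp
    moreover have "\<psi> (\<lambda>x. c * f x) = c * \<psi> f" if "f \<in> V" for c f
      using 3[OF that] by simp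
    ultimately show "\<psi> \<in> dual_unit_ball V N"
      using 1 by (simp add: dual_unit_ball_def PiE_iff)
  next
    fix \<psi> assume \<psi>: "\<psi> \<in> dual_unit_ball V N"
    then have 1: "\<psi> \<in> topspace ?P"
      by (simp add: dual_unit_ball_def PiE_iff)
    have "\<psi> f \<in> {- N f..N f}" if "f \<in> V" for f
      using dual_unit_ballD(3)[OF \<psi> that] by (auto simp: abs_le_iff)
    then have "\<psi> \<in> PiE V (\<lambda>f. {- N f..N f})"
      using \<psi> by (simp add: PiE_iff dual_unit_ball_def)
    moreover have "\<psi> \<in> \<Inter>?K"
      using 1 dual_unit_ballD(1,2)[OF \<psi>] by auto
    ultimately show "\<psi> \<in> PiE V (\<lambda>f. {- N f..N f}) \<inter> \<Inter>?K"
      by blast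
  qed
  ultimately show ?thesis
    by (simp add: weak_star_ball_def compact_space_subtopology)
qed

text \<open>Countably many weak-star closed sets of small uniform diameter cover the weak-star closure of
  the given set, so by Baire's theorem one of them has interior.\<close>

lemma asplund_set_of_sup_separable:
  assumes add: "\<And>f g. f \<in> V \<Longrightarrow> g \<in> V \<Longrightarrow> (\<lambda>x. f x + g x) \<in> V"
    and cmult: "\<And>c f. f \<in> V \<Longrightarrow> (\<lambda>x. c * f x) \<in> V"
    and CV: "C \<subseteq> V" and bdd: "\<And>f. f \<in> C \<Longrightarrow> N f \<le> K"
    and sep: "sup_separable C (dual_unit_ball V N)"
  shows "asplund_set V N C"
  unfolding asplund_set_def
proof (intro conjI allI impI)
  fix A and \<epsilon> :: real
  assume A: "A \<subseteq> dual_unit_ball V N" "A \<noteq> {}" and e: "0 < \<epsilon>"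
  let ?X = "weak_star_ball V N" and ?B = "dual_unit_ball V N"
  \<comment> \<open>With radius \<open>\<epsilon> / 5\<close>, two members of one piece
    \<open>E d\<close> differ by at most \<open>2 * \<epsilon> / 5\<close> at each \<open>f\<close>,
    which leaves room for the strict bound on the diameter.\<close>
  obtain D where D: "countable D" "\<And>\<psi>. \<psi> \<in> ?B \<Longrightarrow> \<exists>d\<in>D. \<forall>f\<in>C. \<bar>\<psi> f - d f\<bar> \<le> \<epsilon> / 5"
    using sep e unfolding sup_separable_def by (metis zero_less_divide_iff zero_less_numeral)
  define E where "E = (\<lambda>d. \<Inter>(insert ?B ((\<lambda>f. {\<psi>\<in>?B. \<psi> f \<in> {d f - \<epsilon> / 5..d f + \<epsilon> / 5}}) ` C)))"
  have E_closed: "closedin ?X (E d)" for d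
    unfolding E_def
  proof (rule closedin_Inter)
    fix S assume "S \<in> insert ?B ((\<lambda>f. {\<psi>\<in>?B. \<psi> f \<in> {d f - \<epsilon> / 5..d f + \<epsilon> / 5}}) ` C)"
    then consider "S = ?B" | f where "f \<in> C" "S = {\<psi>\<in>?B. \<psi> f \<in> {d f - \<epsilon> / 5..d f + \<epsilon> / 5}}"
      by blast
    then show "closedin ?X S"
    proof cases
      case 1
      then show ?thesis
        using closedin_topspace[of ?X] by (simp add: topspace_weak_star_ball)
    next
      case 2
      then show ?thesis
        using closedin_continuous_map_preimage[OF continuous_map_weak_star_eval[of f V N],
            of "{d f - \<epsilon> / 5..d f + \<epsilon> / 5}"] CV
        by (auto simp: topspace_weak_star_ball)
    qed
  qed simp
  \<comment> \<open>\<open>A\<close> itself need not be a Baire space; its closure is compact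
    Hausdorff, and an open set that meets the closure also meets \<open>A\<close>.\<close>
  let ?K = "?X closure_of A"
  let ?Y = "subtopology ?X ?K"
  have KB: "?K \<subseteq> ?B"
    using closure_of_subset_topspace[of ?X A] by (simp add: topspace_weak_star_ball)
  have AK: "A \<subseteq> ?K"
    using A closure_of_subset[of A ?X] by (simp add: topspace_weak_star_ball)
  have top_Y: "topspace ?Y = ?K"
    using KB by (auto simp: topspace_weak_star_ball)
  have "compact_space ?X"
    by (rule compact_weak_star_ball; fact)
  then have "compact_space ?Y"
    by (intro compact_space_subtopology closedin_compact_space closedin_closure_of)
  moreover have "Hausdorff_space ?Y"
    by (intro Hausdorff_space_subtopology Hausdorff_weak_star_ball)
  ultimately have "locally_compact_space ?Y \<and> regular_space ?Y"
    by (simp add: compact_imp_locally_compact_space compact_Hausdorff_imp_regular_space)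
  moreover have "countable ((\<lambda>d. ?K \<inter> E d) ` D)"
    using D(1) by simp
  moreover have "closedin ?Y (?K \<inter> E d)" for d
    by (rule closedin_subtopology_Int_closed[OF E_closed])
  moreover have "?K \<subseteq> \<Union>((\<lambda>d. ?K \<inter> E d) ` D)"
  proof
    fix \<psi> assume \<psi>: "\<psi> \<in> ?K"
    then obtain d where d: "d \<in> D" "\<forall>f\<in>C. \<bar>\<psi> f - d f\<bar> \<le> \<epsilon> / 5"
      using D(2) KB by blast
    have "\<psi> \<in> ?B"
      using \<psi> KB by blast
    moreover have "\<psi> f \<in> {d f - \<epsilon> / 5..d f + \<epsilon> / 5}" if "f \<in> C" for f
      using bspec[OF d(2) that] unfolding abs_le_iff atLeastAtMost_iff by linarith
    ultimately have "\<psi> \<in> E d"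
      unfolding E_def by blast
    then show "\<psi> \<in> \<Union>((\<lambda>d. ?K \<inter> E d) ` D)"
      using \<psi> d by blast
  qed
  then have "\<Union>((\<lambda>d. ?K \<inter> E d) ` D) = topspace ?Y"
    unfolding top_Y by blast
  moreover have "?Y interior_of (topspace ?Y) \<noteq> {}"
    using interior_of_topspace[of ?Y] AK A(2) unfolding top_Y by auto
  ultimately obtain d where "d \<in> D" "?Y interior_of (?K \<inter> E d) \<noteq> {}"
    using Baire_category_alt[of ?Y "(\<lambda>d. ?K \<inter> E d) ` D"] by fastforce
  moreover have "openin ?Y (?Y interior_of (?K \<inter> E d))"
    by simp
  ultimately obtain W where W: "openin ?X W" "?Y interior_of (?K \<inter> E d) = W \<inter> ?K"
    unfolding openin_subtopology by blast
  have WE: "W \<inter> A \<subseteq> E d"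
    using W(2) interior_of_subset[of ?Y "?K \<inter> E d"] AK by blast
  have WA: "W \<inter> A \<noteq> {}"
    using openin_Int_closure_of_eq_empty[OF W(1), of A] W(2) \<open>?Y interior_of (?K \<inter> E d) \<noteq> {}\<close>
    by simp
  have "diameter ((\<lambda>\<psi>. \<psi> f) ` (W \<inter> A)) < \<epsilon>" if f: "f \<in> C" for f
  proof -
    have "diameter ((\<lambda>\<psi>. \<psi> f) ` (W \<inter> A)) \<le> 2 * \<epsilon> / 5"
    proof (rule diameter_le)
      fix s t assume "s \<in> (\<lambda>\<psi>. \<psi> f) ` (W \<inter> A)" "t \<in> (\<lambda>\<psi>. \<psi> f) ` (W \<inter> A)"
      then obtain \<psi> \<psi>' where st: "s = \<psi> f" "t = \<psi>' f" "\<psi> \<in> E d" "\<psi>' \<in> E d"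
        using WE by blast
      have "s \<in> {d f - \<epsilon> / 5..d f + \<epsilon> / 5}" "t \<in> {d f - \<epsilon> / 5..d f + \<epsilon> / 5}"
        using st f by (auto simp: E_def)
      then show "norm (s - t) \<le> 2 * \<epsilon> / 5"
        unfolding atLeastAtMost_iff real_norm_def abs_le_iff by linarith
    qed (use e in auto)
    then show ?thesis
      using e by simp
  qed
  with W(1) WA show "\<exists>W. openin ?X W \<and> W \<inter> A \<noteq> {} \<and> (\<forall>f\<in>C. diameter ((\<lambda>\<psi>. \<psi> f) ` (W \<inter> A)) < \<epsilon>)"
    by blast
qed (use CV bdd in auto)

text \<open>The sequence \<open>q\<close> of evaluations maps the ball onto a compact metrizable space.  Fragmentability
  passes to the image: a weak-star closed set that is minimal among those meeting all fibres over \<open>Y\<close>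
  has a small relatively open piece, which by minimality contains all its points over some open set.\<close>

lemma asplund_set_imp_countable_cover:
  fixes c :: "nat \<Rightarrow> 'a \<Rightarrow> real"
  assumes add: "\<And>f g. f \<in> V \<Longrightarrow> g \<in> V \<Longrightarrow> (\<lambda>x. f x + g x) \<in> V"
    and cmult: "\<And>c f. f \<in> V \<Longrightarrow> (\<lambda>x. c * f x) \<in> V"
    and asp: "asplund_set V N C" and c: "range c \<subseteq> C" and e: "0 < \<epsilon>"
  shows "\<exists>D. countable D \<and> (\<forall>\<psi>\<in>dual_unit_ball V N. \<exists>d\<in>D. \<forall>n. \<bar>\<psi> (c n) - d (c n)\<bar> \<le> \<epsilon>)"
proof -
  let ?X = "weak_star_ball V N" and ?B = "dual_unit_ball V N"
  note top_X = topspace_weak_star_ball[of V N]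
  \<comment> \<open>The small sets form a sigma-ideal, and the goal is that it contains the whole
    ball.\<close>
  define small where "small = (\<lambda>P. \<exists>D. countable D \<and> (\<forall>\<psi>\<in>P. \<exists>d\<in>D. \<forall>n. \<bar>\<psi> (c n) - d (c n)\<bar> \<le> \<epsilon>))"
  have small_mono: "small P" if "small Q" "P \<subseteq> Q" for P Q
    using that unfolding small_def by blast
  have small_UN: "small (\<Union>i\<in>I. P i)" if I: "countable I" and P: "\<And>i. i \<in> I \<Longrightarrow> small (P i)"
    for I :: "(nat \<Rightarrow> real) set set" and P
  proof -
    obtain D where D: "\<And>i. i \<in> I \<Longrightarrow> countable (D i)"
        "\<And>i \<psi>. i \<in> I \<Longrightarrow> \<psi> \<in> P i \<Longrightarrow> \<exists>d\<in>D i. \<forall>n. \<bar>\<psi> (c n) - d (c n)\<bar> \<le> \<epsilon>"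
      using P unfolding small_def by metis
    then show ?thesis
      unfolding small_def using I
      by (intro exI[of _ "\<Union>i\<in>I. D i"] conjI countable_UN ballI) (auto, blast)
  qed
  have small_Un: "small (P \<union> R)" if P: "small P" and R: "small R" for P R
  proof -
    obtain D1 D2 where "countable D1" "\<forall>\<psi>\<in>P. \<exists>d\<in>D1. \<forall>n. \<bar>\<psi> (c n) - d (c n)\<bar> \<le> \<epsilon>"
      "countable D2" "\<forall>\<psi>\<in>R. \<exists>d\<in>D2. \<forall>n. \<bar>\<psi> (c n) - d (c n)\<bar> \<le> \<epsilon>"
      using P R unfolding small_def by blast
    then show ?thesis
      unfolding small_def by (intro exI[of _ "D1 \<union> D2"] conjI countable_Un ballI) blast+
  qed
  define q where "q = (\<lambda>\<psi> n. \<psi> (c n) :: real)"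
  have CV: "C \<subseteq> V"
    using asp by (simp add: asplund_set_def)
  have q_cont: "continuous_map ?X euclidean q"
    unfolding euclidean_product_topology[symmetric] continuous_map_componentwise_UNIV q_def
    using c CV by (auto intro!: continuous_map_weak_star_eval)
  have X_compact: "compact_space ?X"
    by (rule compact_weak_star_ball; fact)
  obtain \<BB> :: "(nat \<Rightarrow> real) set set" where \<BB>: "countable \<BB>" "topological_basis \<BB>"
    using ex_countable_basis by blast
  \<comment> \<open>A Lindelof argument: countably many basic open sets with small preimage are
    discarded, at the cost of a small set. If a point \<open>y\<close> of the remainder
    \<open>Y\<close> exists, no basic neighbourhood of \<open>y\<close> has a small
    preimage.\<close>
  define \<W> where "\<W> = {Q\<in>\<BB>. small (?B \<inter> q -` Q)}"
  have \<W>_small: "small (\<Union>Q\<in>\<W>. ?B \<inter> q -` Q)"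
    by (rule small_UN) (auto simp: \<W>_def intro: countable_subset[OF _ \<BB>(1)])
  define Y where "Y = q ` ?B - \<Union>\<W>"
  have "Y = {}"
  proof (rule ccontr)
    assume "Y \<noteq> {}"
    define fib where "fib = (\<lambda>y. {\<psi>\<in>?B. q \<psi> = y})"
    have fib_compact: "compactin ?X (fib y)" for y
      using closedin_compact_space[OF X_compact closedin_continuous_map_preimage[OF q_cont, of "{y}"]]
      by (simp add: fib_def top_X)
    \<comment> \<open>The complements of these open sets are the closed sets meeting every fibre
      over \<open>Y\<close>, so a maximal \<open>W0\<close> is the complement of a minimal such set.
      Compactness of the fibres keeps unions of chains in the family.\<close>
    define \<F> where "\<F> = {W. openin ?X W \<and> (\<forall>y\<in>Y. \<not> fib y \<subseteq> W)}"
    have "\<exists>W\<in>\<F>. \<forall>Z\<in>\<F>. W \<subseteq> Z \<longrightarrow> Z = W"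
    proof (rule subset_Zorn_nonempty)
      have "{} \<in> \<F>"
        by (auto simp: \<F>_def Y_def fib_def)
      then show "\<F> \<noteq> {}"
        by blast
      fix \<C> assume \<C>: "\<C> \<noteq> {}" "subset.chain \<F> \<C>"
      then have sub: "\<C> \<subseteq> \<F>" and lin: "\<And>S T. S \<in> \<C> \<Longrightarrow> T \<in> \<C> \<Longrightarrow> S \<subseteq> T \<or> T \<subseteq> S"
        by (auto simp: subset_chain_def)
      have "\<not> fib y \<subseteq> \<Union>\<C>" if y: "y \<in> Y" for y
      proof
        assume "fib y \<subseteq> \<Union>\<C>"
        then obtain \<D> where \<D>: "finite \<D>" "\<D> \<subseteq> \<C>" "fib y \<subseteq> \<Union>\<D>"
          using compactinD[OF fib_compact, of \<C> y] sub unfolding \<F>_def by blast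
        have "fib y \<noteq> {}"
          using y by (auto simp: Y_def fib_def)
        then have "\<D> \<noteq> {}"
          using \<D> by auto
        have "\<exists>S\<in>\<D>. \<Union>\<D> \<subseteq> S"
          using \<D>(1) \<open>\<D> \<noteq> {}\<close> \<D>(2)
        proof (induction \<D> rule: finite_ne_induct)
          case (insert S \<D>)
          then obtain T where T: "T \<in> \<D>" "\<Union>\<D> \<subseteq> T"
            by auto
          then have "S \<subseteq> T \<or> T \<subseteq> S"
            using insert.prems by (intro lin) auto
          then show ?case
          proof
            assume "S \<subseteq> T"
            then show ?thesis
              using T by (intro bexI[of _ T]) auto
          next
            assume "T \<subseteq> S"
            then show ?thesis
              using T by (intro bexI[of _ S]) auto
          qed
        qed simp
        then obtain S where "S \<in> \<F>" "fib y \<subseteq> S"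
          using \<D> sub by blast
        then show False
          using y unfolding \<F>_def by blast
      qed
      then show "\<Union>\<C> \<in> \<F>"
        using sub by (auto simp: \<F>_def)
    qed
    then obtain W0 where W0: "W0 \<in> \<F>" and max: "\<And>Z. Z \<in> \<F> \<Longrightarrow> W0 \<subseteq> Z \<Longrightarrow> Z = W0"
      by blast
    have "?B - W0 \<noteq> {}"
      using W0 \<open>Y \<noteq> {}\<close> by (auto simp: \<F>_def fib_def)
    moreover have "?B - W0 \<subseteq> ?B"
      by blast
    ultimately obtain W where W: "openin ?X W" "W \<inter> (?B - W0) \<noteq> {}"
        "\<And>f. f \<in> C \<Longrightarrow> diameter ((\<lambda>\<psi>. \<psi> f) ` (W \<inter> (?B - W0))) < \<epsilon>"
      using asp e unfolding asplund_set_def by meson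
    have W0_open: "openin ?X W0"
      using W0 by (simp add: \<F>_def)
    \<comment> \<open>\<open>W\<close> meets the complement of \<open>W0\<close>, so the union is
      strictly larger than \<open>W0\<close> and, by maximality, swallows a whole fibre.\<close>
    have "W0 \<union> W \<notin> \<F>"
      using max[of "W0 \<union> W"] W(2) by blast
    then obtain y where y: "y \<in> Y" "fib y \<subseteq> W0 \<union> W"
      using W0_open W(1) by (auto simp: \<F>_def)
    have "closedin ?X (?B - (W0 \<union> W))"
      using closedin_diff[OF closedin_topspace openin_Un[OF W0_open W(1)]] by (simp add: top_X)
    \<comment> \<open>Since this image is closed, not only the fibre over \<open>y\<close> but all
      fibres over some basic neighbourhood \<open>Q\<close> lie in
      \<open>W0 \<union> W\<close>.\<close>
    then have "compact (q ` (?B - (W0 \<union> W)))"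
      using image_compactin[OF closedin_compact_space[OF X_compact] q_cont] by simp
    then have "open (- q ` (?B - (W0 \<union> W)))"
      by (intro open_Compl compact_imp_closed)
    moreover have "y \<in> - q ` (?B - (W0 \<union> W))"
      using y(2) by (auto simp: fib_def)
    ultimately obtain Q where Q: "Q \<in> \<BB>" "y \<in> Q" "Q \<subseteq> - q ` (?B - (W0 \<union> W))"
      using topological_basisE[OF \<BB>(2)] by metis
    obtain \<psi>0 where \<psi>0: "\<psi>0 \<in> W \<inter> (?B - W0)"
      using W(2) by blast
    \<comment> \<open>A fibre over a point of \<open>Y\<close> has a member \<open>\<psi>'\<close>
      outside \<open>W0\<close>. Over \<open>Q\<close> it must lie in \<open>W\<close>, hence near
      \<open>\<psi>0\<close>, and it takes the same values as \<open>\<psi>\<close> at all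
      \<open>c n\<close>.\<close>
    have near: "\<forall>n. \<bar>\<psi> (c n) - \<psi>0 (c n)\<bar> \<le> \<epsilon>" if \<psi>: "\<psi> \<in> ?B" "q \<psi> \<in> Q" "q \<psi> \<in> Y" for \<psi>
    proof
      fix n
      obtain \<psi>' where \<psi>': "\<psi>' \<in> ?B" "q \<psi>' = q \<psi>" "\<psi>' \<notin> W0"
        using W0 \<psi>(3) by (auto simp: \<F>_def fib_def)
      then have "\<psi>' \<in> W"
        using Q(3) \<psi>(2) by (metis ComplD DiffI UnE image_eqI subsetD)
      have cn: "c n \<in> C" "c n \<in> V"
        using c CV by auto
      have "bounded ((\<lambda>\<psi>. \<psi> (c n)) ` (W \<inter> (?B - W0)))"
        unfolding bounded_iff using dual_unit_ballD(3)[of _ V N "c n"] cn by auto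
      then have "dist (\<psi>' (c n)) (\<psi>0 (c n)) \<le> diameter ((\<lambda>\<psi>. \<psi> (c n)) ` (W \<inter> (?B - W0)))"
        using \<psi>0 \<psi>' \<open>\<psi>' \<in> W\<close> by (intro diameter_bounded_bound) auto
      moreover have "\<psi>' (c n) = \<psi> (c n)"
        using fun_cong[OF \<psi>'(2), of n] by (simp add: q_def)
      ultimately show "\<bar>\<psi> (c n) - \<psi>0 (c n)\<bar> \<le> \<epsilon>"
        using W(3)[OF cn(1)] by (simp add: dist_real_def)
    qed
    have "small {\<psi>\<in>?B. q \<psi> \<in> Q \<and> q \<psi> \<in> Y}"
      unfolding small_def using near by (intro exI[of _ "{\<psi>0}"]) auto
    \<comment> \<open>Whatever lies over \<open>Q\<close> but not over \<open>Y\<close> lies over a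
      discarded basic set, so the whole preimage of \<open>Q\<close> is small, contradicting the
      choice of \<open>y\<close>.\<close>
    then have "small ({\<psi>\<in>?B. q \<psi> \<in> Q \<and> q \<psi> \<in> Y} \<union> (\<Union>Q\<in>\<W>. ?B \<inter> q -` Q))"
      using \<W>_small by (rule small_Un)
    then have "small (?B \<inter> q -` Q)"
      by (rule small_mono) (auto simp: Y_def)
    then have "Q \<in> \<W>"
      using Q(1) by (simp add: \<W>_def)
    then show False
      using y(1) Q(2) by (auto simp: Y_def)
  qed
  then have "?B \<subseteq> (\<Union>Q\<in>\<W>. ?B \<inter> q -` Q)"
    by (auto simp: Y_def)
  then have "small ?B"
    by (rule small_mono[OF \<W>_small])
  then show ?thesis
    by (simp add: small_def)
qed

lemma sup_separable_of_asplund_set: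
  assumes add: "\<And>f g. f \<in> V \<Longrightarrow> g \<in> V \<Longrightarrow> (\<lambda>x. f x + g x) \<in> V"
    and cmult: "\<And>c f. f \<in> V \<Longrightarrow> (\<lambda>x. c * f x) \<in> V"
    and asp: "asplund_set V N C" and "countable C0" "C0 \<subseteq> C"
  shows "sup_separable C0 (dual_unit_ball V N)"
proof (rule sup_separableI)
  fix \<epsilon> :: real assume e: "0 < \<epsilon>"
  show "\<exists>D. countable D \<and> (\<forall>\<psi>\<in>dual_unit_ball V N. \<exists>d\<in>D. \<forall>u\<in>C0. \<bar>\<psi> u - d u\<bar> \<le> \<epsilon>)"
  proof (cases "C0 = {}")
    case True
    then show ?thesis
      by (intro exI[of _ "{\<lambda>_. 0}"]) auto
  next
    case False
    then obtain c :: "nat \<Rightarrow> 'a \<Rightarrow> real" where c: "range c = C0"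
      using \<open>countable C0\<close> uncountable_def by metis
    then have "range c \<subseteq> C"
      using \<open>C0 \<subseteq> C\<close> by simp
    then have "\<exists>D. countable D \<and> (\<forall>\<psi>\<in>dual_unit_ball V N. \<exists>d\<in>D. \<forall>n. \<bar>\<psi> (c n) - d (c n)\<bar> \<le> \<epsilon>)"
      using add cmult by (intro asplund_set_imp_countable_cover[OF _ _ asp _ e])
    then show ?thesis
      unfolding c[symmetric] ball_simps .
  qed
qed

section \<open>The Stone measure of a charge\<close>

definition charge :: "'a measure \<Rightarrow> ('a set \<Rightarrow> real) \<Rightarrow> bool" where
  "charge M p \<longleftrightarrow> (\<forall>A\<in>sets M. 0 \<le> p A) \<and>
     (\<forall>A\<in>sets M. \<forall>B\<in>sets M. A \<inter> B = {} \<longrightarrow> p (A \<union> B) = p A + p B) \<and>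
     (\<forall>A\<in>null_sets M. p A = 0)"

lemma chargeD:
  assumes "charge M p"
  shows "A \<in> sets M \<Longrightarrow> 0 \<le> p A"
    and "A \<in> sets M \<Longrightarrow> B \<in> sets M \<Longrightarrow> A \<inter> B = {} \<Longrightarrow> p (A \<union> B) = p A + p B"
    and "A \<in> null_sets M \<Longrightarrow> p A = 0"
  using assms by (auto simp: charge_def)

text \<open>A finitely additive \<open>\<mu>\<close> may lack an exact Hahn set, so the positive
  part is defined as the supremum of \<open>\<mu>\<close> over measurable subsets; the negative part
  is what remains after subtracting \<open>\<mu>\<close>.\<close>

lemma Jordan_decomposition_charge:
  fixes \<mu> :: "'a set \<Rightarrow> real"
  assumes add: "\<And>A B. A \<in> sets M \<Longrightarrow> B \<in> sets M \<Longrightarrow> A \<inter> B = {} \<Longrightarrow> \<mu> (A \<union> B) = \<mu> A + \<mu> B"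
    and bdd: "\<And>A. A \<in> sets M \<Longrightarrow> \<bar>\<mu> A\<bar> \<le> K"
    and null: "\<And>A. A \<in> null_sets M \<Longrightarrow> \<mu> A = 0"
  obtains p n where "charge M p" "charge M n" "\<And>A. A \<in> sets M \<Longrightarrow> \<mu> A = p A - n A"
proof -
  define S where "S = (\<lambda>A. \<mu> ` {B\<in>sets M. B \<subseteq> A})"
  define p where "p = (\<lambda>A. Sup (S A))"
  have bS: "bdd_above (S A)" for A
    using bdd by (auto simp: bdd_above_def S_def abs_le_iff)
  have up: "\<mu> B \<le> p A" if "B \<in> sets M" "B \<subseteq> A" for A B
    unfolding p_def by (rule cSup_upper[OF _ bS]) (use that in \<open>auto simp: S_def\<close>)
  have least: "p A \<le> x" if "\<And>B. B \<in> sets M \<Longrightarrow> B \<subseteq> A \<Longrightarrow> \<mu> B \<le> x" for A x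
    unfolding p_def by (rule cSup_least) (use that in \<open>auto simp: S_def\<close>)
  have p_add: "p (A \<union> B) = p A + p B" if AB: "A \<in> sets M" "B \<in> sets M" "A \<inter> B = {}" for A B
  proof (rule antisym)
    show "p (A \<union> B) \<le> p A + p B"
    proof (rule least)
      fix C assume C: "C \<in> sets M" "C \<subseteq> A \<union> B"
      then have "\<mu> C = \<mu> (C \<inter> A) + \<mu> (C \<inter> B)"
        using add[of "C \<inter> A" "C \<inter> B"] AB by (auto simp: Int_Un_distrib[symmetric] Int_absorb2)
      also have "\<dots> \<le> p A + p B"
        using C AB by (intro add_mono up) auto
      finally show "\<mu> C \<le> p A + p B" .
    qed
    have "\<mu> C + p B \<le> p (A \<union> B)" if C: "C \<in> sets M" "C \<subseteq> A" for C
    proof -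
      have "p B \<le> p (A \<union> B) - \<mu> C"
      proof (rule least)
        fix D assume D: "D \<in> sets M" "D \<subseteq> B"
        have "C \<inter> D = {}"
          using AB(3) C(2) D(2) by blast
        then have "\<mu> C + \<mu> D = \<mu> (C \<union> D)"
          using add[of C D] C D by auto
        also have "\<dots> \<le> p (A \<union> B)"
          using C D by (intro up) auto
        finally show "\<mu> D \<le> p (A \<union> B) - \<mu> C"
          by simp
      qed
      then show ?thesis
        by simp
    qed
    then have "p A \<le> p (A \<union> B) - p B"
      by (intro least) (simp add: le_diff_eq)
    then show "p A + p B \<le> p (A \<union> B)"
      by simp
  qed
  have null0: "\<mu> {} = 0"
    using null[of "{}"] by simp
  have pos: "0 \<le> p A" for A
    using up[of "{}" A] null0 by simp
  have "charge M p"
    unfolding charge_def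
  proof (intro conjI ballI impI pos p_add)
    fix A assume A: "A \<in> null_sets M"
    have "p A \<le> 0"
      using null null_sets_subset[OF A] by (intro least) fastforce
    then show "p A = 0"
      using pos[of A] by simp
  qed auto
  moreover have "charge M (\<lambda>A. p A - \<mu> A)"
    using up[OF _ subset_refl] p_add add chargeD(3)[OF \<open>charge M p\<close>] null by (auto simp: charge_def)
  ultimately show ?thesis
    by (rule that) simp
qed

section \<open>The Stone space of the measure algebra and its compactness\<close>

text \<open>These are the basic clopen sets of the Stone space. Its topology is never introduced as
  an object: compactness is stated for countable covers by such sets in
  \<open>clopen_compact\<close>.\<close>

definition clopen :: "'a measure \<Rightarrow> 'a set \<Rightarrow> ('a set \<Rightarrow> real) set" where
  "clopen M A = {\<omega>\<in>zero_one_ba M. \<omega> A = 1}"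

lemma clopen_subset: "clopen M A \<subseteq> zero_one_ba M"
  by (auto simp: clopen_def)

lemma clopen_null: "A \<in> null_sets M \<Longrightarrow> clopen M A = {}"
  by (auto simp: clopen_def zero_one_null)

lemma clopen_space: "clopen M (space M) = zero_one_ba M"
  by (auto simp: clopen_def zero_one_space)

lemma clopen_compl: "A \<in> sets M \<Longrightarrow> clopen M (space M - A) = zero_one_ba M - clopen M A"
  using zero_one_values by (fastforce simp: clopen_def zero_one_compl)

lemma clopen_Int:
  assumes "A \<in> sets M" "B \<in> sets M"
  shows "clopen M (A \<inter> B) = clopen M A \<inter> clopen M B"
  using assms zero_one_Int zero_one_mono[of _ M "A \<inter> B" A] zero_one_mono[of _ M "A \<inter> B" B]
  by (auto simp: clopen_def)

lemma clopen_mono: "A \<in> sets M \<Longrightarrow> B \<in> sets M \<Longrightarrow> A \<subseteq> B \<Longrightarrow> clopen M A \<subseteq> clopen M B"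
  using zero_one_mono by (auto simp: clopen_def)

lemma clopen_Diff:
  assumes "A \<in> sets M" "B \<in> sets M"
  shows "clopen M (A - B) = clopen M A - clopen M B"
proof -
  have "A - B = A \<inter> (space M - B)"
    using sets.sets_into_space[OF assms(1)] by auto
  then show ?thesis
    using assms clopen_subset[of M A] by (auto simp: clopen_Int clopen_compl)
qed

text \<open>If every finite remainder of \<open>A\<close> is non-null, the remainders form a
  decreasing family that extends to an ultrafilter: a point of \<open>clopen M A\<close> that no
  \<open>clopen M (B i)\<close> contains.\<close>

lemma clopen_compact:
  assumes A: "A \<in> sets M" and B: "\<And>i::nat. B i \<in> sets M" and cover: "clopen M A \<subseteq> (\<Union>i. clopen M (B i))"
  shows "\<exists>n. A - (\<Union>i<n. B i) \<in> null_sets M"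
proof (rule ccontr)
  assume neg: "\<nexists>n. A - (\<Union>i<n. B i) \<in> null_sets M"
  let ?F = "range (\<lambda>n. A - (\<Union>i<n. B i))"
  have "\<exists>\<omega>\<in>zero_one_ba M. \<forall>X\<in>?F. \<omega> X = 1"
  proof (rule zero_one_ba_exists)
    show "X \<inter> Y \<in> ?F" if XY: "X \<in> ?F" "Y \<in> ?F" for X Y
    proof -
      obtain m n where "X = A - (\<Union>i<m. B i)" "Y = A - (\<Union>i<n. B i)"
        using XY by blast
      then have "X \<inter> Y = A - (\<Union>i<max m n. B i)"
        by (auto simp: less_max_iff_disj)
      then show ?thesis
        by blast
    qed
  qed (use A B neg in auto)
  then obtain \<omega> where w: "\<omega> \<in> zero_one_ba M" and w1: "\<And>n. \<omega> (A - (\<Union>i<n. B i)) = 1"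
    by auto
  have "\<omega> \<in> clopen M A"
    using zero_one_mono[OF w _ w1[of 0] _ A] A w by (auto simp: clopen_def)
  then obtain i where "\<omega> \<in> clopen M (B i)"
    using cover by blast
  \<comment> \<open>The bound \<open>Suc i\<close> ensures that \<open>B i\<close> itself has been
    removed from the remainder.\<close>
  then have "\<omega> (B i \<inter> (A - (\<Union>i<Suc i. B i))) = 1"
    using B A by (intro zero_one_Int[OF w] w1) (auto simp: clopen_def)
  moreover have "B i \<inter> (A - (\<Union>i<Suc i. B i)) = {}"
    by auto
  ultimately show False
    using zero_one_null[OF w, of "{}"] by simp
qed

text \<open>Compactness applied to the empty cover. It makes the passage from sets to clopen sets
  injective modulo null sets.\<close>

lemma clopen_empty_imp_null:
  assumes "A \<in> sets M" "clopen M A = {}"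
  shows "A \<in> null_sets M"
  using clopen_compact[of A M "\<lambda>_. {}"] assms by auto

text \<open>Clopen sets are compact, so every finitely additive set function on them is countably additive.\<close>

lemma obtain_Stone_measure:
  assumes p: "charge M p"
  obtains P where "space P = zero_one_ba M" "\<And>A. A \<in> sets M \<Longrightarrow> clopen M A \<in> sets P"
    "\<And>A. A \<in> sets M \<Longrightarrow> emeasure P (clopen M A) = ennreal (p A)"
proof -
  define P where "P = extend_measure (zero_one_ba M) (sets M) (clopen M) (\<lambda>A. ennreal (p A))"
  have sub: "clopen M ` sets M \<subseteq> Pow (zero_one_ba M)"
    using clopen_subset by blast
  have alg: "algebra (zero_one_ba M) (clopen M ` sets M)"
    unfolding algebra_iff_Int
  proof (intro conjI ballI sub)
    show "{} \<in> clopen M ` sets M"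
      using clopen_null[of "{}" M] by force
    fix a assume "a \<in> clopen M ` sets M"
    then obtain A where A: "A \<in> sets M" "a = clopen M A"
      by auto
    then have "zero_one_ba M - a = clopen M (space M - A)"
      by (simp add: clopen_compl)
    then show "zero_one_ba M - a \<in> clopen M ` sets M"
      using A by blast
    fix b assume "b \<in> clopen M ` sets M"
    then obtain B where "B \<in> sets M" "b = clopen M B"
      by auto
    then have "a \<inter> b = clopen M (A \<inter> B)" "A \<inter> B \<in> sets M"
      using A by (auto simp: clopen_Int)
    then show "a \<inter> b \<in> clopen M ` sets M"
      by blast
  qed
  \<comment> \<open>Different sets can give the same clopen set, but then they differ by null sets,
    on which a charge vanishes; the premeasure is therefore well defined.\<close>
  have p_null: "p A = p B" if A: "A \<in> sets M" and B: "B \<in> sets M" and eq: "clopen M A = clopen M B" for A B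
  proof -
    have 1: "A - B \<in> null_sets M" "B - A \<in> null_sets M"
      using A B eq by (auto intro!: clopen_empty_imp_null simp: clopen_Diff)
    have "p A = p (A \<inter> B) + p (A - B)" "p B = p (A \<inter> B) + p (B - A)"
      using chargeD(2)[OF p, of "A \<inter> B" "A - B"] chargeD(2)[OF p, of "A \<inter> B" "B - A"] A B
      by (auto simp: Int_Diff_Un Int_Diff_Un[of B A, unfolded Int_commute[of B A]])
    then show ?thesis
      using 1 chargeD(3)[OF p] by simp
  qed
  have em: "emeasure P (clopen M A) = ennreal (p A)" if "A \<in> sets M" for A
  proof (rule extend_measure_caratheodory[OF P_def that])
    interpret algebra "zero_one_ba M" "clopen M ` sets M"
      by (rule alg)
    show "semiring_of_sets (zero_one_ba M) (clopen M ` sets M)"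
      by unfold_locales
    show "ennreal (p i) = 0" if "i \<in> sets M" "clopen M i = {}" for i
      using clopen_empty_imp_null[OF that] chargeD(3)[OF p] by simp
    show "ennreal (p i) = ennreal (p j)" if "i \<in> sets M" "j \<in> sets M" "clopen M i = clopen M j" for i j
      using p_null[OF that] by simp
    fix A :: "nat \<Rightarrow> 'a set" and j
    assume A: "A \<in> UNIV \<rightarrow> sets M" and j: "j \<in> sets M"
      and disj: "disjoint_family (clopen M \<circ> A)" and U: "(\<Union>i. clopen M (A i)) = clopen M j"
    have Ai: "A i \<in> sets M" for i
      using A by auto
    \<comment> \<open>By compactness all pieces from index \<open>n\<close> on turn out to be empty,
      so the series in the countable additivity condition is a finite sum.\<close>
    obtain n where n: "j - (\<Union>i<n. A i) \<in> null_sets M"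
      using clopen_compact[where B = A, OF j Ai] U by auto
    have disj': "clopen M (A i) \<inter> clopen M (A k) = {}" if "i \<noteq> k" for i k
      using disj that by (auto simp: disjoint_family_on_def)
    have clU: "clopen M (\<Union>i<m. A i) = (\<Union>i<m. clopen M (A i))" for m
    proof (induction m)
      case 0
      then show ?case
        using clopen_null[of "{}" M] by simp
    next
      case (Suc m)
      have D: "(\<Union>i<m. A i) \<in> sets M"
        using Ai by auto
      have "clopen M (A m \<union> (\<Union>i<m. A i)) = clopen M (A m) \<union> clopen M (\<Union>i<m. A i)"
      proof (rule antisym)
        show "clopen M (A m) \<union> clopen M (\<Union>i<m. A i) \<subseteq> clopen M (A m \<union> (\<Union>i<m. A i))"
          using Ai D by (intro Un_least clopen_mono) auto
        have "clopen M (A m \<union> (\<Union>i<m. A i)) - clopen M (A m) = clopen M ((A m \<union> (\<Union>i<m. A i)) - A m)"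
          using Ai D by (subst clopen_Diff) auto
        also have "\<dots> \<subseteq> clopen M (\<Union>i<m. A i)"
          using Ai D by (intro clopen_mono) auto
        finally show "clopen M (A m \<union> (\<Union>i<m. A i)) \<subseteq> clopen M (A m) \<union> clopen M (\<Union>i<m. A i)"
          by blast
      qed
      then show ?case
        using Suc by (simp add: lessThan_Suc)
    qed
    have "clopen M (j - (\<Union>i<n. A i)) = {}"
      using n by (rule clopen_null)
    then have jU: "clopen M j \<subseteq> (\<Union>i<n. clopen M (A i))"
      using j Ai by (subst (asm) clopen_Diff) (auto simp: clU)
    then have jeq: "clopen M j = clopen M (\<Union>i<n. A i)"
      using U by (auto simp: clU)
    have zero: "p (A i) = 0" if "i \<ge> n" for i
    proof -
      have "clopen M (A i) \<subseteq> (\<Union>i<n. clopen M (A i))"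
        using U jU by blast
      moreover have "clopen M (A i) \<inter> clopen M (A k) = {}" if "k < n" for k
        using disj'[of i k] that \<open>n \<le> i\<close> by simp
      ultimately have "clopen M (A i) = {}"
        by blast
      then show ?thesis
        using clopen_empty_imp_null[OF Ai] chargeD(3)[OF p] by simp
    qed
    have sum: "p (\<Union>i<m. A i) = (\<Sum>i<m. p (A i))" for m
    proof (induction m)
      case 0
      then show ?case
        using chargeD(3)[OF p, of "{}"] by simp
    next
      case (Suc m)
      have D: "(\<Union>i<m. A i) \<in> sets M"
        using Ai by auto
      \<comment> \<open>Disjointness of the clopen sets gives disjointness of the underlying
        \<open>A i\<close> only up to null sets, so the overlap is split off before additivity of
        \<open>p\<close> is applied.\<close>
      have "clopen M (A m \<inter> (\<Union>i<m. A i)) = {}"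
        unfolding clopen_Int[OF Ai D] clU using disj'[of m] by fastforce
      then have z: "p (A m \<inter> (\<Union>i<m. A i)) = 0"
        using Ai D by (intro chargeD(3)[OF p] clopen_empty_imp_null) auto
      have "p ((\<Union>i<m. A i) \<union> (A m - (\<Union>i<m. A i))) = p (\<Union>i<m. A i) + p (A m - (\<Union>i<m. A i))"
        using Ai D by (intro chargeD(2)[OF p]) auto
      moreover have "p ((A m \<inter> (\<Union>i<m. A i)) \<union> (A m - (\<Union>i<m. A i)))
          = p (A m \<inter> (\<Union>i<m. A i)) + p (A m - (\<Union>i<m. A i))"
        using Ai D by (intro chargeD(2)[OF p]) auto
      moreover have "(A m \<inter> (\<Union>i<m. A i)) \<union> (A m - (\<Union>i<m. A i)) = A m"
        by blast
      moreover have "(\<Union>i<m. A i) \<union> (A m - (\<Union>i<m. A i)) = (\<Union>i<Suc m. A i)"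
        by (auto simp: lessThan_Suc)
      ultimately show ?case
        using Suc z by simp
    qed
    have "(\<Sum>i. ennreal (p (A i))) = (\<Sum>i<n. ennreal (p (A i)))"
      by (rule suminf_finite) (auto simp: zero not_less)
    also have "\<dots> = ennreal (\<Sum>i<n. p (A i))"
      by (rule sum_ennreal) (auto intro: chargeD(1)[OF p] Ai)
    also have "\<dots> = ennreal (p j)"
      using p_null[OF j _ jeq] Ai by (simp add: sum)
    finally show "(\<Sum>i. ennreal (p (A i))) = ennreal (p j)" .
  qed auto
  have "clopen M A \<in> sets P" if "A \<in> sets M" for A
    unfolding P_def using that by (simp add: sets_extend_measure[OF sub])
  moreover have "space P = zero_one_ba M"
    unfolding P_def using sub by (intro space_extend_measure) auto
  ultimately show ?thesis
    using em by (intro that) auto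
qed

section \<open>Integration over the Stone space\<close>

locale Stone_measure =
  fixes M :: "'a measure" and p :: "'a set \<Rightarrow> real" and P :: "('a set \<Rightarrow> real) measure"
  assumes charge: "charge M p"
    and space_P: "space P = zero_one_ba M"
    and sets_P: "A \<in> sets M \<Longrightarrow> clopen M A \<in> sets P"
    and emeasure_P: "A \<in> sets M \<Longrightarrow> emeasure P (clopen M A) = ennreal (p A)"
begin

sublocale finite_measure P
proof
  show "emeasure P (space P) \<noteq> \<infinity>"
    using emeasure_P[of "space M"] by (simp add: space_P clopen_space)
qed

lemma measure_P: "A \<in> sets M \<Longrightarrow> measure P (clopen M A) = p A"
  using emeasure_P[of A] chargeD(1)[OF charge] by (simp add: measure_def)

text \<open>Superlevel sets of the evaluation are countable unions of clopen sets. The gap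
  \<open>inverse (real (Suc n))\<close> is there because a strict inequality may become an equality
  in the limit along the ultrafilter.\<close>

lemma measurable_ba_integral[measurable]:
  assumes f: "f \<in> Linf M"
  shows "(\<lambda>\<omega>. ba_integral M \<omega> f) \<in> borel_measurable P"
  unfolding borel_measurable_iff_greater
proof
  fix c :: real
  note [measurable] = LinfD(1)[OF f]
  let ?A = "\<lambda>n::nat. {x\<in>space M. c + inverse (real (Suc n)) \<le> f x}"
  have A: "?A n \<in> sets M" for n
    by measurable
  have "{\<omega>\<in>space P. c < ba_integral M \<omega> f} = (\<Union>n. clopen M (?A n))"
  proof (intro equalityI subsetI)
    fix \<omega> assume "\<omega> \<in> {\<omega>\<in>space P. c < ba_integral M \<omega> f}"
    then have w: "\<omega> \<in> zero_one_ba M" and c: "c < ba_integral M \<omega> f"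
      by (auto simp: space_P)
    obtain n where n: "inverse (real (Suc n)) < ba_integral M \<omega> f - c"
      using reals_Archimedean[of "ba_integral M \<omega> f - c"] c by auto
    have "eventually (\<lambda>x. c + inverse (real (Suc n)) < f x) (zero_one_filter M \<omega>)"
      using n by (intro order_tendstoD[OF tendsto_ba_integral[OF w f]]) simp
    then have "eventually (\<lambda>x. c + inverse (real (Suc n)) \<le> f x) (zero_one_filter M \<omega>)"
      by eventually_elim simp
    then have "\<omega> \<in> clopen M (?A n)"
      using eventually_zero_one_filter_sets[OF w A] w by (simp add: clopen_def)
    then show "\<omega> \<in> (\<Union>n. clopen M (?A n))"
      by blast
  next
    fix \<omega> assume "\<omega> \<in> (\<Union>n. clopen M (?A n))"
    then obtain n where w: "\<omega> \<in> zero_one_ba M" and n: "\<omega> (?A n) = 1"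
      by (auto simp: clopen_def)
    have "eventually (\<lambda>x. c + inverse (real (Suc n)) \<le> f x) (zero_one_filter M \<omega>)"
      using n eventually_zero_one_filter_sets[OF w A] by simp
    then have "c + inverse (real (Suc n)) \<le> ba_integral M \<omega> f"
      by (intro tendsto_lowerbound[OF tendsto_ba_integral[OF w f]] zero_one_filter_nontrivial[OF w])
    moreover have "0 < inverse (real (Suc n))"
      by simp
    ultimately have "c < ba_integral M \<omega> f"
      by linarith
    then show "\<omega> \<in> {\<omega>\<in>space P. c < ba_integral M \<omega> f}"
      using w by (simp add: space_P)
  qed
  then show "{\<omega>\<in>space P. c < ba_integral M \<omega> f} \<in> sets P"
    using sets_P[OF A] by auto
qed

lemma integrable_ba_integral:
  assumes f: "f \<in> Linf M"
  shows "integrable P (\<lambda>\<omega>. ba_integral M \<omega> f)"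
  using ba_integral_bound[OF _ f]
  by (intro integrable_const_bound[of _ "Linf_norm M f"] measurable_ba_integral f AE_I2)
    (auto simp: space_P)

text \<open>For simple \<open>s\<close> the evaluation is a finite combination of indicators of
  clopen sets, on which the Stone measure is given by \<open>p\<close>.\<close>

lemma integral_ba_integral_simple:
  assumes s: "simple_function M s"
  shows "(\<integral>\<omega>. ba_integral M \<omega> s \<partial>P) = ba_simple_integral M p s"
proof -
  let ?V = "\<lambda>y. s -` {y} \<inter> space M"
  have V: "?V y \<in> sets M" for y
    using s by (rule simple_functionD)
  have fin: "finite (s ` space M)"
    using s by (rule simple_functionD)
  have "ba_integral M \<omega> s = (\<Sum>y\<in>s ` space M. y * indicator (clopen M (?V y)) \<omega>)"
    if w: "\<omega> \<in> space P" for \<omega>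
  proof -
    have w: "\<omega> \<in> zero_one_ba M"
      using w by (simp add: space_P)
    have "(s \<longlongrightarrow> ba_simple_integral M \<omega> s) (zero_one_filter M \<omega>)"
      using ba_simple_integral_zero_one[OF w s] by (rule tendsto_eventually)
    then have "ba_integral M \<omega> s = ba_simple_integral M \<omega> s"
      by (intro ba_integral_eqI[OF w] Linf_simple_function s)
    also have "\<dots> = (\<Sum>y\<in>s ` space M. y * indicator (clopen M (?V y)) \<omega>)"
      unfolding ba_simple_integral_def using zero_one_values[OF w V] w
      by (intro sum.cong) (auto simp: clopen_def indicator_def)
    finally show ?thesis .
  qed
  then have "(\<integral>\<omega>. ba_integral M \<omega> s \<partial>P)
      = (\<integral>\<omega>. (\<Sum>y\<in>s ` space M. y * indicator (clopen M (?V y)) \<omega>) \<partial>P)"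
    by (intro Bochner_Integration.integral_cong) auto
  also have "\<dots> = (\<Sum>y\<in>s ` space M. y * measure P (clopen M (?V y)))"
  proof (subst Bochner_Integration.integral_sum)
    show "integrable P (\<lambda>\<omega>. y * indicator (clopen M (?V y)) \<omega>)" for y :: real
      using sets_P[OF V] by (simp add: integrable_indicator_iff emeasure_finite less_top[symmetric])
  qed (use sets_P[OF V] sets.sets_into_space[OF sets_P[OF V]] in \<open>auto simp: Int_absorb2\<close>)
  also have "\<dots> = ba_simple_integral M p s"
    by (simp add: ba_simple_integral_def measure_P[OF V])
  finally show ?thesis .
qed

end

text \<open>By the Yosida--Hewitt correspondence a functional is integration against a signed charge, that is,
  against the difference of two Stone measures.\<close>

lemma dual_unit_ball_eq_Stone_integral:
  assumes \<psi>: "\<psi> \<in> dual_unit_ball (Linf M) (Linf_norm M)"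
    and P: "Stone_measure M p P" and Q: "Stone_measure M n Q"
    and pn: "\<And>A. A \<in> sets M \<Longrightarrow> \<psi> (indicator A) = p A - n A"
    and f: "f \<in> Linf M"
  shows "\<psi> f = (\<integral>\<omega>. ba_integral M \<omega> f \<partial>P) - (\<integral>\<omega>. ba_integral M \<omega> f \<partial>Q)"
proof -
  interpret P: Stone_measure M p P by (rule P)
  interpret Q: Stone_measure M n Q by (rule Q)
  \<comment> \<open>Replacing \<open>f\<close> by a simple function within \<open>d\<close> costs
    \<open>d\<close> under \<open>\<psi>\<close> and \<open>d\<close> times the total mass under
    each Stone measure.\<close>
  let ?B = "1 + measure P (space P) + measure Q (space Q)"
  have \<psi>_diff: "\<psi> (\<lambda>x. g x - h x) = \<psi> g - \<psi> h" if "g \<in> Linf M" "h \<in> Linf M" for g h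
    using dual_unit_ballD(1)[OF \<psi> that(1) Linf_cmult[OF that(2)], of "-1"]
      dual_unit_ballD(2)[OF \<psi> that(2), of "-1"] by simp
  have \<psi>_sum: "\<psi> (\<lambda>x. \<Sum>i\<in>I. g i x) = (\<Sum>i\<in>I. \<psi> (g i))" if "finite I" "\<And>i. i \<in> I \<Longrightarrow> g i \<in> Linf M"
    for I :: "real set" and g
    using that
  proof (induction I rule: finite_induct)
    case empty
    then show ?case
      using dual_unit_ballD(2)[OF \<psi> f, of 0] by simp
  next
    case (insert i I)
    then show ?case
      using dual_unit_ballD(1)[OF \<psi>, of "g i" "\<lambda>x. \<Sum>i\<in>I. g i x"] Linf_sum[of I g M] by simp
  qed
  have simple: "\<psi> s = (\<integral>\<omega>. ba_integral M \<omega> s \<partial>P) - (\<integral>\<omega>. ba_integral M \<omega> s \<partial>Q)"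
    if s: "simple_function M s" for s
  proof -
    let ?V = "\<lambda>y. s -` {y} \<inter> space M"
    let ?t = "\<lambda>x. \<Sum>y\<in>s ` space M. y * indicator (?V y) x"
    have V: "?V y \<in> sets M" for y
      using s by (rule simple_functionD)
    have fin: "finite (s ` space M)"
      using s by (rule simple_functionD)
    have sL: "s \<in> Linf M"
      using s by (rule Linf_simple_function)
    have tL: "?t \<in> Linf M"
      by (intro Linf_sum Linf_cmult Linf_indicator V)
    have st: "s x = ?t x" if "x \<in> space M" for x
    proof -
      have "?t x = (\<Sum>y\<in>s ` space M. if y = s x then y else 0)"
        using that by (intro sum.cong) (auto simp: indicator_def)
      then show ?thesis
        using fin that by simp
    qed
    \<comment> \<open>\<open>s\<close> and its canonical form agree on \<open>space M\<close> but
      may differ elsewhere; a functional bounded by the seminorm cannot tell them apart.\<close>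
    have "\<bar>\<psi> (\<lambda>x. s x - ?t x)\<bar> \<le> Linf_norm M (\<lambda>x. s x - ?t x)"
      by (intro dual_unit_ballD(3)[OF \<psi>] Linf_diff sL tL)
    also have "\<dots> \<le> 0"
    proof (rule Linf_norm_le)
      show "AE x in M. \<bar>s x - ?t x\<bar> \<le> 0"
        by (rule AE_I2) (simp only: st diff_self abs_zero order_refl)
    qed (rule LinfD(1)[OF Linf_diff[OF sL tL]], rule order_refl)
    finally have "\<psi> s = \<psi> ?t"
      using \<psi>_diff[OF sL tL] by simp
    also have "\<dots> = (\<Sum>y\<in>s ` space M. \<psi> (\<lambda>x. y * indicator (?V y) x))"
      by (intro \<psi>_sum fin Linf_cmult Linf_indicator V)
    also have "\<dots> = (\<Sum>y\<in>s ` space M. y * (p (?V y) - n (?V y)))"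
      using dual_unit_ballD(2)[OF \<psi> Linf_indicator[OF V]] pn[OF V] by simp
    also have "\<dots> = ba_simple_integral M p s - ba_simple_integral M n s"
      by (simp add: ba_simple_integral_def right_diff_distrib sum_subtractf)
    finally show ?thesis
      by (simp add: P.integral_ba_integral_simple[OF s] Q.integral_ba_integral_simple[OF s])
  qed
  have int_close: "\<bar>(\<integral>\<omega>. ba_integral M \<omega> f \<partial>R) - (\<integral>\<omega>. ba_integral M \<omega> s \<partial>R)\<bar> \<le> d * measure R (space R)"
    if R: "Stone_measure M r R" and s: "simple_function M s" and d: "Linf_norm M (\<lambda>x. f x - s x) \<le> d" for r R s d
  proof -
    interpret R: Stone_measure M r R by (rule R)
    have sL: "s \<in> Linf M"
      using s by (rule Linf_simple_function)
    have "\<bar>(\<integral>\<omega>. ba_integral M \<omega> f \<partial>R) - (\<integral>\<omega>. ba_integral M \<omega> s \<partial>R)\<bar>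
        = \<bar>\<integral>\<omega>. ba_integral M \<omega> f - ba_integral M \<omega> s \<partial>R\<bar>"
      by (simp add: R.integrable_ba_integral f sL)
    also have "\<dots> \<le> (\<integral>\<omega>. \<bar>ba_integral M \<omega> f - ba_integral M \<omega> s\<bar> \<partial>R)"
      by (rule integral_abs_bound)
    also have "\<dots> \<le> (\<integral>\<omega>. d \<partial>R)"
    proof (rule integral_mono)
      fix \<omega> assume "\<omega> \<in> space R"
      then have w: "\<omega> \<in> zero_one_ba M"
        by (simp add: R.space_P)
      show "\<bar>ba_integral M \<omega> f - ba_integral M \<omega> s\<bar> \<le> d"
        using ba_integral_bound[OF w Linf_diff[OF f sL]] ba_integral_diff[OF w f sL] d by simp
    qed (auto intro!: R.integrable_ba_integral f sL)
    finally show ?thesis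
      by (simp add: mult.commute)
  qed
  let ?d = "\<bar>\<psi> f - ((\<integral>\<omega>. ba_integral M \<omega> f \<partial>P) - (\<integral>\<omega>. ba_integral M \<omega> f \<partial>Q))\<bar>"
  have bound: "?d \<le> d * ?B" if d: "d > 0" for d
  proof -
    obtain s where s: "simple_function M s" "Linf_norm M (\<lambda>x. f x - s x) \<le> d"
      using Linf_simple_approx[OF f d] by blast
    have sL: "s \<in> Linf M"
      using s by (intro Linf_simple_function)
    have "\<bar>\<psi> f - \<psi> s\<bar> \<le> d"
      using dual_unit_ballD(3)[OF \<psi> Linf_diff[OF f sL]] s(2) by (simp add: \<psi>_diff[OF f sL])
    then show ?thesis
      using int_close[OF P s] int_close[OF Q s] simple[OF s(1)] by (simp add: distrib_left)
  qed
  have "?d \<le> 0 + e" if e: "e > 0" for e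
  proof -
    have "?B > 0"
      by (simp add: add_pos_nonneg)
    then show ?thesis
      using bound[of "e / ?B"] e by simp
  qed
  then have "?d \<le> 0"
    by (rule field_le_epsilon)
  then show ?thesis
    by simp
qed

lemma (in Stone_measure) integral_approx_by_points:
  fixes w :: "nat \<Rightarrow> ('a set \<Rightarrow> real)"
  assumes C: "countable C" "C \<subseteq> Linf M" "\<And>f. f \<in> C \<Longrightarrow> Linf_norm M f \<le> K" and K: "0 \<le> K"
    and w: "\<And>i. w i \<in> zero_one_ba M"
    and dense: "\<And>\<omega> \<epsilon>. \<omega> \<in> zero_one_ba M \<Longrightarrow> \<epsilon> > 0 \<Longrightarrow>
      \<exists>i. \<forall>f\<in>C. \<bar>ba_integral M \<omega> f - ba_integral M (w i) f\<bar> \<le> \<epsilon>"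
    and d: "0 < \<delta>"
  shows "\<exists>n c. \<forall>f\<in>C. \<bar>(\<integral>\<omega>. ba_integral M \<omega> f \<partial>P) - (\<Sum>i<n. c i * ba_integral M (w i) f)\<bar> \<le> \<delta>"
proof -
  define m where "m = measure P (space P)"
  have m: "0 \<le> m"
    by (simp add: m_def)
  \<comment> \<open>The error below is at most \<open>\<epsilon> * m\<close> from the covered part
    and \<open>K * \<epsilon>\<close> from the rest; the added 1 keeps the denominator
    positive.\<close>
  define \<epsilon> where "\<epsilon> = \<delta> / (m + K + 1)"
  have e: "0 < \<epsilon>"
    using d m K by (simp add: \<epsilon>_def)
  \<comment> \<open>The Stone space is measured by distance on \<open>C\<close>, not by its own
    topology. Countability of \<open>C\<close> makes these balls measurable, since each is an
    intersection of countably many conditions.\<close>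
  define E where "E = (\<lambda>i. {\<omega>\<in>space P. \<forall>f\<in>C. \<bar>ba_integral M \<omega> f - ba_integral M (w i) f\<bar> \<le> \<epsilon>})"
  have E[measurable]: "E i \<in> sets P" for i
  proof -
    have "{\<omega>\<in>space P. \<bar>ba_integral M \<omega> f - ba_integral M (w i) f\<bar> \<le> \<epsilon>} \<in> sets P" if "f \<in> C" for f
    proof -
      note [measurable] = measurable_ba_integral[OF subsetD[OF C(2) that]]
      show ?thesis
        by measurable
    qed
    then show ?thesis
      unfolding E_def by (intro sets.sets_Collect_countable_All' C(1))
  qed
  have UE: "(\<Union>i. E i) = space P"
    using dense[OF _ e] by (auto simp: E_def space_P)
  let ?D = "disjointed E"
  have D[measurable]: "?D i \<in> sets P" for i
    using sets.range_disjointed_sets[of E P] E by blast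
  have sums: "(\<lambda>i. measure P (?D i)) sums m"
    using finite_measure_UNION[OF image_subsetI[OF D] disjoint_family_disjointed]
    unfolding UN_disjointed_eq UE m_def .
  then obtain n where "norm ((\<Sum>i<n. measure P (?D i)) - m) < \<epsilon>"
    using LIMSEQ_D[OF _ e] unfolding sums_def by blast
  then have n: "\<bar>m - (\<Sum>i<n. measure P (?D i))\<bar> < \<epsilon>"
    by (simp add: abs_minus_commute)
  have "\<bar>(\<integral>\<omega>. ba_integral M \<omega> f \<partial>P) - (\<Sum>i<n. measure P (?D i) * ba_integral M (w i) f)\<bar> \<le> \<delta>"
    if f: "f \<in> C" for f
  proof -
    \<comment> \<open>\<open>?T\<close> is the indicator of the part of the space outside the first
      \<open>n\<close> pieces. The step function is 0 there, so the error is bounded by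
      \<open>K\<close>; on the pieces it is bounded by \<open>\<epsilon>\<close>.\<close>
    let ?g = "\<lambda>\<omega>. ba_integral M \<omega> f" and ?T = "\<lambda>\<omega>. 1 - (\<Sum>i<n. indicat_real (?D i) \<omega>)"
    have fL: "f \<in> Linf M"
      using C(2) f by blast
    have intD: "integrable P (indicat_real (?D i))" for i
      by (simp add: integrable_indicator_iff emeasure_finite less_top[symmetric])
    have intS: "integrable P (\<lambda>\<omega>. \<Sum>i<n. ?g (w i) * indicator (?D i) \<omega>)"
      by (intro Bochner_Integration.integrable_sum integrable_mult_right intD)
    have intg: "integrable P (\<lambda>\<omega>. ?g \<omega> - (\<Sum>i<n. ?g (w i) * indicator (?D i) \<omega>))"
      by (intro Bochner_Integration.integrable_diff intS integrable_ba_integral fL)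
    have intT: "integrable P (\<lambda>\<omega>. \<epsilon> + K * ?T \<omega>)"
      using intD by simp
    have pt: "\<bar>?g \<omega> - (\<Sum>i<n. ?g (w i) * indicator (?D i) \<omega>)\<bar> \<le> \<epsilon> + K * ?T \<omega>" if w': "\<omega> \<in> space P" for \<omega>
    proof -
      have wz: "\<omega> \<in> zero_one_ba M"
        using w' by (simp add: space_P)
      have "\<omega> \<in> (\<Union>i. ?D i)"
        using w' UE by (simp add: UN_disjointed_eq)
      then obtain j where j: "\<omega> \<in> ?D j"
        by blast
      have ind: "indicat_real (?D i) \<omega> = (if i = j then 1 else 0)" for i
        using j disjoint_family_disjointed[of E] by (auto simp: disjoint_family_on_def indicator_def)
      have "\<omega> \<in> E j"
        using disjointed_subset[of E j] j by (rule subsetD)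
      then have near: "\<bar>?g \<omega> - ?g (w j)\<bar> \<le> \<epsilon>"
        using f by (simp add: E_def)
      have "\<bar>?g \<omega>\<bar> \<le> K"
        using ba_integral_bound[OF wz fL] C(3)[OF f] by simp
      moreover have "(\<Sum>i<n. ?g (w i) * indicator (?D i) \<omega>) = (if j < n then ?g (w j) else 0)"
        "?T \<omega> = (if j < n then 0 else 1)"
        unfolding ind by (simp_all add: if_distrib[of "\<lambda>t. _ * t"] cong: if_cong)
      ultimately show ?thesis
        using near e K by (cases "j < n") simp_all
    qed
    have "(\<integral>\<omega>. ?g \<omega> \<partial>P) - (\<Sum>i<n. measure P (?D i) * ?g (w i))
        = (\<integral>\<omega>. ?g \<omega> - (\<Sum>i<n. ?g (w i) * indicator (?D i) \<omega>) \<partial>P)"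
    proof (subst Bochner_Integration.integral_diff)
      show "(\<integral>\<omega>. ?g \<omega> \<partial>P) - (\<Sum>i<n. measure P (?D i) * ?g (w i))
          = (\<integral>\<omega>. ?g \<omega> \<partial>P) - (\<integral>\<omega>. (\<Sum>i<n. ?g (w i) * indicator (?D i) \<omega>) \<partial>P)"
        using intD by (subst Bochner_Integration.integral_sum) (auto simp: mult.commute)
    qed (intro integrable_ba_integral fL intS)+
    also have "\<bar>\<dots>\<bar> \<le> (\<integral>\<omega>. \<bar>?g \<omega> - (\<Sum>i<n. ?g (w i) * indicator (?D i) \<omega>)\<bar> \<partial>P)"
      by (rule integral_abs_bound)
    also have "\<dots> \<le> (\<integral>\<omega>. \<epsilon> + K * ?T \<omega> \<partial>P)"
      using intg intT pt by (intro integral_mono) auto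
    also have "\<dots> = \<epsilon> * m + K * (m - (\<Sum>i<n. measure P (?D i)))"
      using intD by (simp add: m_def Bochner_Integration.integral_sum)
    also have "\<dots> \<le> \<epsilon> * m + K * \<epsilon>"
      using n K by (intro add_left_mono mult_left_mono) auto
    also have "\<dots> \<le> \<epsilon> * (m + K + 1)"
      using e by (simp add: distrib_left)
    also have "\<dots> = \<delta>"
      using m K by (simp add: \<epsilon>_def)
    finally show ?thesis .
  qed
  then show ?thesis
    by (intro exI[of _ n] exI[of _ "\<lambda>i. measure P (?D i)"] ballI)
qed

lemma sup_separable_dual_unit_ball_of_zero_one:
  assumes C: "countable C" "C \<subseteq> Linf M" "\<And>f. f \<in> C \<Longrightarrow> Linf_norm M f \<le> K" and K: "0 \<le> K"
    and sep: "sup_separable C (ba_integral M ` zero_one_ba M)"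
  shows "sup_separable C (dual_unit_ball (Linf M) (Linf_norm M))"
proof (cases "zero_one_ba M = {}")
  case True
  \<comment> \<open>By the ultrafilter lemma this only happens for the null measure, where the dual ball is trivial.\<close>
  then have "clopen M (space M) = {}"
    by (simp add: clopen_space)
  then have null: "space M \<in> null_sets M"
    by (intro clopen_empty_imp_null) auto
  have "\<psi> f = 0" if "\<psi> \<in> dual_unit_ball (Linf M) (Linf_norm M)" "f \<in> C" for \<psi> f
  proof -
    have "AE x in M. \<bar>f x\<bar> \<le> 0"
      using null by (intro AE_I[of _ _ "space M"]) auto
    then have "Linf_norm M f \<le> 0"
      using C(2) that(2) by (intro Linf_norm_le LinfD(1)) auto
    then show ?thesis
      using dual_unit_ballD(3)[OF that(1), of f] C(2) that(2) by auto
  qed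
  then have "\<forall>\<psi>\<in>dual_unit_ball (Linf M) (Linf_norm M). \<forall>\<epsilon>>0. \<exists>d\<in>{\<lambda>_. 0}. \<forall>f\<in>C. \<bar>\<psi> f - d f\<bar> \<le> \<epsilon>"
    by fastforce
  then show ?thesis
    unfolding sup_separable_def using countable_empty countable_insert by blast
next
  case False
  obtain W where W: "countable W" "W \<subseteq> ba_integral M ` zero_one_ba M"
      "\<And>f \<epsilon>. f \<in> ba_integral M ` zero_one_ba M \<Longrightarrow> \<epsilon> > 0 \<Longrightarrow> \<exists>d\<in>W. \<forall>u\<in>C. \<bar>f u - d u\<bar> \<le> \<epsilon>"
    using sup_separable_obtain_subset[OF sep] by metis
  have "W \<noteq> {}"
    using W(3)[of _ 1] False by fastforce
  then obtain v :: "nat \<Rightarrow> _" where v: "range v = W"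
    using W(1) uncountable_def by metis
  have "\<exists>\<omega>\<in>zero_one_ba M. v i = ba_integral M \<omega>" for i
    using W(2) v by blast
  then obtain w where w: "\<And>i. w i \<in> zero_one_ba M" "\<And>i. v i = ba_integral M (w i)"
    by metis
  have dense: "\<exists>i. \<forall>f\<in>C. \<bar>ba_integral M \<omega> f - ba_integral M (w i) f\<bar> \<le> \<epsilon>"
    if "\<omega> \<in> zero_one_ba M" "\<epsilon> > 0" for \<omega> \<epsilon>
    using W(3)[of "ba_integral M \<omega>" \<epsilon>] that w(2) unfolding v[symmetric] by auto
  \<comment> \<open>Finite lists of rationals enumerate rational combinations of the chosen
    evaluations; a pair of lists serves the positive and the negative part of a signed
    charge.\<close>
  define comb where "comb = (\<lambda>qs f. \<Sum>i<length qs. qs ! i * ba_integral M (w i) f)"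
  define Q where "Q = (\<lambda>(a, b) f. comb a f - comb b f) ` (lists \<rat> \<times> lists \<rat>)"
  have Q: "countable Q"
    unfolding Q_def by (intro countable_image countable_SIGMA countable_lists countable_rat)
  have rational: "\<exists>qs\<in>lists \<rat>. \<forall>f\<in>C. \<bar>(\<integral>\<omega>. ba_integral M \<omega> f \<partial>R) - comb qs f\<bar> \<le> \<delta>"
    if R: "Stone_measure M r R" and d: "0 < \<delta>" for r R \<delta>
  proof -
    obtain n c where nc: "\<And>f. f \<in> C \<Longrightarrow>
        \<bar>(\<integral>\<omega>. ba_integral M \<omega> f \<partial>R) - (\<Sum>i<n. c i * ba_integral M (w i) f)\<bar> \<le> \<delta> / 2"
      using Stone_measure.integral_approx_by_points[OF R C K w(1) dense, of "\<delta> / 2"] d by auto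
    \<comment> \<open>There are \<open>n\<close> coefficient errors, each multiplied by a value at
      most \<open>K\<close>, and their sum has to stay below \<open>\<delta> / 2\<close>; adding 1
      to both factors avoids division by 0.\<close>
    define \<eta> where "\<eta> = \<delta> / (2 * (K + 1) * (real n + 1))"
    have eta: "\<eta> > 0"
      using d K by (simp add: \<eta>_def add_nonneg_pos)
    have "\<exists>q\<in>\<rat>. \<bar>c i - q\<bar> \<le> \<eta>" for i
      using Rats_dense_in_real[of "c i - \<eta>" "c i + \<eta>"] eta by (auto simp: abs_le_iff intro!: bexI)
    then obtain q where q: "\<And>i. q i \<in> \<rat>" "\<And>i. \<bar>c i - q i\<bar> \<le> \<eta>"
      by metis
    have "\<bar>(\<integral>\<omega>. ba_integral M \<omega> f \<partial>R) - comb (map q [0..<n]) f\<bar> \<le> \<delta>" if f: "f \<in> C" for f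
    proof -
      have b: "\<bar>ba_integral M (w i) f\<bar> \<le> K" for i
        using ba_integral_bound[OF w(1), of f] C(2,3) f by (meson order_trans subsetD)
      have "(\<Sum>i<n. c i * ba_integral M (w i) f) - comb (map q [0..<n]) f
          = (\<Sum>i<n. (c i - q i) * ba_integral M (w i) f)"
        by (simp add: comb_def left_diff_distrib sum_subtractf)
      also have "\<bar>\<dots>\<bar> \<le> (\<Sum>i<n. \<bar>(c i - q i) * ba_integral M (w i) f\<bar>)"
        by (rule sum_abs)
      also have "\<dots> \<le> (\<Sum>i<n. \<eta> * K)"
        unfolding abs_mult using eta by (intro sum_mono mult_mono q b) auto
      also have "\<dots> \<le> (real n + 1) * (\<eta> * (K + 1))"
        using eta K by (simp add: mult_mono)
      also have "\<dots> = \<delta> / 2"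
        using K by (simp add: \<eta>_def field_simps add_nonneg_eq_0_iff)
      finally show ?thesis
        using nc[OF f] by linarith
    qed
    then show ?thesis
      using q(1) by (intro bexI[of _ "map q [0..<n]"]) auto
  qed
  have "\<exists>d\<in>Q. \<forall>f\<in>C. \<bar>\<psi> f - d f\<bar> \<le> \<epsilon>"
    if \<psi>: "\<psi> \<in> dual_unit_ball (Linf M) (Linf_norm M)" and e: "0 < \<epsilon>" for \<psi> \<epsilon>
  proof -
    obtain p n where pn: "charge M p" "charge M n" "\<And>A. A \<in> sets M \<Longrightarrow> \<psi> (indicator A) = p A - n A"
    proof (rule Jordan_decomposition_charge[of M "\<lambda>A. \<psi> (indicator A)" 1])
      fix A B assume AB: "A \<in> sets M" "B \<in> sets M" "A \<inter> B = {}"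
      then have "indicat_real (A \<union> B) = (\<lambda>x. indicator A x + indicator B x)"
        by (auto simp: indicator_def fun_eq_iff)
      then show "\<psi> (indicator (A \<union> B)) = \<psi> (indicator A) + \<psi> (indicator B)"
        using dual_unit_ballD(1)[OF \<psi> Linf_indicator[OF AB(1)] Linf_indicator[OF AB(2)]] by simp
    next
      fix A assume A: "A \<in> sets M"
      have "Linf_norm M (indicator A) \<le> 1"
        using A by (intro Linf_norm_le) (auto simp: indicator_def)
      then show "\<bar>\<psi> (indicator A)\<bar> \<le> 1"
        using dual_unit_ballD(3)[OF \<psi> Linf_indicator[OF A]] by simp
    next
      fix A assume A: "A \<in> null_sets M"
      have "Linf_norm M (indicator A) \<le> 0"
        using A AE_not_in[OF A] by (intro Linf_norm_le) (auto elim!: eventually_mono)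
      then show "\<psi> (indicator A) = 0"
        using dual_unit_ballD(3)[OF \<psi> Linf_indicator, of A] A by auto
    qed (auto intro: that)
    obtain P where P: "Stone_measure M p P"
      using obtain_Stone_measure[OF pn(1)] pn(1) unfolding Stone_measure_def by metis
    obtain N where N: "Stone_measure M n N"
      using obtain_Stone_measure[OF pn(2)] pn(2) unfolding Stone_measure_def by metis
    obtain a where a: "a \<in> lists \<rat>" "\<forall>f\<in>C. \<bar>(\<integral>\<omega>. ba_integral M \<omega> f \<partial>P) - comb a f\<bar> \<le> \<epsilon> / 2"
      using rational[OF P, of "\<epsilon> / 2"] e by auto
    obtain b where b: "b \<in> lists \<rat>" "\<forall>f\<in>C. \<bar>(\<integral>\<omega>. ba_integral M \<omega> f \<partial>N) - comb b f\<bar> \<le> \<epsilon> / 2"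
      using rational[OF N, of "\<epsilon> / 2"] e by auto
    have "\<bar>\<psi> f - (comb a f - comb b f)\<bar> \<le> \<epsilon>" if f: "f \<in> C" for f
    proof -
      have "\<psi> f = (\<integral>\<omega>. ba_integral M \<omega> f \<partial>P) - (\<integral>\<omega>. ba_integral M \<omega> f \<partial>N)"
        using C(2) f by (intro dual_unit_ball_eq_Stone_integral[OF \<psi> P N pn(3)]) auto
      then show ?thesis
        using bspec[OF a(2) f] bspec[OF b(2) f] by linarith
    qed
    moreover have "(\<lambda>f. comb a f - comb b f) \<in> Q"
      unfolding Q_def using a(1) b(1) by (intro image_eqI[of _ _ "(a, b)"]) auto
    ultimately show ?thesis
      by (intro bexI[of _ "\<lambda>f. comb a f - comb b f"] ballI)
  qed
  then show ?thesis
    unfolding sup_separable_def using Q by (intro exI[of _ Q] conjI ballI allI impI)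
qed

section \<open>Bounded bilinear forms on the integrable functions\<close>

lemma norm_separableE:
  assumes "norm_separable N S"
  obtains D where "countable D" "D \<subseteq> S" "\<And>f \<epsilon>. f \<in> S \<Longrightarrow> \<epsilon> > 0 \<Longrightarrow> \<exists>d\<in>D. N (\<lambda>x. f x - d x) < \<epsilon>"
  using assms unfolding norm_separable_def by blast

text \<open>The selection argument of \<open>sup_separable_obtain_subset\<close>, for a distance
  given by \<open>N\<close>: dense centres in \<open>S\<close> are replaced by nearby members of
  \<open>T\<close>.\<close>

lemma norm_separable_subset:
  assumes sep: "norm_separable N S" and TS: "T \<subseteq> S"
    and sym: "\<And>f g. f \<in> S \<Longrightarrow> g \<in> S \<Longrightarrow> N (\<lambda>x. f x - g x) = N (\<lambda>x. g x - f x)"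
    and tri: "\<And>f g h. f \<in> S \<Longrightarrow> g \<in> S \<Longrightarrow> h \<in> S \<Longrightarrow>
      N (\<lambda>x. f x - h x) \<le> N (\<lambda>x. f x - g x) + N (\<lambda>x. g x - h x)"
  shows "norm_separable N T"
proof -
  obtain D where D: "countable D" "D \<subseteq> S" "\<And>f \<epsilon>. f \<in> S \<Longrightarrow> \<epsilon> > 0 \<Longrightarrow> \<exists>d\<in>D. N (\<lambda>x. f x - d x) < \<epsilon>"
    using sep unfolding norm_separable_def by blast
  define good where "good = (\<lambda>d n f. f \<in> T \<and> N (\<lambda>x. f x - d x) < inverse (real (Suc n)))"
  define pick where "pick = (\<lambda>(d, n). SOME f. good d n f)"
  define P where "P = {(d, n). d \<in> D \<and> (\<exists>f. good d n f)}"
  have pick: "good d n (pick (d, n))" if "(d, n) \<in> P" for d n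
    using that someI_ex[of "good d n"] by (auto simp: P_def pick_def)
  have "countable (D \<times> (UNIV :: nat set))"
    using D(1) by simp
  then have "countable P"
    by (rule countable_subset[rotated]) (auto simp: P_def)
  moreover have "pick ` P \<subseteq> T"
    using pick by (auto simp: good_def)
  moreover have "\<exists>d\<in>pick ` P. N (\<lambda>x. f x - d x) < \<epsilon>" if f: "f \<in> T" and e: "0 < \<epsilon>" for f \<epsilon>
  proof -
    obtain n where n: "inverse (real (Suc n)) < \<epsilon> / 2"
      using reals_Archimedean[of "\<epsilon> / 2"] e by auto
    obtain d where d: "d \<in> D" "N (\<lambda>x. f x - d x) < inverse (real (Suc n))"
      using D(3)[of f "inverse (real (Suc n))"] f TS by auto
    then have dn: "(d, n) \<in> P"
      using f by (auto simp: P_def good_def)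
    have S: "f \<in> S" "d \<in> S" "pick (d, n) \<in> S"
      using f TS d(1) D(2) pick[OF dn] by (auto simp: good_def)
    have "N (\<lambda>x. d x - pick (d, n) x) < inverse (real (Suc n))"
      using pick[OF dn] sym[OF S(2,3)] by (simp add: good_def)
    then have "N (\<lambda>x. f x - pick (d, n) x) < \<epsilon>"
      using tri[OF S] d(2) n by linarith
    then show ?thesis
      using dn by blast
  qed
  ultimately show ?thesis
    unfolding norm_separable_def by (intro exI[of _ "pick ` P"]) auto
qed

lemma L1_norm_triangle:
  assumes "f \<in> L1 M" "g \<in> L1 M" "h \<in> L1 M"
  shows "L1_norm M (\<lambda>x. f x - h x) \<le> L1_norm M (\<lambda>x. f x - g x) + L1_norm M (\<lambda>x. g x - h x)"
proof -
  have "L1_norm M (\<lambda>x. f x - h x) \<le> (\<integral>x. \<bar>f x - g x\<bar> + \<bar>g x - h x\<bar> \<partial>M)"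
    unfolding L1_norm_def using assms by (intro integral_mono) (auto simp: L1_def)
  then show ?thesis
    using assms by (simp add: L1_norm_def L1_def)
qed

lemma L1_norm_minus_commute: "L1_norm M (\<lambda>x. f x - g x) = L1_norm M (\<lambda>x. g x - f x)"
  by (simp add: L1_norm_def abs_minus_commute)

section \<open>The operator of a bilinear form and its adjoint at zero-one measures\<close>

locale L1_bilinear_form = sigma_finite_measure M for M :: "'a measure" +
  fixes \<beta> :: "('a \<Rightarrow> real) \<Rightarrow> ('a \<Rightarrow> real) \<Rightarrow> real" and K :: real
  assumes add_left: "a \<in> L1 M \<Longrightarrow> b \<in> L1 M \<Longrightarrow> c \<in> L1 M \<Longrightarrow> \<beta> (\<lambda>x. a x + b x) c = \<beta> a c + \<beta> b c"
    and cmult_left: "a \<in> L1 M \<Longrightarrow> c \<in> L1 M \<Longrightarrow> \<beta> (\<lambda>x. r * a x) c = r * \<beta> a c"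
    and add_right: "a \<in> L1 M \<Longrightarrow> b \<in> L1 M \<Longrightarrow> c \<in> L1 M \<Longrightarrow> \<beta> a (\<lambda>x. b x + c x) = \<beta> a b + \<beta> a c"
    and cmult_right: "a \<in> L1 M \<Longrightarrow> c \<in> L1 M \<Longrightarrow> \<beta> a (\<lambda>x. r * c x) = r * \<beta> a c"
    and bound: "a \<in> L1 M \<Longrightarrow> b \<in> L1 M \<Longrightarrow> \<bar>\<beta> a b\<bar> \<le> K * L1_norm M a * L1_norm M b"
    and K_nonneg: "0 \<le> K"
begin

definition T where "T a = Linf_rep M (\<beta> a)"

text \<open>The adjoint of \<open>T\<close> at \<open>\<omega>\<close>: since \<open>T\<close> maps
  L1 into its dual, the adjoint sends a bidual element back into the dual, where it is represented
  by a function.\<close>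

definition S where "S \<omega> = Linf_rep M (\<lambda>b. ba_integral M \<omega> (T b))"

lemma T_rep:
  assumes "a \<in> L1 M"
  shows "\<exists>\<psi>\<in>Linf M. \<forall>b\<in>L1 M. pairing M \<psi> b = \<beta> a b"
  using assms by (intro L1_functional_rep[where K = "K * L1_norm M a"] add_right cmult_right bound)

lemma T_Linf: "a \<in> L1 M \<Longrightarrow> T a \<in> Linf M"
  and pairing_T: "a \<in> L1 M \<Longrightarrow> b \<in> L1 M \<Longrightarrow> pairing M (T a) b = \<beta> a b"
  unfolding T_def by (auto intro: Linf_repD T_rep)

lemma unit_ball_L1: "b \<in> L1_unit_ball M \<Longrightarrow> b \<in> L1 M"
  and unit_ball_norm: "b \<in> L1_unit_ball M \<Longrightarrow> L1_norm M b \<le> 1"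
  by (auto simp: L1_unit_ball_def)

lemma T_bound:
  assumes a: "a \<in> L1 M"
  shows "Linf_norm M (T a) \<le> K * L1_norm M a"
proof (rule Linf_norm_le_of_pairing_le[OF T_Linf[OF a]])
  fix b assume b: "b \<in> L1_unit_ball M"
  have "\<bar>pairing M (T a) b\<bar> \<le> K * L1_norm M a * L1_norm M b"
    using bound[OF a unit_ball_L1[OF b]] pairing_T[OF a unit_ball_L1[OF b]] by simp
  also have "\<dots> \<le> K * L1_norm M a * 1"
    using K_nonneg L1_norm_nonneg[of M a] by (intro mult_left_mono unit_ball_norm b) simp
  finally show "\<bar>pairing M (T a) b\<bar> \<le> K * L1_norm M a"
    by simp
qed

lemma Linf_norm_diff_le_0:
  assumes "f \<in> Linf M" "g \<in> Linf M" "\<And>b. b \<in> L1 M \<Longrightarrow> pairing M f b = pairing M g b"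
  shows "Linf_norm M (\<lambda>x. f x - g x) \<le> 0"
  using assms by (intro Linf_norm_le_of_pairing_le Linf_diff) (auto simp: pairing_diff unit_ball_L1)

lemma pairing_add:
  assumes "f \<in> Linf M" "g \<in> Linf M" "a \<in> L1 M"
  shows "pairing M (\<lambda>x. f x + g x) a = pairing M f a + pairing M g a"
  using pairing_integrable[OF assms(1,3)] pairing_integrable[OF assms(2,3)]
  by (simp add: pairing_def distrib_left)

lemma pairing_cmult: "pairing M (\<lambda>x. r * f x) a = r * pairing M f a"
  by (simp add: pairing_def mult.left_commute)

lemma ba_integral_cong_Linf:
  assumes w: "\<omega> \<in> zero_one_ba M" and "f \<in> Linf M" "g \<in> Linf M" "Linf_norm M (\<lambda>x. f x - g x) \<le> 0"
  shows "ba_integral M \<omega> f = ba_integral M \<omega> g"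
  using ba_integral_bound[OF w Linf_diff[OF assms(2,3)]] ba_integral_diff[OF w assms(2,3)] assms(4)
  by simp

lemma L1_add: "a \<in> L1 M \<Longrightarrow> b \<in> L1 M \<Longrightarrow> (\<lambda>x. a x + b x) \<in> L1 M"
  and L1_cmult: "a \<in> L1 M \<Longrightarrow> (\<lambda>x. r * a x) \<in> L1 M"
  and L1_diff: "a \<in> L1 M \<Longrightarrow> b \<in> L1 M \<Longrightarrow> (\<lambda>x. a x - b x) \<in> L1 M"
  by (auto simp: L1_def)

text \<open>The chosen representatives of \<open>T (a + b)\<close> and \<open>T a + T b\<close> need
  not be the same function, but they pair equally with L1; their difference has seminorm zero and a
  charge does not see it.\<close>

lemma ba_integral_T_add:
  assumes w: "\<omega> \<in> zero_one_ba M" and a: "a \<in> L1 M" and b: "b \<in> L1 M"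
  shows "ba_integral M \<omega> (T (\<lambda>x. a x + b x)) = ba_integral M \<omega> (T a) + ba_integral M \<omega> (T b)"
proof -
  have "ba_integral M \<omega> (T (\<lambda>x. a x + b x)) = ba_integral M \<omega> (\<lambda>x. T a x + T b x)"
    by (intro ba_integral_cong_Linf[OF w] Linf_norm_diff_le_0 T_Linf L1_add Linf_add a b)
      (simp add: pairing_T L1_add a b add_left pairing_add T_Linf)
  then show ?thesis
    by (simp add: ba_integral_add[OF w] T_Linf a b)
qed

lemma ba_integral_T_cmult:
  assumes w: "\<omega> \<in> zero_one_ba M" and a: "a \<in> L1 M"
  shows "ba_integral M \<omega> (T (\<lambda>x. r * a x)) = r * ba_integral M \<omega> (T a)"
proof -
  have "ba_integral M \<omega> (T (\<lambda>x. r * a x)) = ba_integral M \<omega> (\<lambda>x. r * T a x)"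
    by (intro ba_integral_cong_Linf[OF w] Linf_norm_diff_le_0 T_Linf L1_cmult Linf_cmult a)
      (simp add: pairing_T L1_cmult a cmult_left pairing_cmult)
  then show ?thesis
    by (simp add: ba_integral_cmult[OF w] T_Linf a)
qed

lemma T_diff_bound:
  assumes a: "a \<in> L1 M" and b: "b \<in> L1 M"
  shows "Linf_norm M (\<lambda>x. T a x - T b x) \<le> K * L1_norm M (\<lambda>x. a x - b x)"
proof (rule order_trans)
  have "Linf_norm M (\<lambda>x. T a x - T b x) \<le> K * L1_norm M (\<lambda>x. a x - b x) * 1"
  proof (rule Linf_norm_le_of_pairing_le[OF Linf_diff[OF T_Linf[OF a] T_Linf[OF b]]])
    fix c assume c: "c \<in> L1_unit_ball M"
    note c' = unit_ball_L1[OF c]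
    have "pairing M (\<lambda>x. T a x - T b x) c = \<beta> a c - \<beta> b c"
      by (simp add: pairing_diff T_Linf a b c' pairing_T)
    also have "\<dots> = \<beta> (\<lambda>x. a x - b x) c"
      using add_left[OF a L1_cmult[OF b] c', of "-1"] cmult_left[OF b c', of "-1"] by simp
    also have "\<bar>\<dots>\<bar> \<le> K * L1_norm M (\<lambda>x. a x - b x) * L1_norm M c"
      by (intro bound L1_diff a b c')
    also have "\<dots> \<le> K * L1_norm M (\<lambda>x. a x - b x) * 1"
      using K_nonneg L1_norm_nonneg[of M "\<lambda>x. a x - b x"]
      by (intro mult_left_mono unit_ball_norm c) simp
    finally show "\<bar>pairing M (\<lambda>x. T a x - T b x) c\<bar> \<le> K * L1_norm M (\<lambda>x. a x - b x) * 1" .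
  qed
  then show "Linf_norm M (\<lambda>x. T a x - T b x) \<le> K * L1_norm M (\<lambda>x. a x - b x) * 1" .
qed simp

lemma S_rep:
  assumes w: "\<omega> \<in> zero_one_ba M"
  shows "\<exists>\<psi>\<in>Linf M. \<forall>b\<in>L1 M. pairing M \<psi> b = ba_integral M \<omega> (T b)"
proof (rule L1_functional_rep[where K = K])
  fix b assume b: "b \<in> L1 M"
  show "\<bar>ba_integral M \<omega> (T b)\<bar> \<le> K * L1_norm M b"
    using ba_integral_bound[OF w T_Linf[OF b]] T_bound[OF b] by simp
qed (simp_all add: ba_integral_T_add ba_integral_T_cmult w)

lemma S_Linf: "\<omega> \<in> zero_one_ba M \<Longrightarrow> S \<omega> \<in> Linf M"
  and pairing_S: "\<omega> \<in> zero_one_ba M \<Longrightarrow> b \<in> L1 M \<Longrightarrow> pairing M (S \<omega>) b = ba_integral M \<omega> (T b)"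
  unfolding S_def by (auto intro: Linf_repD S_rep)

text \<open>With \<open>S_dist_ge\<close>, this identifies the norm distance of
  \<open>S \<omega>\<close> and \<open>S \<upsilon>\<close> with the uniform distance of the two
  evaluations on the image of the unit ball, and so links \<open>norm_separable\<close> to
  \<open>sup_separable\<close>.\<close>

lemma S_dist_le:
  assumes w: "\<omega> \<in> zero_one_ba M" and v: "\<upsilon> \<in> zero_one_ba M"
    and r: "\<And>b. b \<in> L1_unit_ball M \<Longrightarrow> \<bar>ba_integral M \<omega> (T b) - ba_integral M \<upsilon> (T b)\<bar> \<le> r"
  shows "Linf_norm M (\<lambda>x. S \<omega> x - S \<upsilon> x) \<le> r"
  using r w v by (intro Linf_norm_le_of_pairing_le Linf_diff S_Linf)
    (auto simp: pairing_diff S_Linf pairing_S unit_ball_L1)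

lemma S_dist_ge:
  assumes w: "\<omega> \<in> zero_one_ba M" and v: "\<upsilon> \<in> zero_one_ba M" and b: "b \<in> L1_unit_ball M"
  shows "\<bar>ba_integral M \<omega> (T b) - ba_integral M \<upsilon> (T b)\<bar> \<le> Linf_norm M (\<lambda>x. S \<omega> x - S \<upsilon> x)"
proof -
  have L: "(\<lambda>x. S \<omega> x - S \<upsilon> x) \<in> Linf M"
    by (intro Linf_diff S_Linf w v)
  have "\<bar>pairing M (\<lambda>x. S \<omega> x - S \<upsilon> x) b\<bar> \<le> Linf_norm M (\<lambda>x. S \<omega> x - S \<upsilon> x) * L1_norm M b"
    by (intro pairing_bound L unit_ball_L1 b)
  also have "\<dots> \<le> Linf_norm M (\<lambda>x. S \<omega> x - S \<upsilon> x) * 1"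
    by (intro mult_left_mono unit_ball_norm b LinfD(3) L)
  finally show ?thesis
    by (simp add: pairing_diff S_Linf w v unit_ball_L1[OF b] pairing_S)
qed

lemma asplund_iff_norm_separable:
  assumes sep: "norm_separable (L1_norm M) (L1 M)"
  shows "asplund_set (Linf M) (Linf_norm M) (T ` L1_unit_ball M) \<longleftrightarrow>
    norm_separable (Linf_norm M) (S ` zero_one_ba M)"
proof -
  let ?U = "L1_unit_ball M" and ?B = "dual_unit_ball (Linf M) (Linf_norm M)"
  have "norm_separable (L1_norm M) ?U"
    by (rule norm_separable_subset[OF sep])
      (auto intro: unit_ball_L1 L1_norm_triangle L1_norm_minus_commute)
  \<comment> \<open>The compactness and measure arguments require a countable set of test functions;
    the image of this \<open>D\<close> under \<open>T\<close> is that set.\<close>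
  then obtain D where D: "countable D" "D \<subseteq> ?U"
      "\<And>a \<delta>. a \<in> ?U \<Longrightarrow> \<delta> > 0 \<Longrightarrow> \<exists>d\<in>D. L1_norm M (\<lambda>x. a x - d x) < \<delta>"
    unfolding norm_separable_def by blast
  have C: "countable (T ` D)" "T ` D \<subseteq> T ` ?U" "T ` ?U \<subseteq> Linf M" "T ` D \<subseteq> Linf M"
    using D(1,2) T_Linf unit_ball_L1 by auto
  have normC: "Linf_norm M f \<le> K" if f: "f \<in> T ` ?U" for f
  proof -
    obtain a where a: "a \<in> ?U" "f = T a"
      using f by blast
    have "K * L1_norm M a \<le> K * 1"
      using K_nonneg by (intro mult_left_mono unit_ball_norm a)
    then show ?thesis
      using T_bound[OF unit_ball_L1[OF a(1)]] a(2) by simp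
  qed
  \<comment> \<open>Functionals in the ball are 1-Lipschitz and \<open>T\<close> is Lipschitz with
    constant \<open>K\<close>, so uniform bounds pass from a dense set to the whole ball. The factor
    \<open>K + 1\<close> covers the case \<open>K = 0\<close>.\<close>
  have extend: "\<bar>\<psi> f - \<eta> f\<bar> \<le> r"
    if \<psi>: "\<psi> \<in> ?B" and \<eta>: "\<eta> \<in> ?B" and r: "\<And>f. f \<in> T ` D \<Longrightarrow> \<bar>\<psi> f - \<eta> f\<bar> \<le> r" and f: "f \<in> T ` ?U"
    for \<psi> \<eta> r f
  proof (rule field_le_epsilon)
    fix e :: real assume e: "0 < e"
    obtain a where a: "a \<in> ?U" "f = T a"
      using f by blast
    obtain d where d: "d \<in> D" "L1_norm M (\<lambda>x. a x - d x) < e / (2 * (K + 1))"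
      using D(3)[OF a(1), of "e / (2 * (K + 1))"] e K_nonneg by auto
    have L: "T a \<in> Linf M" "T d \<in> Linf M"
      using a d D(2) by (auto intro!: T_Linf unit_ball_L1)
    have "Linf_norm M (\<lambda>x. T a x - T d x) \<le> K * L1_norm M (\<lambda>x. a x - d x)"
      using a d D(2) by (intro T_diff_bound unit_ball_L1) auto
    also have "\<dots> \<le> (K + 1) * (e / (2 * (K + 1)))"
      using d(2) K_nonneg L1_norm_nonneg by (intro mult_mono) auto
    also have "\<dots> = e / 2"
      using K_nonneg by (simp add: field_simps)
    finally have small: "Linf_norm M (\<lambda>x. T a x - T d x) \<le> e / 2" .
    have "\<bar>\<theta> (T a) - \<theta> (T d)\<bar> \<le> e / 2" if \<theta>: "\<theta> \<in> ?B" for \<theta>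
      using dual_unit_ballD(3)[OF \<theta> Linf_diff[OF L]] small
        dual_unit_ballD(1)[OF \<theta> L(1) Linf_cmult[OF L(2)], of "-1"] dual_unit_ballD(2)[OF \<theta> L(2), of "-1"]
      by simp
    from this[OF \<psi>] this[OF \<eta>] show "\<bar>\<psi> f - \<eta> f\<bar> \<le> r + e"
      using r[OF imageI[OF d(1), of T]] unfolding a(2) by linarith
  qed
  show ?thesis
  proof
    assume asp: "asplund_set (Linf M) (Linf_norm M) (T ` ?U)"
    \<comment> \<open>Members of \<open>dual_unit_ball\<close> are normalised to be extensional,
      hence the restriction.\<close>
    let ?R = "\<lambda>\<omega>. restrict (ba_integral M \<omega>) (Linf M)"
    have RB: "?R ` zero_one_ba M \<subseteq> ?B"
      using ba_integral_in_dual_unit_ball by blast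
    have "sup_separable (T ` D) ?B"
      by (rule sup_separable_of_asplund_set[OF _ _ asp C(1,2)]) (auto intro: Linf_add Linf_cmult)
    then have "sup_separable (T ` D) (?R ` zero_one_ba M)"
      using RB by (rule sup_separable_mono)
    then obtain E where E: "countable E" "E \<subseteq> ?R ` zero_one_ba M"
        "\<And>\<psi> \<epsilon>. \<psi> \<in> ?R ` zero_one_ba M \<Longrightarrow> \<epsilon> > 0 \<Longrightarrow> \<exists>d\<in>E. \<forall>u\<in>T ` D. \<bar>\<psi> u - d u\<bar> \<le> \<epsilon>"
      by (rule sup_separable_obtain_subset) blast
    then obtain Z where Z: "countable Z" "Z \<subseteq> zero_one_ba M" "E = ?R ` Z"
      using countable_subset_image[of E ?R "zero_one_ba M"] by auto
    have "\<exists>\<upsilon>\<in>Z. Linf_norm M (\<lambda>x. S \<omega> x - S \<upsilon> x) < \<epsilon>" if w: "\<omega> \<in> zero_one_ba M" and e: "0 < \<epsilon>" for \<omega> \<epsilon>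
    proof -
      obtain \<upsilon> where v: "\<upsilon> \<in> Z" "\<And>u. u \<in> T ` D \<Longrightarrow> \<bar>?R \<omega> u - ?R \<upsilon> u\<bar> \<le> \<epsilon> / 2"
      proof -
        have "\<exists>d\<in>?R ` Z. \<forall>u\<in>T ` D. \<bar>?R \<omega> u - d u\<bar> \<le> \<epsilon> / 2"
          using E(3)[of "?R \<omega>" "\<epsilon> / 2"] w e unfolding Z(3) by simp
        then show ?thesis
          using that by blast
      qed
      have v': "\<upsilon> \<in> zero_one_ba M"
        using v(1) Z(2) by blast
      have "\<bar>ba_integral M \<omega> (T b) - ba_integral M \<upsilon> (T b)\<bar> \<le> \<epsilon> / 2" if b: "b \<in> ?U" for b
      proof -
        have "\<bar>?R \<omega> (T b) - ?R \<upsilon> (T b)\<bar> \<le> \<epsilon> / 2"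
          using ba_integral_in_dual_unit_ball[OF w] ba_integral_in_dual_unit_ball[OF v'] v(2) imageI[OF b]
          by (rule extend)
        then show ?thesis
          using T_Linf[OF unit_ball_L1[OF b]] by simp
      qed
      then have "Linf_norm M (\<lambda>x. S \<omega> x - S \<upsilon> x) \<le> \<epsilon> / 2"
        by (rule S_dist_le[OF w v'])
      then show ?thesis
        using v(1) e by (intro bexI[of _ \<upsilon>]) auto
    qed
    then show "norm_separable (Linf_norm M) (S ` zero_one_ba M)"
      unfolding norm_separable_def using Z(1,2) by (intro exI[of _ "S ` Z"]) auto
  next
    assume "norm_separable (Linf_norm M) (S ` zero_one_ba M)"
    then obtain E where E: "countable E" "E \<subseteq> S ` zero_one_ba M"
        "\<And>f \<epsilon>. f \<in> S ` zero_one_ba M \<Longrightarrow> \<epsilon> > 0 \<Longrightarrow> \<exists>d\<in>E. Linf_norm M (\<lambda>x. f x - d x) < \<epsilon>"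
      unfolding norm_separable_def by blast
    then obtain Z where Z: "countable Z" "Z \<subseteq> zero_one_ba M" "E = S ` Z"
      using countable_subset_image[of E S "zero_one_ba M"] by auto
    have "sup_separable (T ` D) (ba_integral M ` zero_one_ba M)"
      unfolding sup_separable_def
    proof (intro exI[of _ "ba_integral M ` Z"] conjI ballI allI impI)
      show "countable (ba_integral M ` Z)"
        using Z(1) by simp
      fix g and \<epsilon> :: real assume "g \<in> ba_integral M ` zero_one_ba M" and e: "0 < \<epsilon>"
      then obtain \<omega> where w: "\<omega> \<in> zero_one_ba M" "g = ba_integral M \<omega>"
        by blast
      obtain \<upsilon> where v: "\<upsilon> \<in> Z" "Linf_norm M (\<lambda>x. S \<omega> x - S \<upsilon> x) < \<epsilon>"
        using E(3)[of "S \<omega>" \<epsilon>] w e unfolding Z(3) by blast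
      have "\<bar>g u - ba_integral M \<upsilon> u\<bar> \<le> \<epsilon>" if "u \<in> T ` D" for u
      proof -
        obtain b where b: "b \<in> ?U" "u = T b"
          using \<open>u \<in> T ` D\<close> D(2) by blast
        show ?thesis
          using S_dist_ge[OF w(1) subsetD[OF Z(2) v(1)] b(1)] v(2) unfolding w(2) b(2) by linarith
      qed
      then show "\<exists>d\<in>ba_integral M ` Z. \<forall>u\<in>T ` D. \<bar>g u - d u\<bar> \<le> \<epsilon>"
        using v(1) by blast
    qed
    then have "sup_separable (T ` D) ?B"
      using normC C(2) K_nonneg
      by (intro sup_separable_dual_unit_ball_of_zero_one[OF C(1,4)]) auto
    then obtain F where F: "countable F" "F \<subseteq> ?B"
        "\<And>\<psi> \<epsilon>. \<psi> \<in> ?B \<Longrightarrow> \<epsilon> > 0 \<Longrightarrow> \<exists>d\<in>F. \<forall>u\<in>T ` D. \<bar>\<psi> u - d u\<bar> \<le> \<epsilon>"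
      by (rule sup_separable_obtain_subset) blast
    \<comment> \<open>\<open>extend\<close> compares two members of the dual ball, which is why the
      centres \<open>F\<close> were taken inside it.\<close>
    have "\<exists>d\<in>F. \<forall>u\<in>T ` ?U. \<bar>\<psi> u - d u\<bar> \<le> \<epsilon>" if \<psi>: "\<psi> \<in> ?B" and e: "\<epsilon> > 0" for \<psi> \<epsilon>
    proof -
      obtain d where "d \<in> F" "\<forall>u\<in>T ` D. \<bar>\<psi> u - d u\<bar> \<le> \<epsilon>"
        using F(3)[OF \<psi> e] by blast
      then show ?thesis
        using F(2) extend[OF \<psi>, of d] by (intro bexI[of _ d] ballI) blast+
    qed
    then have "sup_separable (T ` ?U) ?B"
      unfolding sup_separable_def using F(1) by (intro exI[of _ F] conjI ballI allI impI)
    then show "asplund_set (Linf M) (Linf_norm M) (T ` ?U)"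
      using C(3) normC by (intro asplund_set_of_sup_separable[where K = K]) (auto intro: Linf_add Linf_cmult)
  qed
qed

end

section \<open>Second countability of the group\<close>

lemma group_nhds_neg_add:
  fixes y :: "'g::topological_group_add"
  assumes "open U" "y \<in> U"
  obtains V where "open V" "0 \<in> V" "\<And>a b. a \<in> V \<Longrightarrow> b \<in> V \<Longrightarrow> y + - a + b \<in> U"
proof -
  have "((\<lambda>p. y + - fst p + snd p) \<longlongrightarrow> y + - 0 + 0) (nhds (0::'g) \<times>\<^sub>F nhds 0)"
    by (intro tendsto_intros filterlim_fst filterlim_snd)
  then have "eventually (\<lambda>p. y + - fst p + snd p \<in> U) (nhds 0 \<times>\<^sub>F nhds 0)"
    using assms by (intro topological_tendstoD) auto
  then obtain Q where Q: "eventually Q (nhds 0)" "\<And>a b. Q a \<Longrightarrow> Q b \<Longrightarrow> y + - a + b \<in> U"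
    by (auto simp: eventually_prod_same)
  obtain V where "open V" "0 \<in> V" "\<And>x. x \<in> V \<Longrightarrow> Q x"
    using Q(1) by (auto simp: eventually_nhds)
  then show ?thesis
    using Q(2) by (intro that[of V]) auto
qed

lemma group_nhds_diff:
  fixes U :: "'g::topological_group_add set"
  assumes "open U" "0 \<in> U"
  obtains V where "open V" "0 \<in> V" "\<And>a b. a \<in> V \<Longrightarrow> b \<in> V \<Longrightarrow> a - b \<in> U"
proof -
  have "((\<lambda>p. fst p + - snd p) \<longlongrightarrow> 0 + - 0) (nhds (0::'g) \<times>\<^sub>F nhds 0)"
    by (intro tendsto_intros filterlim_fst filterlim_snd)
  then have "eventually (\<lambda>p. fst p + - snd p \<in> U) (nhds 0 \<times>\<^sub>F nhds 0)"
    using assms by (intro topological_tendstoD) auto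
  then obtain Q where Q: "eventually Q (nhds 0)" "\<And>a b. Q a \<Longrightarrow> Q b \<Longrightarrow> a - b \<in> U"
    by (auto simp: eventually_prod_same)
  obtain V where "open V" "0 \<in> V" "\<And>x. x \<in> V \<Longrightarrow> Q x"
    using Q(1) by (auto simp: eventually_nhds)
  then show ?thesis
    using Q(2) by (intro that[of V]) auto
qed

text \<open>A tube argument: continuity of addition at each \<open>(0, k)\<close> gives a product
  neighbourhood, finitely many right factors cover \<open>K\<close>, and the corresponding left
  factors are intersected.\<close>

lemma compact_translate_subset:
  fixes K :: "'g::topological_group_add set"
  assumes "compact K" "open V" "K \<subseteq> V"
  obtains N where "open N" "0 \<in> N" "\<And>g x. g \<in> N \<Longrightarrow> x \<in> K \<Longrightarrow> g + x \<in> V"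
proof -
  have "\<forall>k\<in>K. \<exists>C. open (fst C) \<and> open (snd C) \<and> 0 \<in> fst C \<and> k \<in> snd C \<and>
      (\<forall>g\<in>fst C. \<forall>x\<in>snd C. g + x \<in> V)"
  proof
    fix k assume k: "k \<in> K"
    have "((\<lambda>p. fst p + snd p) \<longlongrightarrow> 0 + k) (nhds (0::'g) \<times>\<^sub>F nhds k)"
      by (intro tendsto_intros filterlim_fst filterlim_snd)
    then have "eventually (\<lambda>p. fst p + snd p \<in> V) (nhds 0 \<times>\<^sub>F nhds k)"
      using assms k by (intro topological_tendstoD) auto
    then obtain P Q where PQ: "eventually P (nhds 0)" "eventually Q (nhds k)"
        "\<And>g x. P g \<Longrightarrow> Q x \<Longrightarrow> g + x \<in> V"
      by (auto simp: eventually_prod_filter)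
    obtain A where A: "open A" "0 \<in> A" "\<And>x. x \<in> A \<Longrightarrow> P x"
      using PQ(1) by (auto simp: eventually_nhds)
    obtain B where B: "open B" "k \<in> B" "\<And>x. x \<in> B \<Longrightarrow> Q x"
      using PQ(2) by (auto simp: eventually_nhds)
    show "\<exists>C. open (fst C) \<and> open (snd C) \<and> 0 \<in> fst C \<and> k \<in> snd C \<and>
        (\<forall>g\<in>fst C. \<forall>x\<in>snd C. g + x \<in> V)"
      using A B PQ(3) by (intro exI[of _ "(A, B)"]) auto
  qed
  from bchoice[OF this] obtain C where C: "\<forall>k\<in>K. open (fst (C k)) \<and> open (snd (C k)) \<and>
      0 \<in> fst (C k) \<and> k \<in> snd (C k) \<and> (\<forall>g\<in>fst (C k). \<forall>x\<in>snd (C k). g + x \<in> V)" ..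
  define A where "A = (\<lambda>k. fst (C k))"
  define B where "B = (\<lambda>k. snd (C k))"
  have AB: "open (A k)" "open (B k)" "0 \<in> A k" "k \<in> B k" "\<forall>g\<in>A k. \<forall>x\<in>B k. g + x \<in> V"
    if "k \<in> K" for k
    using bspec[OF C that] by (simp_all add: A_def B_def)
  obtain F where F: "F \<subseteq> K" "finite F" "K \<subseteq> (\<Union>k\<in>F. B k)"
    by (rule compactE_image[OF assms(1), of K B]) (use AB(2,4) in blast)+
  show ?thesis
  proof
    show "open (\<Inter>k\<in>F. A k)"
      using F AB(1) by (intro open_INT) auto
    show "0 \<in> (\<Inter>k\<in>F. A k)"
      using F AB(3) by blast
    fix g x assume gx: "g \<in> (\<Inter>k\<in>F. A k)" "x \<in> K"
    then obtain k where "k \<in> F" "x \<in> B k"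
      using F(3) by blast
    then show "g + x \<in> V"
      using gx(1) F(1) AB(5)[of k] by blast
  qed
qed

lemma translate_eq_vimage: "(+) g ` A = (\<lambda>x. - g + x) -` A" for g :: "'g::group_add"
proof (intro equalityI subsetI)
  fix x assume "x \<in> (\<lambda>x. - g + x) -` A"
  then have "x = g + (- g + x)" "- g + x \<in> A"
    by (auto simp: add.assoc[symmetric])
  then show "x \<in> (+) g ` A"
    by blast
qed (auto simp: add.assoc[symmetric])

lemma open_translate:
  fixes g :: "'g::topological_group_add"
  shows "open U \<Longrightarrow> open ((+) g ` U)"
  unfolding translate_eq_vimage by (intro open_vimage) (auto intro: continuous_intros)

lemma borel_measurable_translate[measurable]:
  fixes g :: "'g::topological_group_add"
  shows "(\<lambda>x. g + x) \<in> borel_measurable borel"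
  by (intro borel_measurable_continuous_onI continuous_intros)

lemma borel_translate:
  fixes g :: "'g::topological_group_add"
  assumes "A \<in> sets borel"
  shows "(+) g ` A \<in> sets borel"
proof -
  have "(\<lambda>x. - g + x) -` A \<inter> space borel \<in> sets borel"
    using assms by (intro measurable_sets[OF borel_measurable_translate])
  then show ?thesis
    by (simp add: translate_eq_vimage)
qed

lemma left_haar_measureD:
  assumes "left_haar_measure H"
  shows "sets H = sets borel" and "emeasure H UNIV \<noteq> 0"
    and "compact K \<Longrightarrow> emeasure H K < \<infinity>"
    and "open U \<Longrightarrow> emeasure H U = (SUP K\<in>{K. compact K \<and> K \<subseteq> U}. emeasure H K)"
    and "A \<in> sets borel \<Longrightarrow> emeasure H ((+) g ` A) = emeasure H A"
proof -
  note haar = assms[unfolded left_haar_measure_def]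
  note rest = haar[THEN conjunct2, THEN conjunct2]
  show "sets H = sets borel" "emeasure H UNIV \<noteq> 0"
    using haar[THEN conjunct1] haar[THEN conjunct2, THEN conjunct1] .
  show "compact K \<Longrightarrow> emeasure H K < \<infinity>"
    using rest[THEN conjunct1] by (rule spec[of _ K, THEN mp])
  show "open U \<Longrightarrow> emeasure H U = (SUP K\<in>{K. compact K \<and> K \<subseteq> U}. emeasure H K)"
    using rest[THEN conjunct2, THEN conjunct2, THEN conjunct1] by (rule spec[of _ U, THEN mp])
  show "A \<in> sets borel \<Longrightarrow> emeasure H ((+) g ` A) = emeasure H A"
    using rest[THEN conjunct2, THEN conjunct2, THEN conjunct2] by (rule spec[of _ g, THEN bspec])
qed

section \<open>Haar measure and countable bases\<close>

locale separable_haar = M: sigma_finite_measure M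
  for H M :: "'g::{topological_group_add, t2_space} measure" +
  assumes haar: "left_haar_measure H"
    and completion: "M = completion H"
    and locally_compact: "locally_compact_space (euclidean :: 'g topology)"
    and separable_L1: "norm_separable (L1_norm M) (L1 M)"
begin

lemma sets_H: "sets H = sets borel"
  by (rule left_haar_measureD(1)[OF haar])

lemma space_H: "space H = UNIV"
  using sets_eq_imp_space_eq[OF sets_H] by simp

lemma space_M[simp]: "space M = UNIV"
  by (simp add: completion space_H)

lemma sets_M[measurable]: "A \<in> sets borel \<Longrightarrow> A \<in> sets M"
  by (simp add: completion sets_H)

lemma emeasure_M: "A \<in> sets borel \<Longrightarrow> emeasure M A = emeasure H A"
  by (simp add: completion sets_H)

lemma emeasure_translate: "A \<in> sets borel \<Longrightarrow> emeasure M ((+) g ` A) = emeasure M A"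
  using left_haar_measureD(5)[OF haar] borel_translate[of A g] by (simp add: emeasure_M)

lemma emeasure_compact_finite: "compact K \<Longrightarrow> emeasure M K < \<infinity>"
  using left_haar_measureD(3)[OF haar] by (simp add: emeasure_M borel_compact)

lemma emeasure_open: "open U \<Longrightarrow> emeasure M U = (SUP K\<in>{K. compact K \<and> K \<subseteq> U}. emeasure M K)"
proof -
  assume U: "open U"
  have "(SUP K\<in>{K. compact K \<and> K \<subseteq> U}. emeasure M K) = (SUP K\<in>{K. compact K \<and> K \<subseteq> U}. emeasure H K)"
    by (intro SUP_cong refl emeasure_M) (auto intro: borel_compact)
  then show ?thesis
    using left_haar_measureD(4)[OF haar U] U by (simp add: emeasure_M)
qed

text \<open>Finitely many translates of \<open>U\<close> cover any given compact set. If
  \<open>U\<close> were null, all compact sets would be null, and by inner regularity so would the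
  whole group.\<close>

lemma emeasure_open_pos:
  assumes U: "open U" "u \<in> U"
  shows "emeasure M U \<noteq> 0"
proof
  assume zero: "emeasure M U = 0"
  have "emeasure M K = 0" if K: "compact K" for K
  proof -
    let ?W = "\<lambda>k. (+) (k - u) ` U"
    have W: "open (?W k)" for k
      by (intro open_translate U)
    have kW: "k \<in> ?W k" for k
      using U(2) by (intro image_eqI[of _ _ u]) auto
    obtain F where F: "F \<subseteq> K" "finite F" "K \<subseteq> (\<Union>k\<in>F. ?W k)"
    proof (rule compactE_image[OF K, of K ?W])
      show "K \<subseteq> (\<Union>k\<in>K. ?W k)"
        using kW by fast
    qed (use W in simp_all)
    have "emeasure M K \<le> emeasure M (\<Union>k\<in>F. ?W k)"
      using F W by (intro emeasure_mono sets_M) auto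
    also have "\<dots> \<le> (\<Sum>k\<in>F. emeasure M (?W k))"
      using F W by (intro emeasure_subadditive_finite) (auto intro!: sets_M)
    also have "\<dots> = 0"
      using U by (simp add: emeasure_translate zero)
    finally show ?thesis
      by simp
  qed
  then have "emeasure M UNIV = 0"
    by (subst emeasure_open) (auto intro!: SUP_eq_const)
  then show False
    using left_haar_measureD(2)[OF haar] by (simp add: emeasure_M)
qed

lemma obtain_finite_nhd:
  obtains W where "open W" "0 \<in> W" "emeasure M W < \<infinity>"
proof -
  have "\<forall>x :: 'g. \<exists>U. open U \<and> (\<exists>K. compact K \<and> x \<in> U \<and> U \<subseteq> K)"
    using locally_compact by (simp add: locally_compact_space_def)
  from spec[OF this, of 0] obtain U K where UK: "open U" "compact K" "(0::'g) \<in> U" "U \<subseteq> K"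
    by blast
  have "emeasure M U \<le> emeasure M K"
    using UK by (intro emeasure_mono sets_M) (auto intro: borel_compact)
  then show ?thesis
    using emeasure_compact_finite[OF UK(2)] UK by (intro that[of U]) auto
qed

lemma indicator_L1: "A \<in> sets borel \<Longrightarrow> emeasure M A < \<infinity> \<Longrightarrow> indicat_real A \<in> L1 M"
  by (simp add: L1_def sets_M)

lemma L1_norm_indicator_diff:
  assumes A: "A \<in> sets borel" "emeasure M A < \<infinity>" and B: "B \<in> sets borel" "emeasure M B < \<infinity>"
  shows "measure M (A - B) \<le> L1_norm M (\<lambda>x. indicator A x - indicator B x)"
proof -
  have fin: "emeasure M (A - B) < \<infinity>"
    using A B emeasure_mono[of "A - B" A M] sets_M by (meson Diff_subset le_less_trans)
  have "measure M (A - B) = (\<integral>x. indicator (A - B) x \<partial>M)"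
    using A B by (simp add: sets_M)
  also have "\<dots> \<le> (\<integral>x. \<bar>indicator A x - indicator B x\<bar> \<partial>M)"
  proof (rule integral_mono)
    show "integrable M (\<lambda>x. \<bar>indicat_real A x - indicator B x\<bar>)"
      using A B by (simp add: sets_M)
  qed (use A B fin in \<open>auto simp: sets_M split: split_indicator\<close>)
  finally show ?thesis
    by (simp add: L1_norm_def)
qed

lemma separable_indicators:
  assumes "\<And>i. i \<in> I \<Longrightarrow> A i \<in> sets borel" "\<And>i. i \<in> I \<Longrightarrow> emeasure M (A i) < \<infinity>"
  obtains J where "countable J" "J \<subseteq> I"
    "\<And>i \<epsilon>. i \<in> I \<Longrightarrow> \<epsilon> > 0 \<Longrightarrow> \<exists>j\<in>J. L1_norm M (\<lambda>x. indicator (A i) x - indicator (A j) x) < \<epsilon>"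
proof -
  let ?f = "\<lambda>i. indicat_real (A i)"
  have "norm_separable (L1_norm M) (?f ` I)"
    by (rule norm_separable_subset[OF separable_L1])
      (use assms in \<open>auto intro: indicator_L1 L1_norm_triangle L1_norm_minus_commute\<close>)
  then obtain D where D: "countable D" "D \<subseteq> ?f ` I"
      "\<And>f \<epsilon>. f \<in> ?f ` I \<Longrightarrow> \<epsilon> > 0 \<Longrightarrow> \<exists>d\<in>D. L1_norm M (\<lambda>x. f x - d x) < \<epsilon>"
    by (rule norm_separableE) blast
  then obtain J where J: "countable J" "J \<subseteq> I" "D = ?f ` J"
    using countable_subset_image[of D ?f I] by auto
  show ?thesis
    by (rule that[OF J(1,2)]) (use D(3) J(3) in blast)
qed

text \<open>If \<open>V - V \<subseteq> U\<close> and \<open>V\<close>, \<open>V'\<close> are close in \<open>L\<^sup>1\<close>, then \<open>g \<notin> U\<close> forces \<open>g + V'\<close> to be almost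
  disjoint from \<open>V'\<close>.  So the sets of \<open>g\<close> with large overlap, for \<open>V'\<close> in a countable dense
  family, form a base at \<open>0\<close>.\<close>

lemma first_countable_at_zero:
  obtains B :: "nat \<Rightarrow> 'g set" where "\<And>n. open (B n)" "\<And>n. 0 \<in> B n"
    "\<And>U. open U \<Longrightarrow> 0 \<in> U \<Longrightarrow> \<exists>n. B n \<subseteq> U"
proof -
  define I where "I = {V :: 'g set. open V \<and> 0 \<in> V \<and> emeasure M V < \<infinity>}"
  have I: "V \<in> sets borel" "emeasure M V < \<infinity>" "open V" "0 < measure M V" if "V \<in> I" for V
    using that emeasure_open_pos[of V 0]
    by (auto simp: I_def measure_def enn2real_positive_iff zero_less_iff_neq_zero)
  obtain J where J: "countable J" "J \<subseteq> I"
      "\<And>V \<epsilon>. V \<in> I \<Longrightarrow> \<epsilon> > 0 \<Longrightarrow> \<exists>W\<in>J. L1_norm M (\<lambda>x. indicator V x - indicator W x) < \<epsilon>"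
    by (rule separable_indicators[of I "\<lambda>V. V"]) (use I in blast)+
  have "\<exists>N. open N \<and> 0 \<in> N \<and> (\<forall>g\<in>N. measure M (V \<inter> (+) g ` V) > measure M V / 2)" if V: "V \<in> I" for V
  proof -
    have "ennreal (measure M V / 2) < emeasure M V"
      using I[OF V] by (simp add: emeasure_eq_ennreal_measure less_top ennreal_lessI)
    \<comment> \<open>Inner regularity leaves a compact \<open>K\<close> carrying more than half of
      \<open>V\<close>; a small translate of \<open>K\<close> still lies in \<open>V\<close>, hence
      in both sets of the intersection.\<close>
    then obtain K where K: "compact K" "K \<subseteq> V" "ennreal (measure M V / 2) < emeasure M K"
      using emeasure_open[OF I(3)[OF V]] by (auto simp: less_SUP_iff)
    obtain N where N: "open N" "0 \<in> N" "\<And>g x. g \<in> N \<Longrightarrow> x \<in> K \<Longrightarrow> g + x \<in> V"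
      using compact_translate_subset[OF K(1) I(3)[OF V] K(2)] by blast
    have "measure M V / 2 < measure M (V \<inter> (+) g ` V)" if g: "g \<in> N" for g
    proof -
      have KB: "K \<in> sets borel"
        using K(1) by (rule borel_compact)
      have VB: "V \<inter> (+) g ` V \<in> sets borel"
        using I[OF V] by (intro sets.Int borel_translate)
      have "ennreal (measure M V / 2) < emeasure M ((+) g ` K)"
        using K(3) by (simp add: emeasure_translate[OF KB])
      also have "\<dots> \<le> emeasure M (V \<inter> (+) g ` V)"
      proof (rule emeasure_mono)
        show "(+) g ` K \<subseteq> V \<inter> (+) g ` V"
          by (intro image_subsetI IntI N(3) g imageI subsetD[OF K(2)])
      qed (rule sets_M[OF VB])
      also have "\<dots> = ennreal (measure M (V \<inter> (+) g ` V))"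
        using emeasure_mono[of "V \<inter> (+) g ` V" V M] I[OF V]
        by (intro emeasure_eq_ennreal_measure) (auto simp: sets_M top_unique)
      finally show ?thesis
        by (simp add: ennreal_less_iff)
    qed
    with N show ?thesis
      by blast
  qed
  then obtain N where N: "\<And>V. V \<in> I \<Longrightarrow> open (N V)" "\<And>V. V \<in> I \<Longrightarrow> 0 \<in> N V"
      "\<And>V g. V \<in> I \<Longrightarrow> g \<in> N V \<Longrightarrow> measure M (V \<inter> (+) g ` V) > measure M V / 2"
    by metis
  have base: "\<exists>W\<in>J. N W \<subseteq> U" if U: "open U" "0 \<in> U" for U
  proof -
    obtain V0 where V0: "open V0" "0 \<in> V0" "\<And>a b. a \<in> V0 \<Longrightarrow> b \<in> V0 \<Longrightarrow> a - b \<in> U"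
      using group_nhds_diff[OF U] by blast
    obtain W0 where W0: "open W0" "0 \<in> W0" "emeasure M W0 < \<infinity>"
      by (rule obtain_finite_nhd)
    define V where "V = V0 \<inter> W0"
    have "emeasure M V \<le> emeasure M W0"
      unfolding V_def using W0 by (intro emeasure_mono sets_M) auto
    then have V: "V \<in> I"
      using V0 W0 by (auto simp: I_def V_def)
    \<comment> \<open>If \<open>g\<close> in \<open>N W\<close> lay outside \<open>U\<close>, the
      overlap of \<open>W\<close> with its translate would be less than
      \<open>measure M V / 4\<close>, so \<open>measure M W < measure M V / 2\<close>. Closeness 1/8
      gives more than 7/8 of \<open>measure M V\<close>, a contradiction.\<close>
    obtain W where W: "W \<in> J" "L1_norm M (\<lambda>x. indicator V x - indicator W x) < measure M V / 8"
      using J(3)[OF V, of "measure M V / 8"] I[OF V] by auto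
    have WI: "W \<in> I"
      using W(1) J(2) by blast
    note V' = I[OF V] and W' = I[OF WI]
    have d1: "measure M (V - W) < measure M V / 8"
      using L1_norm_indicator_diff[OF V'(1,2) W'(1,2)] W(2) by simp
    have d2: "measure M (W - V) < measure M V / 8"
      using L1_norm_indicator_diff[OF W'(1,2) V'(1,2)] W(2)
        L1_norm_minus_commute[of M "indicator V" "indicator W"] by simp
    have fin: "A \<in> fmeasurable M" if "A \<in> sets borel" "emeasure M A < \<infinity>" for A
      using that by (simp add: fmeasurable_def sets_M)
    have "g \<in> U" if g: "g \<in> N W" for g
    proof (rule ccontr)
      assume "g \<notin> U"
      have disj: "V \<inter> (+) g ` V = {}"
      proof (rule ccontr)
        assume "V \<inter> (+) g ` V \<noteq> {}"
        then obtain v v' where v: "v \<in> V" "v' \<in> V" "v = g + v'"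
          by blast
        then have "g = v - v'"
          by simp
        then show False
          using v V0(3)[of v v'] \<open>g \<notin> U\<close> by (auto simp: V_def)
      qed
      have mt: "measure M ((+) g ` A) = measure M A" if "A \<in> sets borel" for A
        using emeasure_translate[OF that, of g] by (simp add: measure_def)
      have f: "W - V \<in> fmeasurable M" "(+) g ` (W - V) \<in> fmeasurable M"
        using emeasure_mono[of "W - V" W M] V' W' emeasure_translate[of "W - V" g]
        by (auto intro!: fin borel_translate simp: sets_M)
      \<comment> \<open>As \<open>V\<close> misses its translate, a point of the overlap lies
        outside \<open>V\<close> or outside the translate of \<open>V\<close>.\<close>
      have "W \<inter> (+) g ` W \<subseteq> (W - V) \<union> (+) g ` (W - V)"
        using disj by blast
      then have "measure M (W \<inter> (+) g ` W) \<le> measure M ((W - V) \<union> (+) g ` (W - V))"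
      proof (rule measure_mono_fmeasurable)
        show "W \<inter> (+) g ` W \<in> sets M"
          using W'(1) by (intro sets_M sets.Int borel_translate)
        show "(W - V) \<union> (+) g ` (W - V) \<in> fmeasurable M"
          using f by (rule fmeasurable.Un)
      qed
      also have "\<dots> \<le> measure M (W - V) + measure M ((+) g ` (W - V))"
        using f by (intro measure_Un_le) auto
      also have "\<dots> < measure M V / 4"
        using d2 mt[of "W - V"] V' W' by simp
      finally have "measure M W / 2 < measure M V / 4"
        using N(3)[OF WI g] by simp
      moreover have "measure M V \<le> measure M (V - W) + measure M W"
      proof -
        have "measure M V \<le> measure M ((V - W) \<union> W)"
          using V' W' emeasure_mono[of "V - W" V M]
          by (intro measure_mono_fmeasurable fmeasurable.Un fin) (auto simp: sets_M)
        also have "\<dots> \<le> measure M (V - W) + measure M W"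
          using V' W' by (intro measure_Un_le) (auto simp: sets_M)
        finally show ?thesis .
      qed
      ultimately show False
        using d1 V'(4) by simp
    qed
    then show ?thesis
      using W(1) by blast
  qed
  have "J \<noteq> {}"
    using base[of UNIV] by auto
  then obtain c :: "nat \<Rightarrow> 'g set" where c: "range c = J"
    using J(1) uncountable_def by metis
  have "c n \<in> I" for n
    using c J(2) by blast
  then show ?thesis
    using N(1,2) base unfolding c[symmetric] by (intro that[of "\<lambda>n. N (c n)"]) auto
qed

text \<open>Two translates of \<open>V\<close> at L1 distance less than \<open>measure M V\<close>
  must overlap, so a countable dense family of translates yields centres \<open>x\<close> with
  \<open>- x + y\<close> in \<open>B n\<close>. Translating the countable base at 0 to these centres
  gives a base of the topology.\<close>

lemma second_countable: "\<exists>\<BB>::'g set set. countable \<BB> \<and> topological_basis \<BB>"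
proof -
  obtain B :: "nat \<Rightarrow> 'g set" where B: "\<And>n. open (B n)" "\<And>n. 0 \<in> B n"
      "\<And>U. open U \<Longrightarrow> 0 \<in> U \<Longrightarrow> \<exists>n. B n \<subseteq> U"
    by (rule first_countable_at_zero) blast
  obtain W where W: "open W" "0 \<in> W" "emeasure M W < \<infinity>"
    by (rule obtain_finite_nhd)
  have "\<exists>S. countable S \<and> (\<forall>y. \<exists>x\<in>S. - x + y \<in> B n)" for n
  proof -
    obtain V0 where V0: "open V0" "0 \<in> V0" "\<And>a b. a \<in> V0 \<Longrightarrow> b \<in> V0 \<Longrightarrow> a - b \<in> B n"
      using group_nhds_diff[OF B(1,2)] by blast
    define V where "V = V0 \<inter> W"
    have oV: "open V" "0 \<in> V"
      using V0 W by (auto simp: V_def)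
    have "emeasure M V \<le> emeasure M W"
      unfolding V_def using W V0 by (intro emeasure_mono sets_M) auto
    then have V: "V \<in> sets borel" "emeasure M V < \<infinity>" "0 < measure M V"
      using oV emeasure_open_pos[OF oV] W
      by (auto simp: measure_def enn2real_positive_iff zero_less_iff_neq_zero)
    have gV: "(+) x ` V \<in> sets borel" "emeasure M ((+) x ` V) < \<infinity>" "measure M ((+) x ` V) = measure M V" for x
      using V by (auto simp: emeasure_translate borel_translate measure_def)
    obtain S where S: "countable S" "\<And>y. \<exists>x\<in>S. L1_norm M (\<lambda>z. indicator ((+) y ` V) z - indicator ((+) x ` V) z) < measure M V"
      using separable_indicators[of UNIV "\<lambda>x. (+) x ` V"] gV V(3) by (metis UNIV_I)
    have "\<exists>x\<in>S. - x + y \<in> B n" for y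
    proof -
      obtain x where x: "x \<in> S" "L1_norm M (\<lambda>z. indicator ((+) y ` V) z - indicator ((+) x ` V) z) < measure M V"
        using S(2) by blast
      then have "measure M ((+) y ` V - (+) x ` V) < measure M V"
        using L1_norm_indicator_diff[OF gV(1,2)[of y] gV(1,2)[of x]] by simp
      then have "(+) y ` V \<inter> (+) x ` V \<noteq> {}"
        using gV(3)[of y] by (metis Diff_triv less_irrefl)
      then obtain a b where ab: "a \<in> V" "b \<in> V" "y + a = x + b"
        by blast
      have "- x + y = b - a"
        using ab(3) by (metis add.assoc add_diff_cancel minus_add_cancel)
      then show ?thesis
        using V0(3)[of b a] ab x(1) by (intro bexI[of _ x]) (auto simp: V_def)
    qed
    with S(1) show ?thesis
      by blast
  qed
  then obtain S where S: "\<And>n. countable (S n)" "\<And>n y. \<exists>x\<in>S n. - x + y \<in> B n"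
    by metis
  let ?C = "(\<lambda>(n, x). (+) x ` B n) ` (SIGMA n:UNIV. S n)"
  have "countable ?C"
    using S(1) by (intro countable_image countable_SIGMA) auto
  moreover have "topological_basis ?C"
  proof (rule topological_basisI)
    show "open C" if "C \<in> ?C" for C
      using that B(1) by (auto intro: open_translate)
    fix U and y :: 'g assume U: "open U" "y \<in> U"
    obtain V where V: "open V" "0 \<in> V" "\<And>a b. a \<in> V \<Longrightarrow> b \<in> V \<Longrightarrow> y + - a + b \<in> U"
      using group_nhds_neg_add[OF U] by blast
    obtain n where n: "B n \<subseteq> V"
      using B(3)[OF V(1,2)] by blast
    obtain x where x: "x \<in> S n" "- x + y \<in> B n"
      using S(2) by blast
    \<comment> \<open>Both \<open>- x + y\<close> and \<open>b\<close> lie in \<open>V\<close>, and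
      \<open>x + b\<close> equals \<open>y + - (- x + y) + b\<close>;
      \<open>group_nhds_neg_add\<close> has its shape for this purpose.\<close>
    have "x + b \<in> U" if b: "b \<in> B n" for b
    proof -
      have "y + - (- x + y) + b = x + b"
        by (simp add: minus_add add.assoc[symmetric])
      then show ?thesis
        using V(3)[of "- x + y" b] n x b by auto
    qed
    moreover have "y \<in> (+) x ` B n"
      using x(2) by (intro image_eqI[of _ _ "- x + y"]) (auto simp: add.assoc[symmetric])
    ultimately show "\<exists>C\<in>?C. y \<in> C \<and> C \<subseteq> U"
      using x(1) by (intro bexI[of _ "(+) x ` B n"]) auto
  qed
  ultimately show ?thesis
    by blast
qed

end

section \<open>Convolution\<close>

text \<open>With a countable base an open subset of the square is a countable union of open
  rectangles, so it belongs to the product of the two Borel sigma-algebras.\<close>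

lemma open_in_pair_borel:
  fixes W :: "('a::topological_space \<times> 'a) set" and \<BB> :: "'a set set"
  assumes "countable \<BB>" "topological_basis \<BB>" and W: "open W"
  shows "W \<in> sets (borel \<Otimes>\<^sub>M (borel :: 'a measure))"
proof -
  let ?R = "{(A, B). A \<in> \<BB> \<and> B \<in> \<BB> \<and> A \<times> B \<subseteq> W}"
  have sub: "?R \<subseteq> \<BB> \<times> \<BB>"
    by auto
  have "countable ?R"
    by (rule countable_subset[OF sub]) (intro countable_SIGMA assms(1))
  moreover have "A \<in> sets borel" if "A \<in> \<BB>" for A
    using topological_basis_open[OF assms(2) that] by simp
  ultimately have "(\<Union>(A, B)\<in>?R. A \<times> B) \<in> sets (borel \<Otimes>\<^sub>M (borel :: 'a measure))"
    by (intro sets.countable_UN') auto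
  moreover have "W = (\<Union>(A, B)\<in>?R. A \<times> B)"
  proof (intro equalityI subsetI)
    fix p assume "p \<in> W"
    then obtain A B where AB: "open A" "open B" "p \<in> A \<times> B" "A \<times> B \<subseteq> W"
      using open_prod_elim[OF W] by metis
    have p: "fst p \<in> A" "snd p \<in> B"
      using AB(3) by (simp_all add: mem_Times_iff)
    obtain A' where A': "A' \<in> \<BB>" "fst p \<in> A'" "A' \<subseteq> A"
      by (rule topological_basisE[OF assms(2) AB(1) p(1)])
    obtain B' where B': "B' \<in> \<BB>" "snd p \<in> B'" "B' \<subseteq> B"
      by (rule topological_basisE[OF assms(2) AB(2) p(2)])
    have "(A', B') \<in> ?R"
      using A' B' AB(4) by auto
    moreover have "p \<in> A' \<times> B'"
      using A'(2) B'(2) by (simp add: mem_Times_iff)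
    ultimately show "p \<in> (\<Union>(A, B)\<in>?R. A \<times> B)"
      by blast
  qed blast
  ultimately show ?thesis
    by simp
qed

lemma (in complete_measure) borel_measurable_AE_eq:
  fixes f f' :: "'a \<Rightarrow> real"
  assumes f': "f' \<in> borel_measurable M" and eq: "AE x in M. f x = f' x"
  shows "f \<in> borel_measurable M"
proof (rule measurableI)
  fix S :: "real set" assume S: "S \<in> sets borel"
  show "f -` S \<inter> space M \<in> sets M"
  proof (rule in_sets_AE)
    show "AE x in M. x \<in> f' -` S \<inter> space M \<longleftrightarrow> x \<in> f -` S \<inter> space M"
      using eq by eventually_elim auto
    show "f' -` S \<inter> space M \<in> sets M"
      using f' S by (rule measurable_sets)
  qed auto
qed auto

text \<open>Completeness transfers measurability from \<open>f'\<close> to \<open>f\<close>, so it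
  suffices to check it for the Borel version of an integrand.\<close>

lemma (in complete_measure) integral_eq_of_AE_eq:
  fixes f f' :: "'a \<Rightarrow> real"
  assumes "f' \<in> borel_measurable M" "AE x in M. f x = f' x"
  shows "(\<integral>x. f x \<partial>M) = (\<integral>x. f' x \<partial>M)"
  using borel_measurable_AE_eq[OF assms] assms by (rule integral_cong_AE)

section \<open>Fubini's theorem for convolution\<close>

context separable_haar
begin

sublocale complete_measure M
  by (subst completion) (rule completion.complete_measure_axioms)

sublocale pair: pair_sigma_finite M M
  by (rule pair_sigma_finite.intro; rule M.sigma_finite_measure_axioms)

lemma borel_measurable_H: "borel_measurable H = borel_measurable borel"
  by (rule measurable_cong_sets[OF sets_H refl])

lemma borel_measurable_M:
  assumes "f \<in> borel_measurable borel"
  shows "f \<in> borel_measurable M"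
proof -
  have "f \<in> borel_measurable (completion H)"
    using assms unfolding borel_measurable_H[symmetric] by (rule measurable_completion)
  then show ?thesis
    by (subst completion)
qed

text \<open>Second countability enters here: continuity alone concerns the Borel sets of the square,
  which must be brought down to the product sigma-algebra.\<close>

lemma measurable_neg_add[measurable]: "(\<lambda>p. - fst p + snd p) \<in> borel_measurable (M \<Otimes>\<^sub>M M)"
proof -
  obtain \<BB> :: "'g set set" where \<BB>: "countable \<BB>" "topological_basis \<BB>"
    using second_countable by blast
  have id: "(\<lambda>x. x) \<in> measurable M borel"
    by (rule borel_measurable_M) simp
  have "(\<lambda>p. - fst p + snd p) \<in> borel_measurable (borel \<Otimes>\<^sub>M (borel :: 'g measure))"
  proof (rule borel_measurableI)
    fix S :: "'g set" assume "open S"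
    then have "open ((\<lambda>p. - fst p + snd p) -` S)"
      by (intro open_vimage continuous_intros)
    from open_in_pair_borel[OF \<BB> this]
    show "(\<lambda>p. - fst p + snd p) -` S \<inter> space (borel \<Otimes>\<^sub>M borel) \<in> sets (borel \<Otimes>\<^sub>M (borel :: 'g measure))"
      by (simp add: space_pair_measure)
  qed
  moreover have "(\<lambda>p. (fst p, snd p)) \<in> measurable (M \<Otimes>\<^sub>M M) (borel \<Otimes>\<^sub>M borel)"
    by (intro measurable_Pair measurable_compose[OF measurable_fst id] measurable_compose[OF measurable_snd id])
  ultimately have "(\<lambda>p. - fst (fst p, snd p) + snd (fst p, snd p)) \<in> borel_measurable (M \<Otimes>\<^sub>M M)"
    by (rule measurable_compose[rotated])
  then show ?thesis
    by simp
qed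

lemma nn_integral_translate:
  assumes f: "f \<in> borel_measurable borel"
  shows "(\<integral>\<^sup>+g. f (- h + g) \<partial>M) = (\<integral>\<^sup>+g. f g \<partial>M)"
proof -
  have m: "(\<lambda>g. - h + g) \<in> measurable H H"
    using borel_measurable_translate[of "- h"] measurable_cong_sets[OF sets_H sets_H] by simp
  have "distr H H (\<lambda>g. - h + g) = H"
  proof (rule measure_eqI)
    fix A assume "A \<in> sets (distr H H (\<lambda>g. - h + g))"
    then have A: "A \<in> sets borel"
      by (simp add: sets_H)
    then show "emeasure (distr H H (\<lambda>g. - h + g)) A = emeasure H A"
      using left_haar_measureD(5)[OF haar A, of h] m
      by (simp add: emeasure_distr sets_H space_H translate_eq_vimage)
  qed simp
  moreover have "(\<integral>\<^sup>+g. f g \<partial>distr H H (\<lambda>g. - h + g)) = (\<integral>\<^sup>+g. f (- h + g) \<partial>H)"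
    using f by (intro nn_integral_distr m) (simp add: borel_measurable_H)
  ultimately show ?thesis
    unfolding completion nn_integral_completion by simp
qed

text \<open>Left invariance controls sections at fixed \<open>h\<close>, where the exceptional
  \<open>g\<close> form a translate of \<open>N\<close>. At fixed \<open>g\<close> the section also
  involves inversion, so it is reached by exchanging the quantifiers with Fubini's theorem, for
  almost every \<open>g\<close>.\<close>

lemma AE_translate:
  assumes "AE x in H. P x"
  shows "AE g in M. AE h in M. P (- h + g)"
proof -
  obtain N where N: "{x\<in>space H. \<not> P x} \<subseteq> N" "N \<in> null_sets H"
    using assms by (auto elim!: AE_E simp: null_sets_def)
  have NB[measurable]: "N \<in> sets borel"
    using N(2) by (auto simp: sets_H)
  have "AE h in M. AE g in M. - h + g \<notin> N"
  proof (rule AE_I2)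
    fix h
    have "emeasure M ((+) h ` N) = 0"
      using N(2) by (simp add: emeasure_translate[OF NB] emeasure_M[OF NB] null_setsD1)
    then show "AE g in M. - h + g \<notin> N"
      using borel_translate[OF NB, of h] unfolding translate_eq_vimage
      by (intro AE_I[of _ _ "(\<lambda>x. - h + x) -` N"]) auto
  qed
  moreover have "{x\<in>space (M \<Otimes>\<^sub>M M). - fst x + snd x \<notin> N} \<in> sets (M \<Otimes>\<^sub>M M)"
  proof -
    have "{x\<in>space (M \<Otimes>\<^sub>M M). - fst x + snd x \<notin> N} = (\<lambda>p. - fst p + snd p) -` (- N) \<inter> space (M \<Otimes>\<^sub>M M)"
      by blast
    also have "\<dots> \<in> sets (M \<Otimes>\<^sub>M M)"
      by (rule measurable_sets[OF measurable_neg_add]) (rule borel_comp[OF NB])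
    finally show ?thesis .
  qed
  ultimately have "AE g in M. AE h in M. - h + g \<notin> N"
    by (rule pair.AE_commute[THEN iffD1, rotated])
  then show ?thesis
  proof eventually_elim
    case (elim g)
    then show ?case
      by eventually_elim (use N(1) in \<open>auto simp: space_H\<close>)
  qed
qed

text \<open>The integrand of the pairing of \<open>\<phi>\<close> with a convolution, at a point
  \<open>p = (h, g)\<close>; it is meant for a Borel function \<open>b\<close>, which makes it
  jointly measurable.\<close>

definition kernel where
  "kernel \<phi> a b = (\<lambda>p. a (fst p) * \<phi> (snd p) * b (- fst p + snd p) :: real)"

lemma
  fixes a b b' \<phi> :: "'g \<Rightarrow> real"
  assumes \<phi>: "\<phi> \<in> Linf M" and a: "a \<in> L1 M" and b: "b \<in> L1 M"
    and b': "b' \<in> borel_measurable borel" "AE x in H. b x = b' x"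
  shows integrable_kernel: "integrable (M \<Otimes>\<^sub>M M) (kernel \<phi> a b')"
    and pairing_convolution: "pairing M \<phi> (convolution M a b) = (\<integral>p. kernel \<phi> a b' p \<partial>(M \<Otimes>\<^sub>M M))"
    and pairing_convolution_bound:
      "\<bar>pairing M \<phi> (convolution M a b)\<bar> \<le> Linf_norm M \<phi> * L1_norm M a * L1_norm M b"
proof -
  note [measurable] = LinfD(1)[OF \<phi>] L1_D[OF a] b'(1)
  have kernel_m[measurable]: "kernel \<phi> a b' \<in> borel_measurable (M \<Otimes>\<^sub>M M)"
    unfolding kernel_def by measurable
  have norms: "(\<integral>\<^sup>+x. ennreal \<bar>f x\<bar> \<partial>M) = ennreal (L1_norm M f)" if "f \<in> L1 M" for f
    using that by (simp add: L1_def L1_norm_def nn_integral_eq_integral)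
  have "(\<integral>\<^sup>+x. ennreal \<bar>b' x\<bar> \<partial>M) = (\<integral>\<^sup>+x. ennreal \<bar>b x\<bar> \<partial>M)"
    using AE_completion[OF b'(2)] unfolding completion[symmetric]
    by (intro nn_integral_cong_AE) (auto elim: eventually_mono)
  then have nb': "(\<integral>\<^sup>+x. ennreal \<bar>b' x\<bar> \<partial>M) = ennreal (L1_norm M b)"
    by (simp add: norms[OF b])
  have "(\<integral>\<^sup>+p. ennreal \<bar>kernel \<phi> a b' p\<bar> \<partial>(M \<Otimes>\<^sub>M M))
      = (\<integral>\<^sup>+h. \<integral>\<^sup>+g. ennreal \<bar>a h * \<phi> g * b' (- h + g)\<bar> \<partial>M \<partial>M)"
    by (subst M.nn_integral_fst[symmetric]) (auto simp: kernel_def)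
  also have "\<dots> \<le> (\<integral>\<^sup>+h. \<integral>\<^sup>+g. ennreal (\<bar>a h\<bar> * Linf_norm M \<phi>) * ennreal \<bar>b' (- h + g)\<bar> \<partial>M \<partial>M)"
  proof (rule nn_integral_mono, rule nn_integral_mono_AE)
    fix h
    show "AE g in M. ennreal \<bar>a h * \<phi> g * b' (- h + g)\<bar> \<le> ennreal (\<bar>a h\<bar> * Linf_norm M \<phi>) * ennreal \<bar>b' (- h + g)\<bar>"
      using LinfD(2)[OF \<phi>]
    proof eventually_elim
      case (elim g)
      then have "\<bar>a h * \<phi> g * b' (- h + g)\<bar> \<le> \<bar>a h\<bar> * Linf_norm M \<phi> * \<bar>b' (- h + g)\<bar>"
        by (simp add: abs_mult mult_left_mono mult_right_mono)
      then show ?case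
        using LinfD(3)[OF \<phi>] by (simp add: ennreal_mult[symmetric])
    qed
  qed
  also have "\<dots> = (\<integral>\<^sup>+h. ennreal (\<bar>a h\<bar> * Linf_norm M \<phi>) * ennreal (L1_norm M b) \<partial>M)"
  proof (rule nn_integral_cong)
    fix h
    have "(\<lambda>g. ennreal \<bar>b' (- h + g)\<bar>) \<in> borel_measurable M"
      by (rule borel_measurable_M) measurable
    then have "(\<integral>\<^sup>+g. ennreal (\<bar>a h\<bar> * Linf_norm M \<phi>) * ennreal \<bar>b' (- h + g)\<bar> \<partial>M)
        = ennreal (\<bar>a h\<bar> * Linf_norm M \<phi>) * (\<integral>\<^sup>+g. ennreal \<bar>b' (- h + g)\<bar> \<partial>M)"
      by (rule nn_integral_cmult)
    \<comment> \<open>Left invariance makes the inner integral independent of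
      \<open>h\<close>.\<close>
    also have "(\<integral>\<^sup>+g. ennreal \<bar>b' (- h + g)\<bar> \<partial>M) = ennreal (L1_norm M b)"
      using nn_integral_translate[of "\<lambda>x. ennreal \<bar>b' x\<bar>" h] nb' by simp
    finally show "(\<integral>\<^sup>+g. ennreal (\<bar>a h\<bar> * Linf_norm M \<phi>) * ennreal \<bar>b' (- h + g)\<bar> \<partial>M)
        = ennreal (\<bar>a h\<bar> * Linf_norm M \<phi>) * ennreal (L1_norm M b)" .
  qed
  also have "\<dots> = (\<integral>\<^sup>+h. ennreal (Linf_norm M \<phi> * L1_norm M b) * ennreal \<bar>a h\<bar> \<partial>M)"
    using LinfD(3)[OF \<phi>] L1_norm_nonneg[of M b]
    by (intro nn_integral_cong) (simp add: ennreal_mult[symmetric] mult_ac)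
  also have "\<dots> = ennreal (Linf_norm M \<phi> * L1_norm M b) * ennreal (L1_norm M a)"
    by (subst nn_integral_cmult) (auto simp: norms[OF a])
  also have "\<dots> = ennreal (Linf_norm M \<phi> * L1_norm M a * L1_norm M b)"
    using LinfD(3)[OF \<phi>] L1_norm_nonneg[of M b] L1_norm_nonneg[of M a]
    by (simp add: ennreal_mult[symmetric] mult_ac)
  finally have bound: "(\<integral>\<^sup>+p. ennreal \<bar>kernel \<phi> a b' p\<bar> \<partial>(M \<Otimes>\<^sub>M M))
      \<le> ennreal (Linf_norm M \<phi> * L1_norm M a * L1_norm M b)" .
  show int: "integrable (M \<Otimes>\<^sub>M M) (kernel \<phi> a b')"
    using bound by (intro integrableI_bounded kernel_m) (auto intro: le_less_trans)
  have "(\<integral>g. convolution M a b g * \<phi> g \<partial>M) = (\<integral>g. (\<integral>h. kernel \<phi> a b' (h, g) \<partial>M) \<partial>M)"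
  proof (rule integral_eq_of_AE_eq)
    show "(\<lambda>g. \<integral>h. kernel \<phi> a b' (h, g) \<partial>M) \<in> borel_measurable M"
      by measurable
    \<comment> \<open>The convolution is formed with \<open>b\<close>, the kernel with its Borel
      version; by \<open>AE_translate\<close> they give the same inner integral for almost every
      \<open>g\<close>.\<close>
    show "AE g in M. convolution M a b g * \<phi> g = (\<integral>h. kernel \<phi> a b' (h, g) \<partial>M)"
      using AE_translate[OF b'(2)]
    proof eventually_elim
      case (elim g)
      have "(\<lambda>h. b' (- h + g)) \<in> borel_measurable M"
        by (intro borel_measurable_M measurable_compose[OF _ b'(1)] borel_measurable_continuous_onI continuous_intros)
      then have "(\<lambda>h. a h * b' (- h + g)) \<in> borel_measurable M"
        by measurable
      then have "convolution M a b g = (\<integral>h. a h * b' (- h + g) \<partial>M)"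
        unfolding convolution_def
        by (rule integral_eq_of_AE_eq) (use elim in \<open>auto elim: eventually_mono\<close>)
      moreover have "(\<integral>h. kernel \<phi> a b' (h, g) \<partial>M) = (\<integral>h. \<phi> g * (a h * b' (- h + g)) \<partial>M)"
        by (simp only: kernel_def fst_conv snd_conv mult_ac)
      ultimately show ?case
        by (simp only: integral_mult_right_zero mult.commute)
    qed
  qed
  also have "\<dots> = (\<integral>p. kernel \<phi> a b' p \<partial>(M \<Otimes>\<^sub>M M))"
    using pair.integral_snd[of "\<lambda>h g. kernel \<phi> a b' (h, g)"] int by simp
  finally show eq: "pairing M \<phi> (convolution M a b) = (\<integral>p. kernel \<phi> a b' p \<partial>(M \<Otimes>\<^sub>M M))"
    by (simp add: pairing_def)
  have "ennreal \<bar>\<integral>p. kernel \<phi> a b' p \<partial>(M \<Otimes>\<^sub>M M)\<bar> \<le> ennreal (Linf_norm M \<phi> * L1_norm M a * L1_norm M b)"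
    using integral_norm_bound_ennreal[OF int] bound by simp
  then show "\<bar>pairing M \<phi> (convolution M a b)\<bar> \<le> Linf_norm M \<phi> * L1_norm M a * L1_norm M b"
    using LinfD(3)[OF \<phi>] L1_norm_nonneg[of M b] L1_norm_nonneg[of M a] by (simp add: eq)
qed

lemma L1_borel_representative:
  assumes "b \<in> L1 M"
  obtains b' where "b' \<in> borel_measurable borel" "AE x in H. b x = b' x"
proof -
  have "b \<in> borel_measurable (completion H)"
    using L1_D[OF assms] by (simp add: completion)
  from completion_ex_borel_measurable_real[OF this] show ?thesis
    unfolding borel_measurable_H using that by blast
qed

text \<open>Once the pairing is an integral over the product, each algebraic law is a pointwise
  identity of kernels; sums and multiples of Borel representatives represent the sums and
  multiples.\<close>

lemma L1_bilinear_form_convolution: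
  assumes \<phi>: "\<phi> \<in> Linf M"
  shows "L1_bilinear_form M (\<lambda>a b. pairing M \<phi> (convolution M a b)) (Linf_norm M \<phi>)"
proof unfold_locales
  fix a b c :: "'g \<Rightarrow> real" and r :: real
  assume a: "a \<in> L1 M" and c: "c \<in> L1 M"
  obtain c' where c': "c' \<in> borel_measurable borel" "AE x in H. c x = c' x"
    using L1_borel_representative[OF c] by blast
  have ra: "(\<lambda>x. r * a x) \<in> L1 M" and rc: "(\<lambda>x. r * c x) \<in> L1 M"
    using a c by (auto simp: L1_def)
  have "kernel \<phi> (\<lambda>x. r * a x) c' = (\<lambda>p. r * kernel \<phi> a c' p)"
    by (simp add: kernel_def mult_ac)
  then show "pairing M \<phi> (convolution M (\<lambda>x. r * a x) c) = r * pairing M \<phi> (convolution M a c)"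
    by (simp add: pairing_convolution[OF \<phi> _ c c'] a ra)
  have rc': "(\<lambda>x. r * c' x) \<in> borel_measurable borel" "AE x in H. r * c x = r * c' x"
    using c' by (auto elim: eventually_mono)
  have "kernel \<phi> a (\<lambda>x. r * c' x) = (\<lambda>p. r * kernel \<phi> a c' p)"
    by (simp add: kernel_def mult_ac)
  then show "pairing M \<phi> (convolution M a (\<lambda>x. r * c x)) = r * pairing M \<phi> (convolution M a c)"
    by (simp add: pairing_convolution[OF \<phi> a rc rc'] pairing_convolution[OF \<phi> a c c'])
  show "\<bar>pairing M \<phi> (convolution M a c)\<bar> \<le> Linf_norm M \<phi> * L1_norm M a * L1_norm M c"
    by (rule pairing_convolution_bound[OF \<phi> a c c'])
  assume b: "b \<in> L1 M"
  have ab: "(\<lambda>x. a x + b x) \<in> L1 M" and bc: "(\<lambda>x. b x + c x) \<in> L1 M"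
    using a b c by (auto simp: L1_def)
  have "kernel \<phi> (\<lambda>x. a x + b x) c' = (\<lambda>p. kernel \<phi> a c' p + kernel \<phi> b c' p)"
    by (simp add: kernel_def distrib_right)
  then show "pairing M \<phi> (convolution M (\<lambda>x. a x + b x) c)
      = pairing M \<phi> (convolution M a c) + pairing M \<phi> (convolution M b c)"
    by (simp add: pairing_convolution[OF \<phi> _ c c'] a b ab integrable_kernel[OF \<phi> _ c c'])
  obtain b' where b': "b' \<in> borel_measurable borel" "AE x in H. b x = b' x"
    using L1_borel_representative[OF b] by blast
  have bc': "(\<lambda>x. b' x + c' x) \<in> borel_measurable borel" "AE x in H. b x + c x = b' x + c' x"
    using b' c' by auto
  have "kernel \<phi> a (\<lambda>x. b' x + c' x) = (\<lambda>p. kernel \<phi> a b' p + kernel \<phi> a c' p)"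
    by (simp add: kernel_def distrib_left)
  then show "pairing M \<phi> (convolution M a (\<lambda>x. b x + c x))
      = pairing M \<phi> (convolution M a b) + pairing M \<phi> (convolution M a c)"
    by (simp add: pairing_convolution[OF \<phi> a bc bc'] pairing_convolution[OF \<phi> a b b']
        pairing_convolution[OF \<phi> a c c'] integrable_kernel[OF \<phi> a b b'] integrable_kernel[OF \<phi> a c c'])
qed (rule LinfD(3)[OF \<phi>])

end

theorem theorem6p9:
  fixes M :: "'g::{topological_group_add, t2_space} measure" and \<phi> :: "'g \<Rightarrow> real"
  assumes "locally_compact_space (euclidean :: 'g topology)"
    and "complete_left_haar_measure M"
    and "sigma_finite_measure M"
    and "norm_separable (L1_norm M) (L1 M)"
    and "\<phi> \<in> Linf M"
  shows "right_asplund M \<phi> \<longleftrightarrow>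
           norm_separable (Linf_norm M) ((\<lambda>\<omega>. bidual_action M \<omega> \<phi>) ` zero_one_ba M)"
proof -
  obtain H where H: "left_haar_measure H" "M = completion H"
    using assms(2) by (auto simp: complete_left_haar_measure_def)
  interpret separable_haar H M
    using assms H by (simp add: separable_haar_def separable_haar_axioms_def)
  interpret form: L1_bilinear_form M "\<lambda>a b. pairing M \<phi> (convolution M a b)" "Linf_norm M \<phi>"
    by (rule L1_bilinear_form_convolution[OF assms(5)])
  have T: "form.T = right_action M \<phi>"
    by (rule ext) (simp add: form.T_def right_action_def)
  have S: "form.S = (\<lambda>\<omega>. bidual_action M \<omega> \<phi>)"
    by (rule ext) (simp add: form.S_def bidual_action_def T)
  show ?thesis
    using form.asplund_iff_norm_separable[OF assms(4)] by (simp add: right_asplund_def T S)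
qed

end
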